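(* Consider the model problem with constant reaction coefficient $b(x)\equiv b>0$ and $f\in H^2(I)$, and let $0<\delta<1$ be fixed. There exist constants $C,C_\delta,\tilde C_\delta>0$ independent of $\varepsilon$ and $\tau$ such that for every accuracy $\tau\in(0,1]$ and every $\varepsilon\in(0,1]$ there is a strict ReLU feedforward network $\Phi^\tau_\varepsilon$ with width $\bar W(\Phi^\tau_\varepsilon)\le C|\log_2\tau|^2$ (for $\tau$ small), depth $\bar L(\Phi^\tau_\varepsilon)\le C\tau^{-1/[2(1-\delta)]}$, and size $M(\Phi^\tau_\varepsilon)\le C_\delta\tau^{-1/[2(1-\delta)]}$, such that $$\|u_\varepsilon-\mathrm R(\Phi^\tau_\varepsilon)\|_{1,\varepsilon,I}\le\tau\le\tilde C_\delta M^{-2(1-\delta)},\qquad \|u_\varepsilon-\mathrm R(\Phi^\tau_\varepsilon)\|_{L^2(I)}\le\tau^2\le\tilde C_\delta^2M^{-4(1-\delta)},$$ where $M=M(\Phi^\tau_\varepsilon)$.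
   Context: $I=(-1,1)$, $\varepsilon\in(0,1]$; $u_\varepsilon\in H^1_0(I)$ is the weak solution of $-\varepsilon^2u''+bu=f$ in $I$, $u(\pm1)=0$. Energy norm $\|w\|_{1,\varepsilon,I}^2=\int_I(\varepsilon^2(w')^2+bw^2)dx$. A feedforward network $\Phi=((A_1,b_1),\dots,(A_L,b_L))$ has realization $\mathrm R(\Phi)$: $x_0=x$, $x_\ell=\max\{0,A_\ell x_{\ell-1}+b_\ell\}$ (componentwise) for $\ell<L$, $\mathrm R(\Phi)(x)=A_Lx_{L-1}+b_L$. Depth $\bar L=L$, width $\bar W=\max_\ell N_\ell$ (number of rows of $A_\ell$), size $M(\Phi)$ = total number of nonzero entries of all $A_\ell,b_\ell$. *)

theory Defs
  imports "HOL-Analysis.Analysis"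
begin

text \<open>g is the weak derivative of w on I, with g in L^2(I); w is identified with its
  (absolutely) continuous representative: w x = w(-1) + integral of g from -1 to x.
  This is exactly membership of w in H^1(I) with weak derivative g.\<close>
definition H1_deriv :: "(real \<Rightarrow> real) \<Rightarrow> (real \<Rightarrow> real) \<Rightarrow> bool" where
  "H1_deriv w g \<longleftrightarrow>
     set_borel_measurable lebesgue {-1..1} g \<and>
     set_integrable lebesgue {-1..1} (\<lambda>x. (g x)\<^sup>2) \<and>
     (\<forall>x\<in>{-1..1}. w x = w (-1) + (LINT t:{-1..x}|lebesgue. g t))"

definition H10 :: "(real \<Rightarrow> real) \<Rightarrow> (real \<Rightarrow> real) \<Rightarrow> bool" where
  "H10 w g \<longleftrightarrow> H1_deriv w g \<and> w (-1) = 0 \<and> w 1 = 0"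

definition H2 :: "(real \<Rightarrow> real) \<Rightarrow> bool" where
  "H2 f \<longleftrightarrow> (\<exists>g h. H1_deriv f g \<and> H1_deriv g h)"

text \<open>Weak solution u (with weak derivative u') of -eps^2 u'' + b u = f, u(+-1)=0.\<close>
definition weak_solution ::
  "real \<Rightarrow> real \<Rightarrow> (real \<Rightarrow> real) \<Rightarrow> (real \<Rightarrow> real) \<Rightarrow> (real \<Rightarrow> real) \<Rightarrow> bool" where
  "weak_solution eps b f u u' \<longleftrightarrow> H10 u u' \<and>
     (\<forall>v v'. H10 v v' \<longrightarrow>
        (LINT x:{-1..1}|lebesgue. eps\<^sup>2 * u' x * v' x + b * u x * v x)
        = (LINT x:{-1..1}|lebesgue. f x * v x))"

definition energy_norm :: "real \<Rightarrow> real \<Rightarrow> (real \<Rightarrow> real) \<Rightarrow> (real \<Rightarrow> real) \<Rightarrow> real" where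
  "energy_norm eps b w g = sqrt (LINT x:{-1..1}|lebesgue. eps\<^sup>2 * (g x)\<^sup>2 + b * (w x)\<^sup>2)"

definition L2_norm_I :: "(real \<Rightarrow> real) \<Rightarrow> real" where
  "L2_norm_I w = sqrt (LINT x:{-1..1}|lebesgue. (w x)\<^sup>2)"

text \<open>A layer is (A, b): A a matrix given as list of rows, b a bias vector.
  A network is a list of layers ((A_1,b_1),...,(A_L,b_L)).\<close>
type_synonym layer = "real list list \<times> real list"
type_synonym network = "layer list"

definition affine :: "layer \<Rightarrow> real list \<Rightarrow> real list" where
  "affine l x = map (\<lambda>(row, c). sum_list (map2 (*) row x) + c) (zip (fst l) (snd l))"

definition relu_layer :: "layer \<Rightarrow> real list \<Rightarrow> real list" where
  "relu_layer l x = map (\<lambda>y. max 0 y) (affine l x)"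

fun realize :: "network \<Rightarrow> real list \<Rightarrow> real list" where
  "realize [] x = x"
| "realize [l] x = affine l x"
| "realize (l # l' # ls) x = realize (l' # ls) (relu_layer l x)"

fun valid_layers :: "nat \<Rightarrow> network \<Rightarrow> bool" where
  "valid_layers d [] \<longleftrightarrow> d = 1"
| "valid_layers d ((A, c) # ls) \<longleftrightarrow>
     length A \<ge> 1 \<and> length c = length A \<and> (\<forall>row\<in>set A. length row = d)
     \<and> valid_layers (length A) ls"

definition relu_network :: "network \<Rightarrow> bool" where
  "relu_network \<Phi> \<longleftrightarrow> \<Phi> \<noteq> [] \<and> valid_layers 1 \<Phi>"

definition R :: "network \<Rightarrow> real \<Rightarrow> real" where
  "R \<Phi> x = hd (realize \<Phi> [x])"

definition depth :: "network \<Rightarrow> nat" where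
  "depth \<Phi> = length \<Phi>"

definition width :: "network \<Rightarrow> nat" where
  "width \<Phi> = Max (set (map (\<lambda>l. length (fst l)) \<Phi>))"

definition size_nn :: "network \<Rightarrow> nat" where
  "size_nn \<Phi> = sum_list (map (\<lambda>(A, c). length (filter (\<lambda>a. a \<noteq> 0) (concat A))
                                   + length (filter (\<lambda>a. a \<noteq> 0) c)) \<Phi>)"

end

theory Submission
  imports Defs
begin

text \<open>
  The solution splits as \<open>u = w + A exp (- k (1 + x)) + B exp (- k (1 - x))\<close> with \<open>k = sqrt b / \<epsilon>\<close>,
  where \<open>w = f / b + z\<close> and \<open>w'' = b z / \<epsilon>\<^sup>2\<close> is bounded in \<open>L\<^sup>2\<close> uniformly in \<open>\<epsilon>\<close> (test the
  equation for \<open>z\<close> with \<open>z\<close>). Each of the three parts is interpolated linearly on \<open>n = m\<^sup>2\<close> equal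
  cells (the layers only on an interval of length of order \<open>\<epsilon> ln n\<close>) with nodal values rounded to
  multiples of \<open>1 / n\<^sup>2\<close>, which costs \<open>1 / n\<^sup>2\<close> in \<open>L\<^sup>2\<close> and \<open>1 / n\<close> in energy, up to logarithms.

  The point is that such an interpolant is exactly a network of bounded width and depth of order
  \<open>m ln m\<close>, although it has \<open>m\<^sup>2\<close> pieces. The integer second differences of a block of \<open>m\<close> cells are
  packed into the binary expansion of one integer, which is a piecewise constant function of the
  position; the same \<open>m\<close> decoding steps, shared by all blocks, unpack the bits and add the
  corresponding ramps. The position inside the block and the packed integer jump between blocks. The
  garbage computed in these transitions is removed without any multiplication by clamping between two
  coarse piecewise linear barriers that meet the interpolant on the transition cells.
\<close>

section \<open>ReLU networks as register machines\<close>

text \<open>The obstacle is the count. The energy error of linear interpolation is of order 1 / n,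
  so accuracy \<tau> needs about 1 / \<tau> cells, while the network may have only slightly more
  than \<tau> powr (-1/2) weights, far fewer than one per cell. This forces n = m^2 and the reuse of
  every decoding layer by all m blocks. The reuse is affordable because rounding leaves O(ln m) bits
  per node, and because second differences enter an interpolant linearly, as coefficients of ramps:
  a bit only has to switch a ramp on or off, which one ReLU can do. The logarithm in the depth and
  the squared logarithm in the error are both dominated by m powr \<theta>. As \<delta> > 0, the
  exponent 1 / (2 (1 - \<delta>)) exceeds 1 / 2, and this surplus pays for \<theta>. The L2 rate
  comes from the same grid, since (ln n)^2 / n^2 is below the square of (ln n)^2 / n. Uniformity in
  \<epsilon> rests on layer meshes proportional to \<epsilon>, which cancel the decay rate of the
  exponentials.\<close>

definition relu :: "real \<Rightarrow> real" where
  "relu x = max 0 x"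

text \<open>Inductive closure instead of coefficient vectors: the programs below show by
  introduction rules alone that a pre-activation is affine in the available neurons, and
  \<open>affine_span_row\<close> converts this into a weight row and a bias.\<close>

inductive affine_span :: "(real \<Rightarrow> real) set \<Rightarrow> (real \<Rightarrow> real) \<Rightarrow> bool" for Z where
  const: "affine_span Z (\<lambda>x. c)"
| base: "z \<in> Z \<Longrightarrow> affine_span Z z"
| add: "affine_span Z g \<Longrightarrow> affine_span Z h \<Longrightarrow> affine_span Z (\<lambda>x. g x + h x)"
| scale: "affine_span Z g \<Longrightarrow> affine_span Z (\<lambda>x. c * g x)"

lemma affine_span_diff:
  assumes "affine_span Z g" "affine_span Z h"
  shows "affine_span Z (\<lambda>x. g x - h x)"
  using affine_span.add[OF assms(1) affine_span.scale[OF assms(2), of "-1"]] by simp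

lemma affine_span_minus: "affine_span Z g \<Longrightarrow> affine_span Z (\<lambda>x. - g x)"
  using affine_span.scale[of Z g "-1"] by simp

lemma affine_span_trans:
  assumes "affine_span Z g" "\<And>z. z \<in> Z \<Longrightarrow> affine_span Z' z"
  shows "affine_span Z' g"
  using assms(1) by induction (auto intro: affine_span.intros assms(2))

lemma affine_span_row:
  assumes "affine_span (set zs) g"
  shows "\<exists>row c. length row = length zs \<and>
    (\<forall>x. g x = sum_list (map2 (*) row (map (\<lambda>z. z x) zs)) + c)"
  using assms
proof induction
  case (const c)
  have "sum_list (map2 (*) (replicate (length zs) 0) (map (\<lambda>z. z x) zs)) = 0" for x :: real
    by (induction zs) auto
  then show ?case by (intro exI[of _ "replicate (length zs) 0"] exI[of _ c]) auto
next
  case (base z)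
  then show ?case
  proof (induction zs)
    case (Cons a zs)
    show ?case
    \<comment> \<open>\<open>zs\<close> may list a function twice; the unit weight goes to its first
      occurrence.\<close>
    proof (cases "z = a")
      case True
      have "sum_list (map2 (*) (replicate (length zs) 0) (map (\<lambda>z. z x) zs)) = 0" for x :: real
        by (induction zs) auto
      then show ?thesis using True
        by (intro exI[of _ "1 # replicate (length zs) 0"] exI[of _ 0]) auto
    next
      case False
      then obtain row c where "length row = length zs"
        "\<forall>x. z x = sum_list (map2 (*) row (map (\<lambda>z. z x) zs)) + c"
        using Cons by auto
      then show ?thesis by (intro exI[of _ "0 # row"] exI[of _ c]) auto
    qed
  qed auto
next
  case (add g h)
  then obtain r1 c1 r2 c2 where *: "length r1 = length zs" "length r2 = length zs"
    "\<And>x. g x = sum_list (map2 (*) r1 (map (\<lambda>z. z x) zs)) + c1"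
    "\<And>x. h x = sum_list (map2 (*) r2 (map (\<lambda>z. z x) zs)) + c2" by blast
  have "length r1 = length ys \<Longrightarrow> length r2 = length ys \<Longrightarrow>
    sum_list (map2 (*) (map2 (+) r1 r2) ys) = sum_list (map2 (*) r1 ys) + sum_list (map2 (*) r2 ys)"
    for ys :: "real list"
  proof (induction ys arbitrary: r1 r2)
    case (Cons a ys)
    then show ?case by (cases r1; cases r2) (auto simp: algebra_simps)
  qed auto
  with * show ?case
    by (intro exI[of _ "map2 (+) r1 r2"] exI[of _ "c1 + c2"]) auto
next
  case (scale g c)
  then obtain r1 c1 where *: "length r1 = length zs"
    "\<And>x. g x = sum_list (map2 (*) r1 (map (\<lambda>z. z x) zs)) + c1" by blast
  have "length r1 = length ys \<Longrightarrow>
    sum_list (map2 (*) (map ((*) c) r1) ys) = c * sum_list (map2 (*) r1 ys)"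
    for ys :: "real list"
  proof (induction ys arbitrary: r1)
    case (Cons a ys)
    then show ?case by (cases r1) (auto simp: algebra_simps)
  qed auto
  with * show ?case
    by (intro exI[of _ "map ((*) c) r1"] exI[of _ "c * c1"]) (auto simp: algebra_simps)
qed

lemma affine_layer_exists:
  assumes "\<forall>g\<in>set gs. affine_span (set zs) g"
  shows "\<exists>A c. length A = length gs \<and> length c = length gs \<and> (\<forall>row\<in>set A. length row = length zs) \<and>
    (\<forall>x. affine (A, c) (map (\<lambda>z. z x) zs) = map (\<lambda>g. g x) gs)"
  using assms
proof (induction gs)
  case Nil
  then show ?case by (auto simp: affine_def)
next
  case (Cons g gs)
  then obtain A c where "length A = length gs" "length c = length gs"
    "\<forall>row\<in>set A. length row = length zs"
    "\<forall>x. affine (A, c) (map (\<lambda>z. z x) zs) = map (\<lambda>g. g x) gs" by auto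
  moreover obtain row d where "length row = length zs"
    "\<forall>x. g x = sum_list (map2 (*) row (map (\<lambda>z. z x) zs)) + d"
    using affine_span_row Cons.prems by (meson list.set_intros(1))
  ultimately show ?case
    by (intro exI[of _ "row # A"] exI[of _ "d # c"]) (auto simp: affine_def)
qed

text \<open>\<open>valid_layers\<close> demands output dimension 1 and cannot describe an unfinished
  network. Here the output dimension is a parameter, so that layers can be appended at the
  end.\<close>

fun layer_chain :: "nat \<Rightarrow> network \<Rightarrow> nat \<Rightarrow> bool" where
  "layer_chain d [] e \<longleftrightarrow> d = e"
| "layer_chain d ((A, c) # ls) e \<longleftrightarrow>
     length A \<ge> 1 \<and> length c = length A \<and> (\<forall>row\<in>set A. length row = d)
     \<and> layer_chain (length A) ls e"

lemma valid_layers_iff_chain: "valid_layers d \<Phi> \<longleftrightarrow> layer_chain d \<Phi> 1"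
  by (induction d \<Phi> rule: valid_layers.induct) auto

lemma layer_chain_snoc:
  assumes "layer_chain d \<Phi> e" "length A \<ge> 1" "length c = length A" "\<forall>row\<in>set A. length row = e"
  shows "layer_chain d (\<Phi> @ [(A, c)]) (length A)"
  using assms by (induction \<Phi> arbitrary: d) auto

text \<open>\<open>realize\<close> omits the activation in the last layer only. Unfinished networks
  are therefore run by folding \<open>relu_layer\<close>, and the output layer is the one appended
  here.\<close>

lemma realize_snoc: "realize (\<Phi> @ [l]) x = affine l (fold relu_layer \<Phi> x)"
proof (induction \<Phi> arbitrary: x)
  case (Cons k \<Phi>)
  then show ?case by (cases \<Phi>) auto
qed auto

lemma size_nn_le:
  assumes "layer_chain d \<Phi> e" "d \<le> w" "\<forall>l\<in>set \<Phi>. length (fst l) \<le> w"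
  shows "size_nn \<Phi> \<le> length \<Phi> * (w * w + w)"
  using assms
proof (induction \<Phi> arbitrary: d)
  case (Cons l \<Phi>)
  obtain A c where l: "l = (A, c)" by (cases l)
  have "\<forall>row\<in>set A. length row = d" using Cons.prems(1) l by auto
  then have "length (concat A) = length A * d" by (induction A) auto
  also have "\<dots> \<le> w * w" using Cons.prems l by (intro mult_mono) auto
  finally have "length (filter (\<lambda>a. a \<noteq> 0) (concat A)) \<le> w * w"
    using length_filter_le order_trans by blast
  moreover have "length (filter (\<lambda>a. a \<noteq> 0) c) \<le> w"
    using Cons.prems l length_filter_le[of _ c] by (force intro: order_trans)
  moreover have "size_nn \<Phi> \<le> length \<Phi> * (w * w + w)"
    using Cons.prems l by (intro Cons.IH[of "length A"]) auto
  ultimately show ?case by (auto simp: size_nn_def l)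
qed (auto simp: size_nn_def)

definition hidden :: "nat \<Rightarrow> nat \<Rightarrow> (real \<Rightarrow> real) list \<Rightarrow> bool" where
  "hidden w L zs \<longleftrightarrow> (\<exists>\<Phi>. length \<Phi> = L \<and> layer_chain 1 \<Phi> (length zs) \<and>
     (\<forall>l\<in>set \<Phi>. length (fst l) \<le> w) \<and> (\<forall>x. fold relu_layer \<Phi> [x] = map (\<lambda>z. z x) zs))"

lemma hidden_step:
  assumes "hidden w L zs" "\<forall>g\<in>set gs. affine_span (set zs) g" "gs \<noteq> []" "length gs \<le> w"
  shows "hidden w (Suc L) (map (\<lambda>g x. relu (g x)) gs)"
proof -
  obtain \<Phi> where \<Phi>: "length \<Phi> = L" "layer_chain 1 \<Phi> (length zs)"
     "\<forall>l\<in>set \<Phi>. length (fst l) \<le> w" "\<forall>x. fold relu_layer \<Phi> [x] = map (\<lambda>z. z x) zs"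
    using assms(1) unfolding hidden_def by blast
  obtain A c where Ac: "length A = length gs" "length c = length gs"
    "\<forall>row\<in>set A. length row = length zs"
    "\<forall>x. affine (A, c) (map (\<lambda>z. z x) zs) = map (\<lambda>g. g x) gs"
    using affine_layer_exists[OF assms(2)] by blast
  have "layer_chain 1 (\<Phi> @ [(A, c)]) (length A)"
    using assms(3) Ac \<Phi> by (intro layer_chain_snoc) (auto simp: Suc_le_eq)
  then show ?thesis unfolding hidden_def using \<Phi> Ac assms(4)
    by (intro exI[of _ "\<Phi> @ [(A, c)]"]) (auto simp: relu_layer_def relu_def)
qed

text \<open>Registers are affine combinations of the current neurons, not neurons themselves: they
  may be negative, and affine operations on them cost no depth
  (\<open>registers_affine\<close>).\<close>

definition registers :: "nat \<Rightarrow> nat \<Rightarrow> (real \<Rightarrow> real) list \<Rightarrow> bool" where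
  "registers w L fs \<longleftrightarrow> (\<exists>zs. hidden w L zs \<and> (\<forall>f\<in>set fs. affine_span (set zs) f))"

lemma registers_input: "registers w 0 [\<lambda>x. x]"
proof -
  have "hidden w 0 [\<lambda>x. x]" unfolding hidden_def by (auto intro!: exI[of _ "[]"])
  then show ?thesis unfolding registers_def by (intro exI[of _ "[\<lambda>x. x]"]) (auto intro: affine_span.base)
qed

lemma registers_affine:
  assumes "registers w L fs" "\<And>g. g \<in> set gs \<Longrightarrow> affine_span (set fs) g"
  shows "registers w L gs"
  using assms unfolding registers_def by (meson affine_span_trans)

text \<open>Old registers survive a layer as differences of two ReLU neurons.\<close>
lemma registers_relu:
  assumes "registers w L fs" "\<And>g. g \<in> set es \<Longrightarrow> affine_span (set fs) g"
    "fs \<noteq> []" "length es + 2 * length fs \<le> w"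
  shows "registers w (Suc L) (fs @ map (\<lambda>g x. relu (g x)) es)"
proof -
  obtain zs where zs: "hidden w L zs" "\<forall>f\<in>set fs. affine_span (set zs) f"
    using assms(1) unfolding registers_def by blast
  define gs where "gs = es @ fs @ map (\<lambda>f x. - f x) fs"
  define zs' where "zs' = map (\<lambda>g x. relu (g x)) gs"
  have "hidden w (Suc L) zs'" unfolding zs'_def
    using assms zs by (intro hidden_step[OF zs(1)]) (auto simp: gs_def intro: affine_span_minus affine_span_trans)
  moreover have "affine_span (set zs') f" if "f \<in> set fs" for f
  proof -
    have "affine_span (set zs') (\<lambda>x. relu (f x) - relu (- f x))"
      using that by (intro affine_span_diff affine_span.base) (auto simp: zs'_def gs_def)
    moreover have "(\<lambda>x. relu (f x) - relu (- f x)) = f" by (auto simp: relu_def)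
    ultimately show ?thesis by simp
  qed
  moreover have "affine_span (set zs') (\<lambda>x. relu (g x))" if "g \<in> set es" for g
    using that by (intro affine_span.base) (auto simp: zs'_def gs_def)
  ultimately show ?thesis unfolding registers_def by (intro exI[of _ zs']) auto
qed

text \<open>The extra splitting layer makes the output row [1, -1] whatever f is, which secures
  \<open>1 \<le> size_nn \<Phi>\<close>. The rates of the theorem raise the size to a negative
  power, and \<open>0 powr a = 0\<close> would make them fail for a network of size zero.\<close>

lemma registers_network:
  assumes "registers w L fs" "f \<in> set fs" "2 \<le> w"
  shows "\<exists>\<Phi>. relu_network \<Phi> \<and> width \<Phi> \<le> w \<and> depth \<Phi> = L + 2 \<and> 1 \<le> size_nn \<Phi> \<and>
     size_nn \<Phi> \<le> (L + 2) * (w * w + w) \<and> R \<Phi> = f"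
proof -
  obtain zs where zs: "hidden w L zs" "affine_span (set zs) f"
    using assms(1,2) unfolding registers_def by blast
  have "hidden w (Suc L) (map (\<lambda>g x. relu (g x)) [f, \<lambda>x. - f x])"
    using zs assms(3) by (intro hidden_step[OF zs(1)]) (auto intro: affine_span_minus)
  then obtain \<Phi> where \<Phi>: "length \<Phi> = Suc L" "layer_chain 1 \<Phi> (Suc (Suc 0))"
     "\<forall>l\<in>set \<Phi>. length (fst l) \<le> w" "\<forall>x. fold relu_layer \<Phi> [x] = [relu (f x), relu (- f x)]"
    unfolding hidden_def by auto
  define \<Psi> where "\<Psi> = \<Phi> @ [([[1, -1]], [0])]"
  have chain: "layer_chain 1 \<Psi> 1"
    unfolding \<Psi>_def using layer_chain_snoc[OF \<Phi>(2), of "[[1, -1]]" "[0]"] by simp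
  have wd: "\<forall>l\<in>set \<Psi>. length (fst l) \<le> w" using \<Phi> assms(3) by (auto simp: \<Psi>_def)
  have "R \<Psi> x = f x" for x
    using \<Phi>(4) by (auto simp: R_def \<Psi>_def realize_snoc affine_def relu_def)
  moreover have "width \<Psi> \<le> w" unfolding width_def using wd
    by (subst Max_le_iff) (auto simp: \<Psi>_def)
  moreover have "size_nn \<Psi> \<le> length \<Psi> * (w * w + w)"
    using size_nn_le[OF chain _ wd] assms(3) by simp
  moreover have "1 \<le> size_nn \<Psi>" by (simp add: \<Psi>_def size_nn_def)
  ultimately show ?thesis
    using chain \<Phi>(1) by (intro exI[of _ \<Psi>])
      (auto simp: relu_network_def valid_layers_iff_chain depth_def \<Psi>_def)
qed

section \<open>Piecewise linear functions and bit extraction\<close>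

text \<open>The entry at 0 is the first slope itself, because \<open>pl\<close> is constant to the
  left of 0.\<close>

definition second_diff :: "(nat \<Rightarrow> real) \<Rightarrow> nat \<Rightarrow> real" where
  "second_diff y i = y (i + 1) - y i - (if i = 0 then 0 else y i - y (i - 1))"

text \<open>To the right of N the ramps continue with slope y (N + 1) - y N, so the entry y (N + 1)
  decides whether the extension is constant.\<close>

definition pl :: "nat \<Rightarrow> (nat \<Rightarrow> real) \<Rightarrow> real \<Rightarrow> real" where
  "pl N y s = y 0 + (\<Sum>i\<le>N. second_diff y i * relu (s - real i))"

lemma sum_second_diff: "(\<Sum>i\<le>j. second_diff y i) = y (j + 1) - y j"
  by (induction j) (auto simp: second_diff_def)

lemma sum_second_diff_ramp:
  "y 0 + (\<Sum>i\<le>j. second_diff y i * (s - real i)) = y j + (s - real j) * (y (j + 1) - y j)"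
proof (induction j)
  case (Suc j)
  have "y 0 + (\<Sum>i\<le>Suc j. second_diff y i * (s - real i)) =
    y j + (s - real j) * (y (j + 1) - y j) + second_diff y (Suc j) * (s - real (Suc j))"
    using Suc by simp
  also have "\<dots> = y (Suc j) + (s - real (Suc j)) * (y (Suc j + 1) - y (Suc j))"
    by (simp add: second_diff_def algebra_simps)
  finally show ?case .
qed (simp add: second_diff_def algebra_simps)

lemma pl_cell_gen:
  assumes "j \<le> N" "real j \<le> s" "s \<le> real (j + 1) \<or> j = N"
  shows "pl N y s = y j + (s - real j) * (y (j + 1) - y j)"
proof -
  have "(\<Sum>i\<le>N. second_diff y i * relu (s - real i)) = (\<Sum>i\<le>j. second_diff y i * relu (s - real i))"
    using assms by (intro sum.mono_neutral_right) (auto simp: relu_def)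
  also have "\<dots> = (\<Sum>i\<le>j. second_diff y i * (s - real i))"
    using assms by (intro sum.cong) (auto simp: relu_def max_def)
  finally show ?thesis using sum_second_diff_ramp[of y s j] by (simp add: pl_def)
qed

lemma pl_cell:
  assumes "j \<le> N" "real j \<le> s" "s \<le> real (j + 1)"
  shows "pl N y s = y j + (s - real j) * (y (j + 1) - y j)"
  using pl_cell_gen assms by blast

lemma pl_left: "s \<le> 0 \<Longrightarrow> pl N y s = y 0"
  by (auto simp: pl_def relu_def intro!: sum.neutral)

lemma pl_right: "real N \<le> s \<Longrightarrow> y (N + 1) = y N \<Longrightarrow> pl N y s = y N"
  using pl_cell_gen[of N N s y] by auto

lemma pl_cong_cell:
  assumes "j \<le> N" "real j \<le> s" "s \<le> real (j + 1)" "y j = z j" "y (j + 1) = z (j + 1)"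
  shows "pl N y s = pl N z s"
  using assms by (simp add: pl_cell)

lemma pl_mono_cell:
  assumes "j \<le> N" "real j \<le> s" "s \<le> real (j + 1)" "y j \<le> z j" "y (j + 1) \<le> z (j + 1)"
  shows "pl N y s \<le> pl N z s"
proof -
  define \<theta> where "\<theta> = s - real j"
  have l: "0 \<le> \<theta>" "\<theta> \<le> 1" using assms by (auto simp: \<theta>_def)
  have eq: "pl N w s = (1 - \<theta>) * w j + \<theta> * w (j + 1)" for w
    using assms by (simp add: pl_cell \<theta>_def algebra_simps)
  show ?thesis unfolding eq using l assms by (intro add_mono mult_left_mono) auto
qed

text \<open>A two's complement expansion: the weight of the top bit is negative.\<close>

definition bit_weight :: "nat \<Rightarrow> nat \<Rightarrow> real" where
  "bit_weight B b = (if b = B then - (2 ^ B) else 2 ^ b)"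

lemma binary_expansion:
  "k < 2 ^ B \<Longrightarrow> \<exists>\<beta>. (\<forall>b. \<beta> b \<in> {0, 1::real}) \<and> real k = (\<Sum>b<B. 2 ^ b * \<beta> b)"
proof (induction B arbitrary: k)
  case 0
  then show ?case by (intro exI[of _ "\<lambda>_. 0"]) auto
next
  case (Suc B)
  define k' where "k' = (if k < 2 ^ B then k else k - 2 ^ B)"
  have "k' < 2 ^ B" using Suc.prems by (auto simp: k'_def)
  then obtain \<beta> where \<beta>: "\<forall>b. \<beta> b \<in> {0, 1::real}" "real k' = (\<Sum>b<B. 2 ^ b * \<beta> b)"
    using Suc.IH by blast
  let ?\<beta> = "\<beta>(B := if k < 2 ^ B then 0 else 1)"
  have "(\<Sum>b<Suc B. 2 ^ b * ?\<beta> b) = real k' + 2 ^ B * (if k < 2 ^ B then 0 else 1)"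
    using \<beta>(2) by simp
  also have "\<dots> = real k" by (auto simp: k'_def of_nat_diff)
  finally show ?case using \<beta>(1) by (intro exI[of _ ?\<beta>]) auto
qed

text \<open>Signed weights let one fixed list of coefficients decode positive and negative slope
  changes alike. A negative d is stored as d + 2^B in the lower bits, and the top bit of weight -2^B
  undoes the shift.\<close>

lemma twos_complement:
  fixes d :: int
  assumes "- (2 ^ B) \<le> d" "d < 2 ^ B"
  shows "\<exists>\<beta>. (\<forall>b. \<beta> b \<in> {0, 1::real}) \<and> real_of_int d = (\<Sum>b\<le>B. bit_weight B b * \<beta> b)"
proof -
  define k where "k = nat (if d < 0 then d + 2 ^ B else d)"
  have "k < 2 ^ B" using assms by (auto simp: k_def nat_less_iff)
  then obtain \<beta> where \<beta>: "\<forall>b. \<beta> b \<in> {0, 1::real}" "real k = (\<Sum>b<B. 2 ^ b * \<beta> b)"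
    using binary_expansion by blast
  let ?\<beta> = "\<beta>(B := if d < 0 then 1 else 0)"
  have "(\<Sum>b\<le>B. bit_weight B b * ?\<beta> b) = (\<Sum>b<B. 2 ^ b * \<beta> b) - 2 ^ B * (if d < 0 then 1 else 0)"
    by (simp add: lessThan_Suc_atMost[symmetric] bit_weight_def)
  also have "\<dots> = real_of_int d" using \<beta>(2) assms(1) by (auto simp: k_def)
  finally show ?thesis using \<beta>(1) by (intro exI[of _ ?\<beta>]) auto
qed

section \<open>Reading bits with ReLU units\<close>

definition top_bit :: "nat \<Rightarrow> real \<Rightarrow> real" where
  "top_bit q r = relu (r - 2 ^ q + 1) - relu (r - 2 ^ q)"

text \<open>Step e removes the bit of weight 2 ^ (E - 1 - e), in accordance with
  \<open>code\<close>, which puts the most significant bit first.\<close>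

fun remainder :: "nat \<Rightarrow> real \<Rightarrow> nat \<Rightarrow> real" where
  "remainder E r 0 = r"
| "remainder E r (Suc e) = remainder E r e - 2 ^ (E - 1 - e) * top_bit (E - 1 - e) (remainder E r e)"

definition code :: "nat \<Rightarrow> (nat \<Rightarrow> real) \<Rightarrow> nat \<Rightarrow> real" where
  "code E \<beta> e = (\<Sum>i\<in>{e..<E}. 2 ^ (E - 1 - i) * \<beta> i)"

lemma code_bounds:
  assumes "\<forall>i. \<beta> i \<in> {0, 1}" "e \<le> E"
  shows "0 \<le> code E \<beta> e \<and> code E \<beta> e \<le> 2 ^ (E - e) - 1"
  using assms(2)
proof (induction "E - e" arbitrary: e)
  case (Suc k)
  then have e: "e < E" by simp
  then have "code E \<beta> e = 2 ^ (E - 1 - e) * \<beta> e + code E \<beta> (Suc e)"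
    by (simp add: code_def sum.atLeast_Suc_lessThan)
  moreover have "0 \<le> code E \<beta> (Suc e) \<and> code E \<beta> (Suc e) \<le> 2 ^ (E - Suc e) - 1"
    using Suc e by (intro Suc.hyps) auto
  moreover have "(2::real) ^ (E - e) = 2 * 2 ^ (E - 1 - e)"
    using e by (simp flip: power_Suc add: Suc_diff_Suc)
  moreover have "\<beta> e = 0 \<or> \<beta> e = 1" using assms(1) by auto
  ultimately show ?case by auto
qed (auto simp: code_def)

text \<open>The bits below weight 2^q sum to at most 2^q - 1, so a code lies in [0, 2^q - 1] or in
  [2^q, 2^(q+1) - 1] according to its leading bit. The ramp of \<open>top_bit\<close> rises exactly
  in the gap between the two ranges and is therefore exact on codes.\<close>

lemma remainder_code:
  assumes "\<forall>i. \<beta> i \<in> {0, 1}" "e \<le> E"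
  shows "remainder E (code E \<beta> 0) e = code E \<beta> e"
    and "e < E \<Longrightarrow> top_bit (E - 1 - e) (code E \<beta> e) = \<beta> e"
proof -
  have split: "code E \<beta> e = 2 ^ (E - 1 - e) * \<beta> e + code E \<beta> (Suc e)" if "e < E" for e
    using that by (simp add: code_def sum.atLeast_Suc_lessThan)
  have top: "top_bit (E - 1 - e) (code E \<beta> e) = \<beta> e" if "e < E" for e
  proof -
    have "0 \<le> code E \<beta> (Suc e)" "code E \<beta> (Suc e) \<le> 2 ^ (E - 1 - e) - 1"
      using code_bounds[OF assms(1), of "Suc e" E] that by auto
    moreover have "\<beta> e = 0 \<or> \<beta> e = 1" using assms(1) by auto
    ultimately show ?thesis using split[OF that] by (auto simp: top_bit_def relu_def)
  qed
  show "e < E \<Longrightarrow> top_bit (E - 1 - e) (code E \<beta> e) = \<beta> e" by (rule top)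
  show "remainder E (code E \<beta> 0) e = code E \<beta> e"
    using assms(2)
  proof (induction e)
    case (Suc e)
    then have "e < E" "remainder E (code E \<beta> 0) e = code E \<beta> e" by auto
    then show ?case using top split by simp
  qed simp
qed

text \<open>A product of bit and ramp without multiplication: an unset bit shifts the argument down
  by P, which sends it to zero or below as long as P bounds t.\<close>

lemma relu_gate:
  assumes "\<beta> \<in> {0, 1}" "t \<le> P" "0 \<le> P"
  shows "relu (t + P * \<beta> - P) = \<beta> * relu t"
  using assms by (auto simp: relu_def)

text \<open>The q functions share their knots, so one new neuron per layer extends all partial sums
  at once: the depth counts knots, independently of q.\<close>

lemma registers_ramps:
  assumes "finite I" "registers w L (ss @ map f [0..<q])" "s \<in> set ss" "2 * (length ss + q) + 1 \<le> w"
  shows "registers w (L + card I)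
    (ss @ map (\<lambda>j x. f j x + (\<Sum>i\<in>I. a j i * relu (s x - real i))) [0..<q])"
  using assms(1)
proof (induction I rule: finite_induct)
  case empty
  then show ?case using assms(2) by simp
next
  case (insert k I)
  let ?old = "ss @ map (\<lambda>j x. f j x + (\<Sum>i\<in>I. a j i * relu (s x - real i))) [0..<q]"
  let ?new = "?old @ map (\<lambda>g x. relu (g x)) [\<lambda>x. s x - real k]"
  have "registers w (Suc (L + card I)) ?new"
    using insert assms(3,4)
    by (intro registers_relu) (auto intro!: affine_span_diff affine_span.const intro: affine_span.base)
  then have "registers w (Suc (L + card I))
    (ss @ map (\<lambda>j x. f j x + (\<Sum>i\<in>insert k I. a j i * relu (s x - real i))) [0..<q])"
  proof (rule registers_affine)
    fix g assume "g \<in> set (ss @ map (\<lambda>j x. f j x + (\<Sum>i\<in>insert k I. a j i * relu (s x - real i))) [0..<q])"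
    then consider "g \<in> set ss" | j where "j < q"
      "g = (\<lambda>x. f j x + (\<Sum>i\<in>insert k I. a j i * relu (s x - real i)))" by auto
    then show "affine_span (set ?new) g"
    proof cases
      case 1
      then show ?thesis by (intro affine_span.base) auto
    next
      case 2
      have "affine_span (set ?new) (\<lambda>x. (f j x + (\<Sum>i\<in>I. a j i * relu (s x - real i)))
          + a j k * relu (s x - real k))"
        using 2 by (intro affine_span.add affine_span.scale affine_span.base) auto
      moreover have "g = (\<lambda>x. (f j x + (\<Sum>i\<in>I. a j i * relu (s x - real i)))
          + a j k * relu (s x - real k))"
        using 2 insert by (auto simp: fun_eq_iff)
      ultimately show ?thesis by simp
    qed
  qed
  then show ?case using insert by simp
qed

text \<open>Two layers per bit: one evaluates the two ramps of \<open>top_bit\<close>, the other the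
  gated ramp of \<open>relu_gate\<close>; sum and remainder are then updated affinely. The bits live
  in the register r and not in the weights, so the same layers serve every block.\<close>

lemma registers_decode:
  assumes "registers w L (ss @ [t, r, g])" "2 * length ss + 10 \<le> w"
  shows "registers w (L + 2 * e) (ss @ [t, \<lambda>x. remainder E (r x) e,
    \<lambda>x. g x + (\<Sum>i<e. c i * relu (t x - k i + P * top_bit (E - 1 - i) (remainder E (r x) i) - P))])"
proof (induction e)
  case 0
  then show ?case using assms by simp
next
  case (Suc e)
  let ?r = "\<lambda>x. remainder E (r x) e"
  let ?b = "\<lambda>x. top_bit (E - 1 - e) (?r x)"
  define h where "h = (\<lambda>x. g x + (\<Sum>i<e. c i * relu (t x - k i + P * top_bit (E - 1 - i) (remainder E (r x) i) - P)))"
  let ?old = "ss @ [t, ?r, h]"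
  let ?es = "[\<lambda>x. ?r x - 2 ^ (E - 1 - e) + 1, \<lambda>x. ?r x - 2 ^ (E - 1 - e)]"
  have 1: "registers w (Suc (L + 2 * e)) (?old @ map (\<lambda>g x. relu (g x)) ?es)"
    using Suc[folded h_def] assms(2)
    by (intro registers_relu)
      (auto intro!: affine_span_diff affine_span.add affine_span.const intro: affine_span.base)
  let ?mid = "ss @ [t, ?r, h, ?b]"
  have 2: "registers w (Suc (L + 2 * e)) ?mid"
  proof (rule registers_affine[OF 1])
    fix k assume "k \<in> set ?mid"
    then show "affine_span (set (?old @ map (\<lambda>g x. relu (g x)) ?es)) k"
      by (auto simp: top_bit_def intro!: affine_span_diff intro: affine_span.base)
  qed
  let ?e = "\<lambda>x. t x - k e + P * ?b x - P"
  have 3: "registers w (Suc (Suc (L + 2 * e))) (?mid @ map (\<lambda>g x. relu (g x)) [?e])"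
    using assms(2) by (intro registers_relu[OF 2])
      (auto intro!: affine_span_diff affine_span.add affine_span.const affine_span.scale intro: affine_span.base)
  have "registers w (Suc (Suc (L + 2 * e)))
     (ss @ [t, \<lambda>x. ?r x - 2 ^ (E - 1 - e) * ?b x, \<lambda>x. h x + c e * relu (?e x)])"
    by (rule registers_affine[OF 3])
      (auto intro!: affine_span_diff affine_span.add affine_span.scale intro: affine_span.base)
  then show ?case by (simp add: h_def add.assoc)
qed

lemma registers_clamp:
  assumes "registers w L (ss @ [U, V, g])" "2 * length ss + 9 \<le> w"
  shows "registers w (L + 2) (ss @ [\<lambda>x. max (V x) (min (U x) (g x))])"
proof -
  have 1: "registers w (Suc L) ((ss @ [U, V, g]) @ map (\<lambda>g x. relu (g x)) [\<lambda>x. U x - g x])"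
    using assms(2) by (intro registers_relu[OF assms(1)])
      (auto intro!: affine_span_diff intro: affine_span.base)
  have m: "min (U x) (g x) = U x - relu (U x - g x)" for x by (auto simp: relu_def)
  have 2: "registers w (Suc L) (ss @ [V, \<lambda>x. min (U x) (g x)])"
    by (rule registers_affine[OF 1]) (auto simp: m intro!: affine_span_diff intro: affine_span.base)
  have 3: "registers w (Suc (Suc L)) ((ss @ [V, \<lambda>x. min (U x) (g x)]) @
      map (\<lambda>g x. relu (g x)) [\<lambda>x. min (U x) (g x) - V x])"
    using assms(2) by (intro registers_relu[OF 2])
      (auto intro!: affine_span_diff intro: affine_span.base)
  have M: "max (V x) (min (U x) (g x)) = V x + relu (min (U x) (g x) - V x)" for x
    by (auto simp: relu_def)
  have "registers w (Suc (Suc L)) (ss @ [\<lambda>x. max (V x) (min (U x) (g x))])"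
    by (rule registers_affine[OF 3], unfold M)
      (auto intro!: affine_span.add intro: affine_span.base)
  then show ?thesis by simp
qed

section \<open>Blocks of m cells\<close>

lemma sum_div_mod:
  fixes F :: "nat \<Rightarrow> nat \<Rightarrow> real"
  assumes "0 < q"
  shows "(\<Sum>e<p * q. F (e div q) (e mod q)) = (\<Sum>i<p. \<Sum>b<q. F i b)"
proof -
  have "(\<Sum>e<p * q. F (e div q) (e mod q)) = (\<Sum>i<p. \<Sum>e\<in>{i * q..<i * q + q}. F (e div q) (e mod q))"
    by (rule sum.nat_group[symmetric])
  also have "\<dots> = (\<Sum>i<p. \<Sum>b<q. F i b)"
  proof (rule sum.cong[OF refl])
    fix i
    have "(\<Sum>e\<in>{i * q..<i * q + q}. F (e div q) (e mod q)) =
      (\<Sum>b\<in>{0..<q}. F ((b + i * q) div q) ((b + i * q) mod q))"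
      using sum.shift_bounds_nat_ivl[of "\<lambda>e. F (e div q) (e mod q)" 0 "i * q" q] by (simp add: add.commute)
    also have "\<dots> = (\<Sum>b<q. F i b)"
      using assms by (auto simp: lessThan_atLeast0 intro!: sum.cong)
    finally show "(\<Sum>e\<in>{i * q..<i * q + q}. F (e div q) (e mod q)) = (\<Sum>b<q. F i b)" .
  qed
  finally show ?thesis .
qed

text \<open>From node a on, the interpolant is determined by its value and slope there and by the
  second differences at later nodes. No other data from the left enter, which lets the decoding
  start afresh in each block.\<close>

lemma pl_restart:
  assumes "real a \<le> s" "s \<le> real (a + p + 1)" "a + p \<le> N"
  shows "pl N y s = y a + (y (a + 1) - y a) * (s - real a) +
    (\<Sum>i<p. second_diff y (a + i + 1) * relu (s - real (a + i + 1)))"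
proof -
  let ?z = "\<lambda>i. y (a + i)"
  obtain j where j: "j \<le> p" "real (a + j) \<le> s" "s \<le> real (a + j + 1)"
  \<comment> \<open>The right end is split off since the floor there would pick the cell p +
    1.\<close>
  proof (cases "s = real (a + p + 1)")
    case True
    then show ?thesis using that[of p] by auto
  next
    case False
    let ?j = "nat \<lfloor>s - real a\<rfloor>"
    have "real ?j \<le> s - real a" "s - real a < real ?j + 1" using assms by auto
    moreover have "?j \<le> p" using False assms by (auto simp: nat_le_iff floor_le_iff)
    ultimately show ?thesis using that[of ?j] by linarith
  qed
  have "pl N y s = y (a + j) + (s - real (a + j)) * (y (a + j + 1) - y (a + j))"
    using j assms by (intro pl_cell) auto
  also have "\<dots> = pl p ?z (s - real a)"
    using j by (subst pl_cell[of j]) (auto simp: algebra_simps)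
  also have "\<dots> = y a + (\<Sum>i<Suc p. second_diff ?z i * relu (s - real a - real i))"
    by (simp add: pl_def lessThan_Suc_atMost)
  also have "\<dots> = y a + second_diff ?z 0 * relu (s - real a) +
      (\<Sum>i<p. second_diff ?z (Suc i) * relu (s - real a - real (Suc i)))"
    by (subst sum.lessThan_Suc_shift) simp
  also have "second_diff ?z 0 * relu (s - real a) = (y (a + 1) - y a) * (s - real a)"
    using assms by (simp add: second_diff_def relu_def)
  also have "(\<Sum>i<p. second_diff ?z (Suc i) * relu (s - real a - real (Suc i))) =
     (\<Sum>i<p. second_diff y (a + i + 1) * relu (s - real (a + i + 1)))"
    by (intro sum.cong) (auto simp: second_diff_def algebra_simps)
  finally show ?thesis .
qed

text \<open>The possible knots of a function that is affine on the offsets 2, ..., m of each block.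
  There are O(m) of them among m^2 cells, so such a function can be built with one layer per
  knot.\<close>

definition coarse_nodes :: "nat \<Rightarrow> nat set" where
  "coarse_nodes m = {i. i \<le> m * m \<and> i mod m \<le> 2}"

lemma finite_coarse_nodes: "finite (coarse_nodes m)"
  unfolding coarse_nodes_def by simp

lemma card_coarse_nodes:
  assumes "0 < m"
  shows "card (coarse_nodes m) \<le> 3 * (m + 1)"
proof -
  have "coarse_nodes m \<subseteq> (\<lambda>(j, k). j * m + k) ` ({..m} \<times> {..2})"
  proof
    fix i assume i: "i \<in> coarse_nodes m"
    have "i = (i div m) * m + i mod m" by simp
    moreover have "i div m \<le> m" using i div_le_mono[of i "m * m" m] assms by (auto simp: coarse_nodes_def)
    ultimately show "i \<in> (\<lambda>(j, k). j * m + k) ` ({..m} \<times> {..2})"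
      using i by (intro image_eqI[of _ _ "(i div m, i mod m)"]) (auto simp: coarse_nodes_def)
  qed
  then have "card (coarse_nodes m) \<le> card ((\<lambda>(j, k). j * m + k) ` ({..m} \<times> {..2::nat}))"
    by (intro card_mono) auto
  also have "\<dots> \<le> card ({..m} \<times> {..2::nat})" by (intro card_image_le) auto
  finally show ?thesis by (simp add: mult.commute)
qed

lemma pl_coarse:
  assumes "\<And>i. i mod m > 2 \<Longrightarrow> second_diff y i = 0"
  shows "pl (m * m) y s = y 0 + (\<Sum>i\<in>coarse_nodes m. second_diff y i * relu (s - real i))"
proof -
  have "(\<Sum>i\<le>m * m. second_diff y i * relu (s - real i)) =
    (\<Sum>i\<in>coarse_nodes m. second_diff y i * relu (s - real i))"
    using assms by (intro sum.mono_neutral_right) (auto simp: coarse_nodes_def intro: leI)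
  then show ?thesis by (simp add: pl_def)
qed

text \<open>Offset m of one block is offset 0 of the next, so affinity up to k = m covers all three
  nodes in the second difference at the offsets 3, ..., m - 1.\<close>

lemma second_diff_coarse:
  assumes "3 \<le> m" "i mod m > 2"
    and "\<And>j k. 2 \<le> k \<Longrightarrow> k \<le> m \<Longrightarrow> y (j * m + k) = \<alpha> j + \<gamma> j * real k"
  shows "second_diff y i = 0"
proof -
  define j k where "j = i div m" and "k = i mod m"
  have i: "i = j * m + k" by (simp add: j_def k_def)
  have k: "2 < k" "k < m" using assms by (auto simp: k_def)
  have "y i = \<alpha> j + \<gamma> j * real k" using assms(3)[of k j] k i by simp
  moreover have "y (i + 1) = \<alpha> j + \<gamma> j * real (k + 1)"
    using assms(3)[of "k + 1" j] k i by (simp add: add.assoc)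
  moreover have "y (i - 1) = \<alpha> j + \<gamma> j * real (k - 1)"
    using assms(3)[of "k - 1" j] k i by (cases k) auto
  ultimately show ?thesis using k i by (simp add: second_diff_def of_nat_diff algebra_simps)
qed

text \<open>For position and code, block j consists of the nodes j * m + 1, ..., j * m + m. With
  this shift by one the jump between two blocks occupies a single cell, the one from j * m to j * m
  + 1.\<close>

lemma block_index:
  fixes j k m :: nat
  assumes "1 \<le> k" "k \<le> m"
  shows "(j * m + k - 1) div m = j" "(j * m + k - 1) mod m = k - 1"
proof -
  have "j * m + k - 1 = j * m + (k - 1)" "k - 1 < m" using assms by linarith+
  then show "(j * m + k - 1) div m = j" "(j * m + k - 1) mod m = k - 1" by auto
qed

text \<open>The data of block \<open>j\<close> is packed into one integer \<open>r\<close>. The registers \<open>t, r, l\<close> jump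
  between blocks, so they are only meaningful outside the first cell of each block; the barriers
  \<open>U, V\<close> enclose the interpolant and coincide with it on exactly those first cells.\<close>

lemma registers_pl:
  fixes Y :: "nat \<Rightarrow> real"
  assumes m: "3 \<le> m" and Yint: "\<And>i. Y i \<in> \<int>"
    and Yend: "Y (m * m + 1) = Y (m * m)"
    and Ybd: "\<And>i. \<bar>second_diff Y i\<bar> < 2 ^ B"
    and Lip: "\<And>i. i < m * m \<Longrightarrow> \<bar>Y (i + 1) - Y i\<bar> \<le> \<Lambda>"
    and reg: "registers w L ss" and s: "s \<in> set ss" and w: "2 * length ss + 16 \<le> w"
  shows "\<exists>L'. L' \<le> L + 3 * (m + 1) + 2 * (m * (B + 1)) + 2 \<and>
    registers w L' (ss @ [\<lambda>x. pl (m * m) Y (s x)])"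
proof -
  have "\<exists>\<beta>. (\<forall>b. \<beta> b \<in> {0, 1::real}) \<and> second_diff Y i = (\<Sum>b\<le>B. bit_weight B b * \<beta> b)" for i
  proof -
    have "second_diff Y i \<in> \<int>" unfolding second_diff_def using Yint by auto
    then obtain d where d: "second_diff Y i = real_of_int d" by (auto elim: Ints_cases)
    have "real_of_int \<bar>d\<bar> < real_of_int (2 ^ B)" using Ybd[of i] d by simp
    then have "\<bar>d\<bar> < 2 ^ B" by (simp only: of_int_less_iff)
    then have "- (2 ^ B) \<le> d" "d < 2 ^ B" by auto
    then show ?thesis using twos_complement d by auto
  qed
  then obtain \<beta> where \<beta>: "\<And>i b. \<beta> i b \<in> {0, 1::real}"
    "\<And>i. second_diff Y i = (\<Sum>b\<le>B. bit_weight B b * \<beta> i b)" by metis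
  \<comment> \<open>On block j the register \<open>l\<close> supplies the first value and slope, so
    bits are spent only on the m - 2 nodes at the offsets 2, ..., m - 1. Decoding step e treats bit
    e mod (B + 1) of the node at offset \<open>k e\<close>.\<close>
  define E where "E = (m - 2) * (B + 1)"
  define bits where "bits j e = \<beta> (j * m + 1 + e div (B + 1) + 1) (e mod (B + 1))" for j e
  define k where "k e = real (e div (B + 1) + 2)" for e
  define c where "c e = bit_weight B (e mod (B + 1))" for e
  \<comment> \<open>From offset 2 on, the barriers are the two sides of the cone of slope \<Lambda>
    with apex at the right end of the block, which contains every sequence with increments at most
    \<Lambda> through the apex. They are affine there, so they have coarse knots only.\<close>
  define U where "U i = (if i mod m \<le> 1 then Y i
    else Y ((i div m + 1) * m) + \<Lambda> * real (m - i mod m))" for i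
  define V where "V i = (if i mod m \<le> 1 then Y i
    else Y ((i div m + 1) * m) - \<Lambda> * real (m - i mod m))" for i
  \<comment> \<open>At i = 0 truncated subtraction puts node 0 into block 0. The values of t, r and
    l at this node are felt only in the first cell and to its left, where the barriers
    coincide.\<close>
  define t where "t i = real ((i - 1) mod m + 1)" for i
  define r where "r i = code E (bits ((i - 1) div m)) 0" for i
  define l where "l i = (let j = (i - 1) div m in Y (j * m + 1) +
    (Y (j * m + 2) - Y (j * m + 1)) * real ((i - 1) mod m))" for i
  define G where "G x = pl (m * m) l x + (\<Sum>e<E. c e * relu (pl (m * m) t x - k e +
    real m * top_bit (E - 1 - e) (remainder E (pl (m * m) r x) e) - real m))" for x

  have U_in: "U (j * m + k) = Y ((j + 1) * m) + \<Lambda> * real (m - k)"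
    and V_in: "V (j * m + k) = Y ((j + 1) * m) - \<Lambda> * real (m - k)" if "2 \<le> k" "k \<le> m" for j k
    using that m by (cases "k = m"; auto simp: U_def V_def add.commute)+
  have t_in: "t (j * m + k) = real k" and r_in: "r (j * m + k) = code E (bits j) 0"
    and l_in: "l (j * m + k) = Y (j * m + 1) + (Y (j * m + 2) - Y (j * m + 1)) * (real k - 1)"
    if "1 \<le> k" "k \<le> m" for j k
    unfolding t_def r_def l_def Let_def block_index[OF that] using that by (auto simp: of_nat_diff)

  have coarse: "second_diff U i = 0" "second_diff V i = 0" "second_diff t i = 0"
    "second_diff r i = 0" "second_diff l i = 0" if "i mod m > 2" for i
  proof -
    show "second_diff U i = 0"
      by (rule second_diff_coarse[OF m that, of _ "\<lambda>j. Y ((j + 1) * m) + \<Lambda> * real m" "\<lambda>j. - \<Lambda>"])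
        (simp only: U_in, simp add: of_nat_diff algebra_simps)
    show "second_diff V i = 0"
      by (rule second_diff_coarse[OF m that, of _ "\<lambda>j. Y ((j + 1) * m) - \<Lambda> * real m" "\<lambda>j. \<Lambda>"])
        (simp only: V_in, simp add: of_nat_diff algebra_simps)
    show "second_diff t i = 0"
      by (rule second_diff_coarse[OF m that, of _ "\<lambda>j. 0" "\<lambda>j. 1"]) (subst t_in, auto)
    show "second_diff r i = 0"
      by (rule second_diff_coarse[OF m that, of _ "\<lambda>j. code E (bits j) 0" "\<lambda>j. 0"]) (subst r_in, auto)
    show "second_diff l i = 0"
      by (rule second_diff_coarse[OF m that, of _
        "\<lambda>j. Y (j * m + 1) - (Y (j * m + 2) - Y (j * m + 1))" "\<lambda>j. Y (j * m + 2) - Y (j * m + 1)"])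
        (subst l_in, auto simp: algebra_simps)
  qed

  have Lips: "\<bar>Y (i + d) - Y i\<bar> \<le> \<Lambda> * real d" if "i + d \<le> m * m" for i d
    using that
  proof (induction d)
    case (Suc d)
    then have "\<bar>Y (i + d) - Y i\<bar> \<le> \<Lambda> * real d" "\<bar>Y (i + d + 1) - Y (i + d)\<bar> \<le> \<Lambda>"
      using Lip[of "i + d"] by auto
    then show ?case by (simp add: algebra_simps)
  qed simp
  have barrier: "V i \<le> Y i \<and> Y i \<le> U i" if "i \<le> m * m" for i
  proof (cases "i mod m \<le> 1")
    case True
    then show ?thesis by (simp add: U_def V_def)
  next
    case False
    define j q where "j = i div m" and "q = i mod m"
    have i: "i = j * m + q" "q < m" using m by (auto simp: j_def q_def)
    have "j < m"
    proof (rule ccontr)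
      assume "\<not> j < m"
      then have "m * m \<le> j * m" by simp
      then show False using i(1) that False unfolding q_def[symmetric] by linarith
    qed
    then have "j * m + m \<le> m * m" using mult_le_mono1[of "j + 1" m m] by simp
    moreover have "i + (m - q) = (j + 1) * m" using i by simp
    ultimately have "\<bar>Y ((j + 1) * m) - Y i\<bar> \<le> \<Lambda> * real (m - q)"
      using Lips[of i "m - q"] by simp
    then show ?thesis using False unfolding U_def V_def j_def[symmetric] q_def[symmetric] by auto
  qed

  have clamp: "max (pl (m * m) V x) (min (pl (m * m) U x) (G x)) = pl (m * m) Y x" for x
  proof -
    have eq: "?thesis" if "pl (m * m) U x = pl (m * m) Y x" "pl (m * m) V x = pl (m * m) Y x"
      using that by simp
    consider "x \<le> 0" | "real (m * m) \<le> x" | "0 < x" "x < real (m * m)" by linarith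
    then show ?thesis
    proof cases
      case 1
      then show ?thesis by (intro eq) (auto simp: pl_left U_def V_def)
    next
      case 2
      have "U (m * m) = Y (m * m)" "V (m * m) = Y (m * m)" "U (m * m + 1) = Y (m * m)"
        "V (m * m + 1) = Y (m * m)" using m Yend by (auto simp: U_def V_def mod_Suc)
      then show ?thesis using 2 Yend by (intro eq) (auto simp: pl_right)
    next
      case 3
      define i where "i = nat \<lfloor>x\<rfloor>"
      have i: "real i \<le> x" "x \<le> real (i + 1)" using 3 by (auto simp: i_def) linarith
      have "i < m * m" using i 3 by (metis of_nat_less_iff order_le_less_trans)
      define j q where "j = i div m" and "q = i mod m"
      have iq: "i = j * m + q" "q < m" using m by (auto simp: j_def q_def)
      have jm: "(j + 1) * m \<le> m * m"
        using \<open>i < m * m\<close> by (metis j_def Suc_eq_plus1 Suc_leI less_mult_imp_div_less mult_le_mono1)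
      show ?thesis
      proof (cases "q = 0")
        case True
        moreover have "Suc (j * m) mod m = 1" using m by (simp add: mod_Suc)
        ultimately have "U i = Y i" "V i = Y i" "U (i + 1) = Y (i + 1)" "V (i + 1) = Y (i + 1)"
          using m iq by (auto simp: U_def V_def)
        then show ?thesis using i \<open>i < m * m\<close> by (intro eq pl_cong_cell[of i]) auto
      next
        case False
        then have q: "1 \<le> q" "q + 1 \<le> m" using iq by auto
        \<comment> \<open>On the remaining cells \<open>G\<close> already equals the interpolant,
          and the clamp changes nothing because the barriers enclose it.\<close>
        have "pl (m * m) V x \<le> pl (m * m) Y x" "pl (m * m) Y x \<le> pl (m * m) U x"
          using i \<open>i < m * m\<close> barrier[of i] barrier[of "i + 1"] by (auto intro!: pl_mono_cell[of i])
        moreover have "G x = pl (m * m) Y x"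
        proof -
          have tx: "pl (m * m) t x = x - real (j * m)"
            using i \<open>i < m * m\<close> t_in[of q j] t_in[of "q + 1" j] q iq
            by (subst pl_cell[of i]) (auto simp: add.assoc)
          have rx: "pl (m * m) r x = code E (bits j) 0"
            using i \<open>i < m * m\<close> r_in[of q j] r_in[of "q + 1" j] q iq
            by (subst pl_cell[of i]) (auto simp: add.assoc)
          have lx: "pl (m * m) l x = Y (j * m + 1) +
             (Y (j * m + 2) - Y (j * m + 1)) * (x - real (j * m + 1))"
          proof -
            have l0: "l i = Y (j * m + 1) + (Y (j * m + 2) - Y (j * m + 1)) * (real q - 1)"
              using l_in[of q j] q iq by simp
            have l1: "l (i + 1) = Y (j * m + 1) + (Y (j * m + 2) - Y (j * m + 1)) * real q"
              using l_in[of "q + 1" j] q iq by (simp add: add.assoc)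
            have "real i = real (j * m) + real q" using iq by simp
            then show ?thesis using i \<open>i < m * m\<close>
              by (subst pl_cell[of i], simp_all only: l0 l1) (auto simp: algebra_simps)
          qed
          have x: "real (j * m + 1) \<le> x" "x \<le> real (j * m + 1 + (m - 2) + 1)"
            using i iq q by auto
          have bits01: "\<forall>e. bits j e \<in> {0, 1}" using \<beta>(1) by (simp add: bits_def)
          have "(\<Sum>e<E. c e * relu (pl (m * m) t x - k e +
              real m * top_bit (E - 1 - e) (remainder E (pl (m * m) r x) e) - real m)) =
            (\<Sum>e<E. c e * (bits j e * relu (x - real (j * m) - k e)))"
          proof (rule sum.cong[OF refl])
            fix e assume "e \<in> {..<E}"
            then have e: "e < E" by simp
            have "top_bit (E - 1 - e) (remainder E (pl (m * m) r x) e) = bits j e"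
              unfolding rx using remainder_code[OF bits01, of e E] e by simp
            \<comment> \<open>Positions inside a block are at most m, so m is an admissible gate
              constant.\<close>
            moreover have "x - real (j * m) - k e \<le> real m" using x m by (auto simp: k_def of_nat_diff)
            ultimately show "c e * relu (pl (m * m) t x - k e +
              real m * top_bit (E - 1 - e) (remainder E (pl (m * m) r x) e) - real m) =
              c e * (bits j e * relu (x - real (j * m) - k e))"
              unfolding tx using bits01 by (subst relu_gate) auto
          qed
          also have "\<dots> = (\<Sum>i<m - 2. \<Sum>b<B + 1. bit_weight B b *
              (\<beta> (j * m + 1 + i + 1) b * relu (x - real (j * m) - real (i + 2))))"
            unfolding E_def c_def bits_def k_def
            by (rule sum_div_mod[of "B + 1" "\<lambda>i b. bit_weight B b *
              (\<beta> (j * m + 1 + i + 1) b * relu (x - real (j * m) - real (i + 2)))"]) simp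
          also have "\<dots> = (\<Sum>i<m - 2. second_diff Y (j * m + 1 + i + 1) * relu (x - real (j * m + 1 + i + 1)))"
          proof (rule sum.cong[OF refl])
            fix i
            have "relu (x - real (j * m) - real (i + 2)) = relu (x - real (j * m + 1 + i + 1))"
              by (simp add: algebra_simps)
            then show "(\<Sum>b<B + 1. bit_weight B b *
                (\<beta> (j * m + 1 + i + 1) b * relu (x - real (j * m) - real (i + 2)))) =
              second_diff Y (j * m + 1 + i + 1) * relu (x - real (j * m + 1 + i + 1))"
              unfolding \<beta>(2) by (simp only: sum_distrib_right mult.assoc Suc_eq_plus1[symmetric] lessThan_Suc_atMost)
          qed
          finally show ?thesis unfolding G_def lx
            using pl_restart[OF x, of "m * m" Y] jm m by (simp add: add.commute)
        qed
        ultimately show ?thesis by simp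
      qed
    qed
  qed

  let ?fs = "[U, V, t, r, l]"
  \<comment> \<open>Each of the five functions starts as its value at node 0, the constant term of
    \<open>pl\<close>; \<open>registers_ramps\<close> adds the rest.\<close>
  have "registers w L (ss @ map (\<lambda>j x. (?fs ! j) 0) [0..<5])"
    by (rule registers_affine[OF reg]) (auto intro: affine_span.base affine_span.const)
  then have "registers w (L + card (coarse_nodes m)) (ss @ map (\<lambda>j x. (?fs ! j) 0 +
      (\<Sum>i\<in>coarse_nodes m. second_diff (?fs ! j) i * relu (s x - real i))) [0..<5])"
    using s w by (intro registers_ramps finite_coarse_nodes) auto
  moreover have "map (\<lambda>j x. (?fs ! j) 0 +
      (\<Sum>i\<in>coarse_nodes m. second_diff (?fs ! j) i * relu (s x - real i))) [0..<5] =
    [\<lambda>x. pl (m * m) U (s x), \<lambda>x. pl (m * m) V (s x), \<lambda>x. pl (m * m) t (s x),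
     \<lambda>x. pl (m * m) r (s x), \<lambda>x. pl (m * m) l (s x)]"
    using coarse by (simp add: pl_coarse upt_rec numeral_nat)
  ultimately have "registers w (L + card (coarse_nodes m))
    ((ss @ [\<lambda>x. pl (m * m) U (s x), \<lambda>x. pl (m * m) V (s x)]) @
     [\<lambda>x. pl (m * m) t (s x), \<lambda>x. pl (m * m) r (s x), \<lambda>x. pl (m * m) l (s x)])" by simp
  from registers_decode[OF this, of E E c k "real m"]
  have "registers w (L + card (coarse_nodes m) + 2 * E)
    ((ss @ [\<lambda>x. pl (m * m) U (s x), \<lambda>x. pl (m * m) V (s x)]) @
     [\<lambda>x. pl (m * m) t (s x), \<lambda>x. remainder E (pl (m * m) r (s x)) E, \<lambda>x. G (s x)])"
    using w unfolding G_def by simp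
  then have "registers w (L + card (coarse_nodes m) + 2 * E)
    (ss @ [\<lambda>x. pl (m * m) U (s x), \<lambda>x. pl (m * m) V (s x), \<lambda>x. G (s x)])"
    by (rule registers_affine) (auto intro: affine_span.base)
  from registers_clamp[OF this] have "registers w (L + card (coarse_nodes m) + 2 * E + 2)
    (ss @ [\<lambda>x. pl (m * m) Y (s x)])" using w by (simp add: clamp)
  moreover have "E \<le> m * (B + 1)" unfolding E_def by (rule mult_le_mono1) simp
  ultimately show ?thesis using card_coarse_nodes[of m] m
    by (intro exI[of _ "L + card (coarse_nodes m) + 2 * E + 2"]) auto
qed

section \<open>Square integrable weak derivatives\<close>

abbreviation D :: "real set" where "D \<equiv> {-1..1}"

definition L2 :: "(real \<Rightarrow> real) \<Rightarrow> bool" where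
  "L2 g \<longleftrightarrow> set_borel_measurable lebesgue D g \<and> set_integrable lebesgue D (\<lambda>x. (g x)\<^sup>2)"

lemma set_measurable_mult:
  assumes "set_borel_measurable lebesgue D p" "set_borel_measurable lebesgue D q"
  shows "set_borel_measurable lebesgue D (\<lambda>x. p x * q x :: real)"
proof -
  have "(\<lambda>x. (indicator D x *\<^sub>R p x) * (indicator D x *\<^sub>R q x)) \<in> borel_measurable lebesgue"
    using assms unfolding set_borel_measurable_def by measurable
  moreover have "(\<lambda>x. (indicator D x *\<^sub>R p x) * (indicator D x *\<^sub>R q x)) = (\<lambda>x. indicator D x *\<^sub>R (p x * q x))"
    by (auto simp: indicator_def)
  ultimately show ?thesis by (simp add: set_borel_measurable_def)
qed

lemma set_measurable_add:
  assumes "set_borel_measurable lebesgue D p" "set_borel_measurable lebesgue D q"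
  shows "set_borel_measurable lebesgue D (\<lambda>x. p x + q x :: real)"
proof -
  have "(\<lambda>x. (indicator D x *\<^sub>R p x) + (indicator D x *\<^sub>R q x)) \<in> borel_measurable lebesgue"
    using assms unfolding set_borel_measurable_def by measurable
  moreover have "(\<lambda>x. (indicator D x *\<^sub>R p x) + (indicator D x *\<^sub>R q x)) = (\<lambda>x. indicator D x *\<^sub>R (p x + q x))"
    by (auto simp: indicator_def)
  ultimately show ?thesis by (simp add: set_borel_measurable_def)
qed

lemma set_integrable_const_D: "set_integrable lebesgue D (\<lambda>x. c :: real)"
  by (intro absolutely_integrable_continuous_real) auto

lemma L2_mult:
  assumes "L2 p" "L2 q"
  shows "set_integrable lebesgue D (\<lambda>x. p x * q x)"
proof (rule set_integrable_bound)
  show "set_integrable lebesgue D (\<lambda>x. (p x)\<^sup>2 + (q x)\<^sup>2)"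
    using assms by (intro set_integral_add) (auto simp: L2_def)
  show "set_borel_measurable lebesgue D (\<lambda>x. p x * q x)"
    using assms by (intro set_measurable_mult) (auto simp: L2_def)
  have "\<bar>p x * q x\<bar> \<le> (p x)\<^sup>2 + (q x)\<^sup>2" for x
  proof -
    have "2 * \<bar>p x * q x\<bar> \<le> (p x)\<^sup>2 + (q x)\<^sup>2"
      using sum_squares_bound[of "\<bar>p x\<bar>" "\<bar>q x\<bar>"] by (simp add: abs_mult)
    then show ?thesis using abs_ge_zero[of "p x * q x"] by linarith
  qed
  then show "AE x in lebesgue. x \<in> D \<longrightarrow> norm (p x * q x) \<le> norm ((p x)\<^sup>2 + (q x)\<^sup>2)"
    by simp
qed

lemma L2_add:
  assumes "L2 p" "L2 q"
  shows "L2 (\<lambda>x. p x + q x)"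
  unfolding L2_def
proof
  show "set_borel_measurable lebesgue D (\<lambda>x. p x + q x)"
    using assms by (intro set_measurable_add) (auto simp: L2_def)
  have "set_integrable lebesgue D (\<lambda>x. (p x)\<^sup>2 + ((q x)\<^sup>2 + 2 * (p x * q x)))"
    using assms L2_mult[OF assms] by (intro set_integral_add set_integrable_mult_right) (auto simp: L2_def)
  then show "set_integrable lebesgue D (\<lambda>x. (p x + q x)\<^sup>2)"
    by (simp add: power2_eq_square algebra_simps)
qed

lemma L2_continuous:
  assumes "continuous_on D p"
  shows "L2 p"
proof -
  have "set_integrable lebesgue D p" "set_integrable lebesgue D (\<lambda>x. (p x)\<^sup>2)"
    using assms by (auto intro!: absolutely_integrable_continuous_real continuous_intros)
  then show ?thesis
    unfolding L2_def set_integrable_def set_borel_measurable_def by (blast intro: borel_measurable_integrable)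
qed

lemma L2_const: "L2 (\<lambda>x. c)"
  by (intro L2_continuous continuous_intros)

lemma L2_scale: "L2 p \<Longrightarrow> L2 (\<lambda>x. c * p x)"
  unfolding L2_def using set_measurable_mult[of "\<lambda>x. c" p] L2_const[of c]
  by (auto simp: L2_def power_mult_distrib)

lemma L2_diff: "L2 p \<Longrightarrow> L2 q \<Longrightarrow> L2 (\<lambda>x. p x - q x)"
  using L2_add[of p "\<lambda>x. -1 * q x"] L2_scale[of q "-1"] by simp

lemma L2_integrable: "L2 p \<Longrightarrow> set_integrable lebesgue D p"
  using L2_mult[of p "\<lambda>x. 1"] L2_const by simp

lemma set_integrable_sub:
  "set_integrable lebesgue D (g :: real \<Rightarrow> real) \<Longrightarrow> {a..b} \<subseteq> D \<Longrightarrow> set_integrable lebesgue {a..b} g"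
  by (rule set_integrable_subset) auto

lemma H1_deriv_L2: "H1_deriv w g \<Longrightarrow> L2 g"
  unfolding H1_deriv_def L2_def by blast

text \<open>Passes from the Lebesgue integral in \<open>H1_deriv\<close> to the gauge integral, for
  which interval additivity and the fundamental theorem of calculus are at hand;
  \<open>H1_derivI\<close> is the way back.\<close>

lemma H1_deriv_integral:
  assumes "H1_deriv w g" "x \<in> D"
  shows "w x = w (-1) + integral {-1..x} g"
proof -
  have "set_integrable lebesgue {-1..x} g"
    by (rule set_integrable_sub[OF L2_integrable[OF H1_deriv_L2[OF assms(1)]]]) (use assms(2) in auto)
  moreover have "w x = w (-1) + (LINT t:{-1..x}|lebesgue. g t)"
    using assms unfolding H1_deriv_def by blast
  ultimately show ?thesis using set_lebesgue_integral_eq_integral(2)[of "{-1..x}" g] by simp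
qed

lemma L2_integrable_on: "L2 g \<Longrightarrow> {a..b} \<subseteq> D \<Longrightarrow> g integrable_on {a..b}"
  using set_integrable_sub[OF L2_integrable] set_lebesgue_integral_eq_integral(1) by blast

lemma H1_derivI:
  assumes "L2 g" "\<And>x. x \<in> D \<Longrightarrow> w x = w (-1) + integral {-1..x} g"
  shows "H1_deriv w g"
  unfolding H1_deriv_def
proof (intro conjI ballI)
  fix x :: real assume x: "x \<in> D"
  have "set_integrable lebesgue {-1..x} g"
    by (rule set_integrable_sub[OF L2_integrable[OF assms(1)]]) (use x in auto)
  from set_lebesgue_integral_eq_integral(2)[OF this] show "w x = w (-1) + (LINT t:{-1..x}|lebesgue. g t)"
    using assms(2)[OF x] by metis
qed (use assms(1) in \<open>auto simp: L2_def\<close>)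

lemma H1_deriv_add:
  assumes "H1_deriv w g" "H1_deriv v k"
  shows "H1_deriv (\<lambda>x. w x + v x) (\<lambda>x. g x + k x)"
proof (rule H1_derivI)
  show "L2 (\<lambda>x. g x + k x)" using assms by (intro L2_add H1_deriv_L2)
  fix x :: real assume x: "x \<in> D"
  then have "{-1..x} \<subseteq> D" by auto
  then have "integral {-1..x} (\<lambda>x. g x + k x) = integral {-1..x} g + integral {-1..x} k"
    using assms by (intro Henstock_Kurzweil_Integration.integral_add L2_integrable_on H1_deriv_L2)
  then show "w x + v x = w (- 1) + v (- 1) + integral {- 1..x} (\<lambda>x. g x + k x)"
    using H1_deriv_integral[OF assms(1) x] H1_deriv_integral[OF assms(2) x] by simp
qed

lemma H1_deriv_scale:
  assumes "H1_deriv w g"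
  shows "H1_deriv (\<lambda>x. c * w x) (\<lambda>x. c * g x)"
proof (rule H1_derivI)
  show "L2 (\<lambda>x. c * g x)" using assms by (intro L2_scale H1_deriv_L2)
  fix x :: real assume x: "x \<in> D"
  show "c * w x = c * w (- 1) + integral {- 1..x} (\<lambda>x. c * g x)"
    using H1_deriv_integral[OF assms x] by (simp add: algebra_simps)
qed

lemma H1_deriv_diff:
  assumes "H1_deriv w g" "H1_deriv v k"
  shows "H1_deriv (\<lambda>x. w x - v x) (\<lambda>x. g x - k x)"
  using H1_deriv_add[OF assms(1) H1_deriv_scale[OF assms(2), of "-1"]] by simp

lemma H1_deriv_const: "H1_deriv (\<lambda>x. c) (\<lambda>x. 0)"
  by (rule H1_derivI) (auto simp: L2_const)

lemma H1_deriv_sum: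
  assumes "finite I" "\<And>i. i \<in> I \<Longrightarrow> H1_deriv (w i) (g i)"
  shows "H1_deriv (\<lambda>x. \<Sum>i\<in>I. w i x) (\<lambda>x. \<Sum>i\<in>I. g i x)"
  using assms by (induction I rule: finite_induct) (auto intro: H1_deriv_const H1_deriv_add)

lemma H1_deriv_cong:
  assumes "H1_deriv w g" "\<And>x. x \<in> D \<Longrightarrow> w x = v x"
  shows "H1_deriv v g"
proof (rule H1_derivI[OF H1_deriv_L2[OF assms(1)]])
  fix x :: real assume x: "x \<in> D"
  show "v x = v (-1) + integral {-1..x} g"
    using H1_deriv_integral[OF assms(1) x] assms(2)[OF x] assms(2)[of "-1"] by simp
qed

text \<open>The finite exceptional set absorbs the kinks of ReLU functions; continuity across it
  keeps the fundamental theorem of calculus valid.\<close>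

lemma H1_deriv_C1:
  assumes "finite S" "continuous_on D w" "\<And>x. x \<in> D - S \<Longrightarrow> (w has_real_derivative g x) (at x)" "L2 g"
  shows "H1_deriv w g"
proof (rule H1_derivI[OF assms(4)])
  fix x :: real assume x: "x \<in> D"
  have "(g has_integral (w x - w (-1))) {-1..x}"
    using x assms(1-3)
    by (intro fundamental_theorem_of_calculus_interior_strong[of S])
      (auto intro: continuous_on_subset simp flip: has_real_derivative_iff_has_vector_derivative)
  then show "w x = w (- 1) + integral {- 1..x} g" by (simp add: integral_unique)
qed

lemma H1_deriv_continuous:
  assumes "H1_deriv w g"
  shows "continuous_on D w"
proof -
  have "continuous_on D (\<lambda>x. w (-1) + integral {-1..x} g)"
    using assms by (intro continuous_intros indefinite_integral_continuous_1 L2_integrable_on H1_deriv_L2) auto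
  moreover have "continuous_on D (\<lambda>x. w (-1) + integral {-1..x} g) = continuous_on D w"
    by (rule continuous_on_cong[OF refl]) (rule H1_deriv_integral[OF assms, symmetric])
  ultimately show ?thesis by blast
qed

lemma H1_deriv_L2_self: "H1_deriv w g \<Longrightarrow> L2 w"
  by (intro L2_continuous H1_deriv_continuous)

section \<open>Fubini on a triangle and integration by parts\<close>

lemma lebesgue_integrable_borel_rep:
  fixes P :: "real \<Rightarrow> real"
  assumes "integrable lebesgue P"
  obtains P' where "integrable lborel P'" "AE x in lebesgue. P x = P' x"
proof -
  obtain P' where P': "P' \<in> borel_measurable lborel" "AE x in lborel. P x = P' x"
    using completion_ex_borel_measurable_real[of P lborel] borel_measurable_integrable[OF assms] by auto
  have ae: "AE x in lebesgue. P x = P' x" using P'(2) by (rule AE_completion)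
  have "P' \<in> borel_measurable lebesgue" using P'(1) by (rule measurable_completion)
  then have "integrable lebesgue P'"
    using integrable_cong_AE[OF borel_measurable_integrable[OF assms] _ ae] assms by blast
  then have "integrable lborel P'" using P'(1) by (simp add: integrable_completion)
  then show ?thesis using that ae by blast
qed

text \<open>Fubini on the triangle t \<le> x. It takes the place of the product rule, since
  antiderivatives of L2 functions need not be differentiable everywhere.\<close>

lemma integral_triangle_swap_lborel:
  fixes P Q :: "real \<Rightarrow> real"
  assumes "integrable lborel P" "integrable lborel Q"
  shows "(LINT x|lborel. Q x * (LINT t|lborel. indicator {..x} t * P t)) =
         (LINT t|lborel. P t * (LINT x|lborel. indicator {t..} x * Q x))"
proof -
  have [measurable]: "P \<in> borel_measurable borel" "Q \<in> borel_measurable borel"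
    using assms by auto
  let ?F = "\<lambda>x t. Q x * (indicator {(x, t). t \<le> x} (x, t) * P t)"
  have "integrable (lborel \<Otimes>\<^sub>M lborel) (\<lambda>(x, t). Q x * P t)"
    using assms by (intro lborel_pair.Fubini_integrable) (auto simp: abs_mult)
  then have "integrable (lborel \<Otimes>\<^sub>M lborel) (case_prod ?F)"
    by (rule Bochner_Integration.integrable_bound) (auto simp: indicator_def)
  from lborel_pair.Fubini_integral[OF this]
  have "(LINT t|lborel. LINT x|lborel. ?F x t) = (LINT x|lborel. LINT t|lborel. ?F x t)" .
  moreover have "(LINT x|lborel. ?F x t) = P t * (LINT x|lborel. indicator {t..} x * Q x)" for t
  proof -
    have "(\<lambda>x. ?F x t) = (\<lambda>x. P t * (indicator {t..} x * Q x))" by (auto simp: indicator_def)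
    then show ?thesis by simp
  qed
  moreover have "(LINT t|lborel. ?F x t) = Q x * (LINT t|lborel. indicator {..x} t * P t)" for x
  proof -
    have "(\<lambda>t. ?F x t) = (\<lambda>t. Q x * (indicator {..x} t * P t))" by (auto simp: indicator_def)
    then show ?thesis by simp
  qed
  ultimately show ?thesis by (simp only:)
qed

lemma integral_triangle_swap:
  fixes P Q :: "real \<Rightarrow> real"
  assumes P: "integrable lebesgue P" and Q: "integrable lebesgue Q"
  shows "(LINT x|lebesgue. Q x * (LINT t|lebesgue. indicator {..x} t * P t)) =
         (LINT t|lebesgue. P t * (LINT x|lebesgue. indicator {t..} x * Q x))"
proof -
  \<comment> \<open>The product-space argument runs over Borel functions, so the completed measure
    is traded for Borel representatives.\<close>
  obtain P' where P': "integrable lborel P'" "AE x in lebesgue. P x = P' x"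
    using lebesgue_integrable_borel_rep[OF P] .
  obtain Q' where Q': "integrable lborel Q'" "AE x in lebesgue. Q x = Q' x"
    using lebesgue_integrable_borel_rep[OF Q] .
  have m: "P' \<in> borel_measurable borel" "Q' \<in> borel_measurable borel" using P' Q' by auto
  note [measurable] = m
  \<comment> \<open>Only F is exchanged for its representative; the factor H has to be Borel, which
    \<open>A'\<close> and \<open>B'\<close> establish for the inner integrals.\<close>
  have rep: "(LINT x|lebesgue. H x * F x) = (LINT x|lborel. H x * G x)"
    if "AE x in lebesgue. F x = G x" "F \<in> borel_measurable lebesgue"
      "G \<in> borel_measurable borel" "H \<in> borel_measurable borel" for F G H :: "real \<Rightarrow> real"
  proof -
    have [measurable]: "F \<in> borel_measurable lebesgue" "G \<in> borel_measurable lebesgue" "H \<in> borel_measurable lebesgue"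
      using that by (auto intro: measurable_completion)
    have "(LINT x|lebesgue. H x * F x) = (LINT x|lebesgue. H x * G x)"
      by (rule integral_cong_AE) (use that(1) in auto)
    also have "\<dots> = (LINT x|lborel. H x * G x)"
      using that by (intro integral_completion) auto
    finally show ?thesis .
  qed
  have mP: "P \<in> borel_measurable lebesgue" and mQ: "Q \<in> borel_measurable lebesgue" using P Q by auto
  have A: "(LINT t|lebesgue. indicator {..x} t * P t) = (LINT t|lborel. indicator {..x} t * P' t)" for x
    by (rule rep[OF P'(2) mP m(1)]) auto
  have B: "(LINT t|lebesgue. indicator {x..} t * Q t) = (LINT t|lborel. indicator {x..} t * Q' t)" for x
    by (rule rep[OF Q'(2) mQ m(2)]) auto
  have [measurable]: "(\<lambda>p. indicator {..fst p} (snd p) * P' (snd p) :: real) \<in> borel_measurable (borel \<Otimes>\<^sub>M borel)"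
  proof -
    have "(\<lambda>p. indicator {..fst p} (snd p) * P' (snd p) :: real) = (\<lambda>p. if snd p \<le> fst p then P' (snd p) else 0)"
      by (auto simp: indicator_def)
    then show ?thesis by simp
  qed
  have [measurable]: "(\<lambda>p. indicator {fst p..} (snd p) * Q' (snd p) :: real) \<in> borel_measurable (borel \<Otimes>\<^sub>M borel)"
  proof -
    have "(\<lambda>p. indicator {fst p..} (snd p) * Q' (snd p) :: real) = (\<lambda>p. if fst p \<le> snd p then Q' (snd p) else 0)"
      by (auto simp: indicator_def)
    then show ?thesis by simp
  qed
  have A': "(\<lambda>x. LINT t|lborel. indicator {..x} t * P' t) \<in> borel_measurable borel"
    by (rule lborel.borel_measurable_lebesgue_integral) (simp add: split_beta')
  have B': "(\<lambda>x. LINT t|lborel. indicator {x..} t * Q' t) \<in> borel_measurable borel"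
    by (rule lborel.borel_measurable_lebesgue_integral) (simp add: split_beta')
  have "(LINT x|lebesgue. (LINT t|lborel. indicator {..x} t * P' t) * Q x) =
    (LINT x|lborel. (LINT t|lborel. indicator {..x} t * P' t) * Q' x)"
    by (rule rep[OF Q'(2) mQ m(2) A'])
  moreover have "(LINT t|lebesgue. (LINT x|lborel. indicator {t..} x * Q' x) * P t) =
    (LINT t|lborel. (LINT x|lborel. indicator {t..} x * Q' x) * P' t)"
    by (rule rep[OF P'(2) mP m(1) B'])
  ultimately show ?thesis
    using integral_triangle_swap_lborel[OF P'(1) Q'(1)] unfolding A B by (simp add: mult.commute)
qed

text \<open>Write p x - p (-1) and - v t as integrals of p' over [-1, x] and of v' over [t, 1], and
  swap the order of integration on the triangle. The constant p (-1) drops out because v' has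
  integral zero.\<close>

lemma H1_deriv_by_parts:
  assumes p: "H1_deriv p p'" and v: "H1_deriv v v'" and v0: "v (-1) = 0" "v 1 = 0"
  shows "(LINT x:D|lebesgue. p x * v' x) = - (LINT x:D|lebesgue. p' x * v x)"
proof -
  define P where "P x = indicator D x * p' x" for x
  define Q where "Q x = indicator D x * v' x" for x
  have PQ: "integrable lebesgue P" "integrable lebesgue Q"
    using L2_integrable[OF H1_deriv_L2[OF p]] L2_integrable[OF H1_deriv_L2[OF v]]
    by (simp_all add: P_def[abs_def] Q_def[abs_def] set_integrable_def)
  have A: "Q x * (LINT t|lebesgue. indicator {..x} t * P t) = indicator D x * ((p x - p (-1)) * v' x)" for x
  proof (cases "x \<in> D")
    case True
    have "(LINT t|lebesgue. indicator {..x} t * P t) = (LINT t:{-1..x}|lebesgue. p' t)"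
      unfolding set_lebesgue_integral_def P_def using True
      by (intro Bochner_Integration.integral_cong) (auto simp: indicator_def)
    moreover have "p x = p (-1) + (LINT t:{-1..x}|lebesgue. p' t)"
      using p True unfolding H1_deriv_def by blast
    ultimately show ?thesis by (simp add: Q_def)
  qed (simp add: Q_def)
  have B: "P t * (LINT x|lebesgue. indicator {t..} x * Q x) = - (indicator D t * (p' t * v t))" for t
  proof (cases "t \<in> D")
    case True
    have "(LINT x|lebesgue. indicator {t..} x * Q x) = (LINT x:{t..1}|lebesgue. v' x)"
      unfolding set_lebesgue_integral_def Q_def using True
      by (intro Bochner_Integration.integral_cong) (auto simp: indicator_def)
    also have "\<dots> = integral {t..1} v'"
      by (rule set_lebesgue_integral_eq_integral, rule set_integrable_sub[OF L2_integrable[OF H1_deriv_L2[OF v]]])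
        (use True in auto)
    also have "\<dots> = - v t"
      using Henstock_Kurzweil_Integration.integral_combine[of "-1" t 1 v'] True
        L2_integrable_on[OF H1_deriv_L2[OF v], of "-1" 1]
        H1_deriv_integral[OF v True] H1_deriv_integral[OF v, of 1] v0 by auto
    finally show ?thesis by (simp add: P_def)
  qed (simp add: P_def)
  have "(LINT x:D|lebesgue. (p x - p (-1)) * v' x) = - (LINT x:D|lebesgue. p' x * v x)"
    using integral_triangle_swap[OF PQ] unfolding A B set_lebesgue_integral_def by simp
  moreover have "(LINT x:D|lebesgue. (p x - p (-1)) * v' x) =
     (LINT x:D|lebesgue. p x * v' x) - p (-1) * (LINT x:D|lebesgue. v' x)"
    using L2_mult[OF H1_deriv_L2_self[OF p] H1_deriv_L2[OF v]] L2_integrable[OF H1_deriv_L2[OF v]]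
    by (simp add: left_diff_distrib set_integral_diff)
  moreover have "v 1 = v (-1) + (LINT x:D|lebesgue. v' x)"
  proof -
    have "\<forall>x\<in>D. v x = v (-1) + (LINT t:{-1..x}|lebesgue. v' t)" using v unfolding H1_deriv_def by blast
    then show ?thesis by (rule bspec) simp
  qed
  ultimately show ?thesis using v0 by simp
qed

section \<open>Decomposition of the solution\<close>

lemma L2_power2_integrable_on: "L2 g \<Longrightarrow> {a..b} \<subseteq> D \<Longrightarrow> (\<lambda>x. (g x)\<^sup>2) integrable_on {a..b}"
  unfolding L2_def using set_integrable_sub set_lebesgue_integral_eq_integral(1) by blast

text \<open>The integral of (g - s)^2 is nonnegative; for s the mean value of g it is the difference
  of the two sides divided by b - a.\<close>

lemma L2_cauchy_schwarz:
  assumes "L2 g" "a \<le> b" "{a..b} \<subseteq> D"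
  shows "(integral {a..b} g)\<^sup>2 \<le> (b - a) * integral {a..b} (\<lambda>x. (g x)\<^sup>2)"
proof (cases "a = b")
  case False
  then have ab: "a < b" using assms by simp
  define I J where "I = integral {a..b} g" and "J = integral {a..b} (\<lambda>x. (g x)\<^sup>2)"
  define s where "s = I / (b - a)"
  have i: "g integrable_on {a..b}" "(\<lambda>x. (g x)\<^sup>2) integrable_on {a..b}"
    using assms L2_integrable_on L2_power2_integrable_on by auto
  have "((\<lambda>x. (g x)\<^sup>2 - 2 * s * g x + s\<^sup>2) has_integral (J - 2 * s * I + s\<^sup>2 * (b - a))) {a..b}"
    unfolding I_def J_def
    using integrable_integral[OF i(1)] integrable_integral[OF i(2)]
      has_integral_const_real[of "s\<^sup>2" a b] ab
    by (intro has_integral_add has_integral_diff has_integral_mult_right) (auto simp: mult.commute)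
  moreover have "0 \<le> (g x)\<^sup>2 - 2 * s * g x + s\<^sup>2" for x
    using zero_le_power2[of "g x - s"] by (simp add: power2_eq_square algebra_simps)
  ultimately have "0 \<le> J - 2 * s * I + s\<^sup>2 * (b - a)"
    by (rule has_integral_nonneg) 
  also have "\<dots> = J - I\<^sup>2 / (b - a)"
  proof -
    have "s * (b - a) = I" using ab by (simp add: s_def)
    then have "s\<^sup>2 * (b - a) = s * I" by (simp add: power2_eq_square mult.assoc)
    then show ?thesis by (simp add: s_def power2_eq_square)
  qed
  finally show ?thesis unfolding I_def J_def using ab by (simp add: field_simps)
qed simp

lemma LINT_eq_integral: "set_integrable lebesgue D g \<Longrightarrow> (LINT x:D|lebesgue. g x) = integral D g" for g :: "real \<Rightarrow> real"
  by (rule set_lebesgue_integral_eq_integral)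

lemma H1_deriv_increment:
  assumes "H1_deriv w g" "-1 \<le> x" "x \<le> y" "y \<le> 1"
  shows "w y - w x = integral {x..y} g"
proof -
  have "integral {-1..x} g + integral {x..y} g = integral {-1..y} g"
    using assms L2_integrable_on[OF H1_deriv_L2[OF assms(1)], of "-1" y]
    by (intro Henstock_Kurzweil_Integration.integral_combine) auto
  then show ?thesis
    using H1_deriv_integral[OF assms(1), of x] H1_deriv_integral[OF assms(1), of y] assms by simp
qed

text \<open>One-dimensional Sobolev bound: Cauchy-Schwarz on [-1, x], whose length is at most
  2.\<close>

lemma H10_sq_le:
  assumes "H1_deriv w g" "w (-1) = 0" "x \<in> D"
  shows "(w x)\<^sup>2 \<le> 2 * integral D (\<lambda>x. (g x)\<^sup>2)"
proof -
  have L: "L2 g" using assms H1_deriv_L2 by blast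
  have "(w x)\<^sup>2 = (integral {-1..x} g)\<^sup>2"
    using H1_deriv_increment[OF assms(1), of "-1" x] assms by simp
  also have "\<dots> \<le> (x - (-1)) * integral {-1..x} (\<lambda>x. (g x)\<^sup>2)"
    by (rule L2_cauchy_schwarz[OF L]) (use assms in auto)
  also have "\<dots> \<le> 2 * integral D (\<lambda>x. (g x)\<^sup>2)"
    using assms(3) L
    by (intro mult_mono integral_subset_le L2_power2_integrable_on Henstock_Kurzweil_Integration.integral_nonneg) auto
  finally show ?thesis .
qed

lemma H1_deriv_indefinite:
  assumes "L2 g"
  shows "H1_deriv (\<lambda>x. c + integral {-1..x} g) g"
  using assms by (intro H1_derivI) auto

text \<open>The function \<open>q = z' + G\<close> is orthogonal to all functions of mean zero,
  in particular to \<open>q\<close> minus its mean.\<close>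
lemma du_Bois_Reymond:
  assumes z: "H10 z z'" and F: "L2 F"
    and weak: "\<And>v v'. H10 v v' \<Longrightarrow> (LINT x:D|lebesgue. z' x * v' x) = (LINT x:D|lebesgue. F x * v x)"
  shows "\<exists>c. H1_deriv z (\<lambda>x. c - integral {-1..x} F)"
proof -
  define G where "G x = 0 + integral {-1..x} F" for x
  have G: "H1_deriv G F" unfolding G_def using H1_deriv_indefinite[OF F] .
  have z': "L2 z'" "H1_deriv z z'" using z H1_deriv_L2 by (auto simp: H10_def)
  define q where "q x = z' x + G x" for x
  have q: "L2 q" unfolding q_def using z' H1_deriv_L2_self[OF G] by (intro L2_add)
  \<comment> \<open>The mean of q, as D has length 2. It gives k integral zero, so that the
    antiderivative v of k is an admissible test function.\<close>
  define c where "c = integral D q / 2"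
  define k where "k x = q x - c" for x
  have k: "L2 k" unfolding k_def using q by (intro L2_diff L2_const)
  define v where "v x = 0 + integral {-1..x} k" for x
  have v: "H1_deriv v k" unfolding v_def using H1_deriv_indefinite[OF k] .
  have "integral D k = integral D q - integral D (\<lambda>x. c)"
    unfolding k_def using L2_integrable_on[OF q] by (intro Henstock_Kurzweil_Integration.integral_diff) auto
  then have k0: "integral D k = 0" by (simp add: c_def)
  then have H: "H10 v k" using v by (auto simp: H10_def v_def)
  have "(LINT x:D|lebesgue. z' x * k x) = (LINT x:D|lebesgue. F x * v x)" by (rule weak[OF H])
  moreover have "(LINT x:D|lebesgue. G x * k x) = - (LINT x:D|lebesgue. F x * v x)"
    using H by (intro H1_deriv_by_parts[OF G]) (auto simp: H10_def)
  moreover have "(LINT x:D|lebesgue. q x * k x) =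
     (LINT x:D|lebesgue. z' x * k x) + (LINT x:D|lebesgue. G x * k x)"
    unfolding q_def distrib_right using L2_mult[OF z'(1) k] L2_mult[OF H1_deriv_L2_self[OF G] k]
    by (rule set_integral_add(2))
  moreover have "(LINT x:D|lebesgue. (k x)\<^sup>2) =
     (LINT x:D|lebesgue. q x * k x) - (LINT x:D|lebesgue. c * k x)"
    unfolding k_def power2_eq_square left_diff_distrib[of "q _"] unfolding k_def[symmetric]
    using L2_mult[OF q k] L2_mult[OF L2_const k] by (rule set_integral_diff(2))
  moreover have "(LINT x:D|lebesgue. c * k x) = 0"
    using k0 LINT_eq_integral[OF L2_integrable[OF k]] by simp
  ultimately have "(LINT x:D|lebesgue. (k x)\<^sup>2) = 0" by linarith
  moreover have "set_integrable lebesgue D (\<lambda>x. (k x)\<^sup>2)" using k by (simp add: L2_def)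
  ultimately have int0: "integral D (\<lambda>x. (k x)\<^sup>2) = 0" using LINT_eq_integral by metis
  have v0: "v x = 0" if "x \<in> D" for x
    using H10_sq_le[OF v _ that] int0 H by (auto simp: H10_def)
  \<comment> \<open>z' agrees with the desired continuous derivative only almost everywhere.
    Subtracting v, which vanishes on D but has k as a derivative, exchanges the representative
    without any almost-everywhere argument.\<close>
  have "H1_deriv z (\<lambda>x. c - integral {-1..x} F)"
  proof (rule H1_deriv_cong)
    have "H1_deriv (\<lambda>x. z x - v x) (\<lambda>x. z' x - k x)" by (rule H1_deriv_diff[OF z'(2) v])
    moreover have "(\<lambda>x. z' x - k x) = (\<lambda>x. c - integral {-1..x} F)" by (auto simp: k_def q_def G_def)
    ultimately show "H1_deriv (\<lambda>x. z x - v x) (\<lambda>x. c - integral {-1..x} F)" by simp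
  qed (use v0 in auto)
  then show ?thesis by blast
qed

lemma strong_to_weak:
  assumes e: "H1_deriv e e'" "H1_deriv e' e''" and v: "H10 v v'"
  shows "(LINT x:D|lebesgue. a * e' x * v' x + b * e x * v x) =
    (LINT x:D|lebesgue. (b * e x - a * e'' x) * v x)"
proof -
  have v': "H1_deriv v v'" "v (-1) = 0" "v 1 = 0" using v by (auto simp: H10_def)
  note L = H1_deriv_L2_self[OF e(1)] H1_deriv_L2_self[OF e(2)] H1_deriv_L2[OF e(2)]
    H1_deriv_L2_self[OF v'(1)] H1_deriv_L2[OF v'(1)]
  have "(LINT x:D|lebesgue. a * (e' x * v' x) + b * (e x * v x)) =
     (LINT x:D|lebesgue. a * (e' x * v' x)) + (LINT x:D|lebesgue. b * (e x * v x))"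
    using L by (intro set_integral_add(2) set_integrable_mult_right L2_mult)
  moreover have "(LINT x:D|lebesgue. e' x * v' x) = - (LINT x:D|lebesgue. e'' x * v x)"
    by (rule H1_deriv_by_parts[OF e(2) v'])
  moreover have "(LINT x:D|lebesgue. b * (e x * v x) - a * (e'' x * v x)) =
     (LINT x:D|lebesgue. b * (e x * v x)) - (LINT x:D|lebesgue. a * (e'' x * v x))"
    using L by (intro set_integral_diff(2) set_integrable_mult_right L2_mult)
  ultimately show ?thesis by (simp add: left_diff_distrib mult.assoc)
qed

text \<open>Young's inequality with weight b / 2 absorbs half of the reaction term. The power of
  \<epsilon> matters: z has L2 norm of order \<epsilon>^2, which is exactly what keeps b z /
  \<epsilon>^2 bounded in L2.\<close>

lemma L2_norm_H10_energy:
  assumes z: "H10 z z'" and k: "L2 k" and b: "b > 0" and \<epsilon>: "\<epsilon> > 0"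
    and eq: "(LINT x:D|lebesgue. \<epsilon>\<^sup>2 * z' x * z' x + b * z x * z x) = (\<epsilon>\<^sup>2 / b) * (LINT x:D|lebesgue. k x * z x)"
  shows "integral D (\<lambda>x. (z x)\<^sup>2) \<le> \<epsilon> ^ 4 / b ^ 4 * integral D (\<lambda>x. (k x)\<^sup>2)"
    and "integral D (\<lambda>x. (z' x)\<^sup>2) \<le> \<epsilon>\<^sup>2 / b ^ 3 * integral D (\<lambda>x. (k x)\<^sup>2)"
proof -
  have Lz: "L2 z'" "L2 z" using z H1_deriv_L2 H1_deriv_L2_self by (auto simp: H10_def)
  define Z Z' K where "Z = integral D (\<lambda>x. (z x)\<^sup>2)" and "Z' = integral D (\<lambda>x. (z' x)\<^sup>2)"
    and "K = integral D (\<lambda>x. (k x)\<^sup>2)"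
  have i: "(\<lambda>x. (z x)\<^sup>2) integrable_on D" "(\<lambda>x. (z' x)\<^sup>2) integrable_on D" "(\<lambda>x. (k x)\<^sup>2) integrable_on D"
    using Lz k by (auto intro: L2_power2_integrable_on)
  have nn: "0 \<le> Z" "0 \<le> Z'" "0 \<le> K" unfolding Z_def Z'_def K_def
    using i by (auto intro!: Henstock_Kurzweil_Integration.integral_nonneg)
  have sq: "(LINT x:D|lebesgue. (p x)\<^sup>2) = integral D (\<lambda>x. (p x)\<^sup>2)" if "L2 p" for p
    using that by (intro LINT_eq_integral) (simp add: L2_def)
  have "(LINT x:D|lebesgue. \<epsilon>\<^sup>2 * (z' x)\<^sup>2 + b * (z x)\<^sup>2) =
      (LINT x:D|lebesgue. \<epsilon>\<^sup>2 * (z' x)\<^sup>2) + (LINT x:D|lebesgue. b * (z x)\<^sup>2)"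
    using Lz by (intro set_integral_add(2) set_integrable_mult_right) (auto simp: L2_def)
  then have lhs: "(LINT x:D|lebesgue. \<epsilon>\<^sup>2 * z' x * z' x + b * z x * z x) = \<epsilon>\<^sup>2 * Z' + b * Z"
    using sq[OF Lz(1)] sq[OF Lz(2)] by (simp add: power2_eq_square mult.assoc Z_def Z'_def)
  have "(LINT x:D|lebesgue. (\<epsilon>\<^sup>2 / b) * (k x * z x)) \<le>
      (LINT x:D|lebesgue. (b / 2) * (z x)\<^sup>2 + (\<epsilon> ^ 4 / (2 * b ^ 3)) * (k x)\<^sup>2)"
  proof (rule set_integral_mono)
    show "set_integrable lebesgue D (\<lambda>x. (\<epsilon>\<^sup>2 / b) * (k x * z x))"
      using Lz k by (intro set_integrable_mult_right L2_mult)
    show "set_integrable lebesgue D (\<lambda>x. (b / 2) * (z x)\<^sup>2 + (\<epsilon> ^ 4 / (2 * b ^ 3)) * (k x)\<^sup>2)"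
      using Lz k by (intro set_integral_add(1) set_integrable_mult_right) (auto simp: L2_def)
    fix x
    have "0 \<le> (b / 2) * (z x - \<epsilon>\<^sup>2 * k x / b\<^sup>2)\<^sup>2" using b by simp
    also have "\<dots> = (b / 2) * (z x)\<^sup>2 + (\<epsilon> ^ 4 / (2 * b ^ 3)) * (k x)\<^sup>2 - (\<epsilon>\<^sup>2 / b) * (k x * z x)"
      using b by (simp add: field_simps power2_eq_square power3_eq_cube power4_eq_xxxx)
    finally show "(\<epsilon>\<^sup>2 / b) * (k x * z x) \<le> (b / 2) * (z x)\<^sup>2 + (\<epsilon> ^ 4 / (2 * b ^ 3)) * (k x)\<^sup>2"
      by simp
  qed
  also have "\<dots> = (LINT x:D|lebesgue. (b / 2) * (z x)\<^sup>2) + (LINT x:D|lebesgue. (\<epsilon> ^ 4 / (2 * b ^ 3)) * (k x)\<^sup>2)"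
    using Lz k by (intro set_integral_add(2) set_integrable_mult_right) (auto simp: L2_def)
  also have "\<dots> = (b / 2) * Z + \<epsilon> ^ 4 / (2 * b ^ 3) * K"
    using sq[OF k] sq[OF Lz(2)] by (simp add: Z_def K_def)
  finally have main: "\<epsilon>\<^sup>2 * Z' + b * Z \<le> (b / 2) * Z + \<epsilon> ^ 4 / (2 * b ^ 3) * K"
    using eq lhs by simp
  have "b / 2 * Z \<le> \<epsilon> ^ 4 / (2 * b ^ 3) * K" using main nn \<epsilon> by (smt (verit) mult_nonneg_nonneg zero_le_power2 field_sum_of_halves distrib_right)
  then show "integral D (\<lambda>x. (z x)\<^sup>2) \<le> \<epsilon> ^ 4 / b ^ 4 * integral D (\<lambda>x. (k x)\<^sup>2)"
    unfolding Z_def[symmetric] K_def[symmetric] using b by (simp add: field_simps power3_eq_cube power4_eq_xxxx)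
  have "0 \<le> b / 2 * Z" using b nn by simp
  then have "\<epsilon>\<^sup>2 * Z' \<le> \<epsilon> ^ 4 / (2 * b ^ 3) * K" using main by (simp add: field_simps)
  also have "\<dots> = \<epsilon>\<^sup>2 * (\<epsilon>\<^sup>2 / (2 * b ^ 3) * K)" by (simp add: power2_eq_square power4_eq_xxxx)
  finally have "Z' \<le> \<epsilon>\<^sup>2 / (2 * b ^ 3) * K" using \<epsilon> by (subst (asm) mult_le_cancel_left_pos) auto
  also have "\<dots> \<le> \<epsilon>\<^sup>2 / b ^ 3 * K" using b nn by (intro mult_right_mono divide_left_mono) auto
  finally show "integral D (\<lambda>x. (z' x)\<^sup>2) \<le> \<epsilon>\<^sup>2 / b ^ 3 * integral D (\<lambda>x. (k x)\<^sup>2)"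
    by (simp add: Z'_def K_def)
qed

lemma H1_deriv_exp: "H1_deriv (\<lambda>x. exp (c * x + d)) (\<lambda>x. c * exp (c * x + d))"
  by (rule H1_deriv_C1[of "{}"])
    (auto intro!: continuous_intros L2_continuous derivative_eq_intros)

text \<open>Layers carrying the boundary values of - f / b leave a remainder z in H10, which may
  test its own equation; the exponentials solve the homogeneous equation, so only \<epsilon>^2 / b
  times f'' is left on its right-hand side. In w = f / b + z the terms f'' / b cancel, so the second
  derivative of w is controlled by z alone.\<close>

lemma solution_decomposition:
  assumes b: "b > 0" and f: "H2 f"
  shows "\<exists>K>0. \<forall>\<epsilon> u u'. 0 < \<epsilon> \<and> \<epsilon> \<le> 1 \<and> weak_solution \<epsilon> b f u u' \<longrightarrow>
    (\<exists>A B w w1 w2. \<bar>A\<bar> \<le> K \<and> \<bar>B\<bar> \<le> K \<and> (\<forall>x\<in>D. \<bar>w x\<bar> \<le> K) \<and>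
      H1_deriv w w1 \<and> H1_deriv w1 w2 \<and> integral D (\<lambda>x. (w2 x)\<^sup>2) \<le> K \<and>
      (\<forall>x\<in>D. u x = w x + A * exp (- sqrt b / \<epsilon> * (1 + x)) + B * exp (- sqrt b / \<epsilon> * (1 - x))))"
proof -
  obtain g k where fg: "H1_deriv f g" and gk: "H1_deriv g k" using f by (auto simp: H2_def)
  have k: "L2 k" using gk by (rule H1_deriv_L2)
  define K2 where "K2 = integral D (\<lambda>x. (k x)\<^sup>2)"
  have K2: "0 \<le> K2" unfolding K2_def
    using k by (intro Henstock_Kurzweil_Integration.integral_nonneg L2_power2_integrable_on) auto
  have "compact (f ` D)" using H1_deriv_continuous[OF fg] by (intro compact_continuous_image) auto
  then obtain F0 where F0: "\<And>x. x \<in> D \<Longrightarrow> \<bar>f x\<bar> \<le> F0" "0 < F0"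
    using compact_imp_bounded bounded_pos by (metis image_eqI real_norm_def)
  \<comment> \<open>A bound for q = exp (- 2 \<kappa>) that is uniform in \<epsilon> \<le> 1. It
    keeps 1 - q^2, the determinant of the system for A and B, away from zero.\<close>
  define q0 where "q0 = exp (- 2 * sqrt b)"
  have q0: "q0 < 1" "0 < q0" using b by (auto simp: q0_def)
  define K where "K = 2 * F0 / (b * (1 - q0)) + (F0 / b + 1 + K2 / b ^ 3) + K2 / b\<^sup>2"
  have Kparts: "0 \<le> 2 * F0 / (b * (1 - q0))" "0 \<le> F0 / b + 1 + K2 / b ^ 3" "0 < F0 / b + 1 + K2 / b ^ 3" "0 \<le> K2 / b\<^sup>2"
  proof -
    have "0 < F0 / b" "0 \<le> K2 / b ^ 3" using b F0 K2 by auto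
    then show "0 \<le> F0 / b + 1 + K2 / b ^ 3" "0 < F0 / b + 1 + K2 / b ^ 3" by linarith+
  qed (use b F0 q0 K2 in auto)
  show ?thesis
  proof (rule exI[of _ K], intro conjI allI impI)
    show "0 < K" using Kparts by (simp add: K_def)
    fix \<epsilon> u u'
    assume "0 < \<epsilon> \<and> \<epsilon> \<le> 1 \<and> weak_solution \<epsilon> b f u u'"
    then have \<epsilon>: "0 < \<epsilon>" "\<epsilon> \<le> 1" and u: "H10 u u'"
      and weak: "\<And>v v'. H10 v v' \<Longrightarrow> (LINT x:D|lebesgue. \<epsilon>\<^sup>2 * u' x * v' x + b * u x * v x)
        = (LINT x:D|lebesgue. f x * v x)"
      by (auto simp: weak_solution_def)
    define \<kappa> where "\<kappa> = sqrt b / \<epsilon>"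
    have \<kappa>: "0 < \<kappa>" "sqrt b \<le> \<kappa>" "\<epsilon>\<^sup>2 * \<kappa>\<^sup>2 = b"
      using b \<epsilon> by (auto simp: \<kappa>_def power_divide field_simps)
    define q where "q = exp (- 2 * \<kappa>)"
    have q: "0 < q" "q \<le> q0" "q < 1" using \<kappa> q0 by (auto simp: q_def q0_def)
    have den: "b * (1 - q0) \<le> b * (1 - q\<^sup>2)" "0 < b * (1 - q0)" "q\<^sup>2 < 1"
    proof -
      have "q\<^sup>2 \<le> q" using q by (simp add: power2_eq_square mult_left_le)
      then show "b * (1 - q0) \<le> b * (1 - q\<^sup>2)" "0 < b * (1 - q0)" "q\<^sup>2 < 1" using q q0 b by auto
    qed
    \<comment> \<open>A and B solve A + q B = - f (-1) / b and q A + B = - f 1 / b, so that e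
      vanishes at both ends.\<close>
    define A where "A = - (f (-1) - q * f 1) / (b * (1 - q\<^sup>2))"
    define B where "B = - (f 1 - q * f (-1)) / (b * (1 - q\<^sup>2))"
    have bound: "\<bar>- (s - q * t) / (b * (1 - q\<^sup>2))\<bar> \<le> 2 * F0 / (b * (1 - q0))"
      if "\<bar>s\<bar> \<le> F0" "\<bar>t\<bar> \<le> F0" for s t
    proof -
      have "\<bar>q * t\<bar> \<le> 1 * F0" unfolding abs_mult using q that by (intro mult_mono) auto
      then have "\<bar>- (s - q * t)\<bar> \<le> 2 * F0" using that by linarith
      then show ?thesis unfolding abs_divide using den F0 by (intro frac_le) auto
    qed
    have AB: "\<bar>A\<bar> \<le> K" "\<bar>B\<bar> \<le> K"
      using bound[of "f (-1)" "f 1"] bound[of "f 1" "f (-1)"] F0(1)[of 1] F0(1)[of "-1"] Kparts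
      by (auto simp: A_def B_def K_def)
    define E1 where "E1 x = exp (- \<kappa> * x + - \<kappa>)" for x
    define E2 where "E2 x = exp (\<kappa> * x + - \<kappa>)" for x
    have hE: "H1_deriv E1 (\<lambda>x. - \<kappa> * E1 x)" "H1_deriv E2 (\<lambda>x. \<kappa> * E2 x)"
      unfolding E1_def[abs_def] E2_def[abs_def] by (rule H1_deriv_exp)+
    have E_ends: "E1 (-1) = 1" "E1 1 = q" "E2 (-1) = q" "E2 1 = 1"
      by (auto simp: E1_def E2_def q_def)
    define e where "e x = (1 / b) * f x + (A * E1 x + B * E2 x)" for x
    define e' where "e' x = (1 / b) * g x + (A * (- \<kappa> * E1 x) + B * (\<kappa> * E2 x))" for x
    define e'' where "e'' x = (1 / b) * k x + (A * (- \<kappa> * (- \<kappa> * E1 x)) + B * (\<kappa> * (\<kappa> * E2 x)))" for x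
    have e: "H1_deriv e e'" unfolding e_def e'_def
      by (intro H1_deriv_add H1_deriv_scale fg hE)
    have e': "H1_deriv e' e''" unfolding e'_def e''_def
      by (intro H1_deriv_add H1_deriv_scale gk hE)
    have "e (-1) = 0" "e 1 = 0"
    proof -
      define d where "d = b * (1 - q\<^sup>2)"
      have d: "d \<noteq> 0" using den b by (simp add: d_def)
      have Ad: "A * d = - (f (-1) - q * f 1)" and Bd: "B * d = - (f 1 - q * f (-1))"
        using d by (simp_all add: A_def B_def d_def)
      have db: "(1 / b) * d = 1 - q\<^sup>2" using b by (simp add: d_def)
      have "e (-1) * d = ((1 / b) * d) * f (-1) + (A * d + (B * d) * q)"
        "e 1 * d = ((1 / b) * d) * f 1 + ((A * d) * q + B * d)"
        unfolding e_def E_ends by (simp_all add: algebra_simps)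
      then have "e (-1) * d = 0" "e 1 * d = 0"
        unfolding Ad Bd db by (simp_all add: algebra_simps power2_eq_square)
      then show "e (-1) = 0" "e 1 = 0" using d by auto
    qed
    define z where "z x = u x - e x" for x
    define z' where "z' x = u' x - e' x" for x
    have z: "H10 z z'"
      using H1_deriv_diff[of u u' e e'] u e \<open>e (-1) = 0\<close> \<open>e 1 = 0\<close>
      by (simp add: H10_def z_def[abs_def] z'_def[abs_def])
    then have Lz: "L2 z'" "L2 z" using H1_deriv_L2 H1_deriv_L2_self by (auto simp: H10_def)
    have weak_z: "(LINT x:D|lebesgue. \<epsilon>\<^sup>2 * z' x * v' x + b * z x * v x) =
      (\<epsilon>\<^sup>2 / b) * (LINT x:D|lebesgue. k x * v x)" if v: "H10 v v'" for v v'
    proof -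
      have Lv: "L2 v" "L2 v'" using v H1_deriv_L2 H1_deriv_L2_self by (auto simp: H10_def)
      have Lu: "L2 u" "L2 u'" using u H1_deriv_L2 H1_deriv_L2_self by (auto simp: H10_def)
      have res: "b * e x - \<epsilon>\<^sup>2 * e'' x = f x - \<epsilon>\<^sup>2 / b * k x" for x
      proof -
        have "\<epsilon>\<^sup>2 * e'' x = \<epsilon>\<^sup>2 / b * k x + (\<epsilon>\<^sup>2 * \<kappa>\<^sup>2) * (A * E1 x + B * E2 x)"
          by (simp add: e''_def power2_eq_square algebra_simps)
        then show ?thesis using b unfolding \<kappa>(3) by (simp add: e_def algebra_simps)
      qed
      have "(LINT x:D|lebesgue. \<epsilon>\<^sup>2 * z' x * v' x + b * z x * v x) =
        (LINT x:D|lebesgue. (\<epsilon>\<^sup>2 * u' x * v' x + b * u x * v x) - (\<epsilon>\<^sup>2 * e' x * v' x + b * e x * v x))"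
        by (simp add: z_def z'_def algebra_simps)
      also have "\<dots> = (LINT x:D|lebesgue. \<epsilon>\<^sup>2 * u' x * v' x + b * u x * v x) -
          (LINT x:D|lebesgue. \<epsilon>\<^sup>2 * e' x * v' x + b * e x * v x)"
        using Lu Lv H1_deriv_L2_self[OF e] H1_deriv_L2[OF e] unfolding mult.assoc
        by (intro set_integral_diff(2) set_integral_add(1) set_integrable_mult_right L2_mult)
      also have "\<dots> = (LINT x:D|lebesgue. f x * v x) - (LINT x:D|lebesgue. f x * v x - \<epsilon>\<^sup>2 / b * (k x * v x))"
        unfolding weak[OF v] strong_to_weak[OF e e' v] res by (simp add: left_diff_distrib mult.assoc)
      also have "(LINT x:D|lebesgue. f x * v x - \<epsilon>\<^sup>2 / b * (k x * v x)) =
         (LINT x:D|lebesgue. f x * v x) - (LINT x:D|lebesgue. \<epsilon>\<^sup>2 / b * (k x * v x))"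
        using H1_deriv_L2_self[OF fg] Lv k by (intro set_integral_diff(2) set_integrable_mult_right L2_mult)
      finally show ?thesis by simp
    qed
    note zbound = L2_norm_H10_energy[OF z k b \<epsilon>(1) weak_z[OF z], folded K2_def]
    \<comment> \<open>The equation for z reads - z'' = F in weak form. As z is so far only in H1,
      \<open>du_Bois_Reymond\<close> has to provide its second derivative.\<close>
    define F where "F x = (1 / b) * k x - b / \<epsilon>\<^sup>2 * z x" for x
    have F: "L2 F" unfolding F_def using k Lz by (intro L2_diff L2_scale)
    have "(LINT x:D|lebesgue. z' x * v' x) = (LINT x:D|lebesgue. F x * v x)" if v: "H10 v v'" for v v'
    proof -
      have Lv: "L2 v" "L2 v'" using v H1_deriv_L2 H1_deriv_L2_self by (auto simp: H10_def)
      have "(LINT x:D|lebesgue. \<epsilon>\<^sup>2 * z' x * v' x + b * z x * v x) =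
        (LINT x:D|lebesgue. \<epsilon>\<^sup>2 * (z' x * v' x)) + (LINT x:D|lebesgue. b * (z x * v x))"
        using Lv Lz unfolding mult.assoc by (intro set_integral_add(2) set_integrable_mult_right L2_mult)
      then have "\<epsilon>\<^sup>2 * (LINT x:D|lebesgue. z' x * v' x) =
          \<epsilon>\<^sup>2 / b * (LINT x:D|lebesgue. k x * v x) - b * (LINT x:D|lebesgue. z x * v x)"
        using weak_z[OF v] by simp
      then have 1: "(LINT x:D|lebesgue. z' x * v' x) =
          1 / b * (LINT x:D|lebesgue. k x * v x) - b / \<epsilon>\<^sup>2 * (LINT x:D|lebesgue. z x * v x)"
        using \<epsilon> by (simp add: field_simps)
      have "(LINT x:D|lebesgue. F x * v x) = (LINT x:D|lebesgue. (1 / b) * (k x * v x) - b / \<epsilon>\<^sup>2 * (z x * v x))"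
        by (simp add: F_def left_diff_distrib mult.assoc)
      also have "\<dots> = (LINT x:D|lebesgue. (1 / b) * (k x * v x)) - (LINT x:D|lebesgue. b / \<epsilon>\<^sup>2 * (z x * v x))"
        using Lv Lz k by (intro set_integral_diff(2) set_integrable_mult_right L2_mult)
      finally show ?thesis using 1 by simp
    qed
    from du_Bois_Reymond[OF z F this] obtain c where c: "H1_deriv z (\<lambda>x. c - integral {-1..x} F)" by blast
    define w where "w x = (1 / b) * f x + z x" for x
    define w1 where "w1 x = (1 / b) * g x + (c - integral {-1..x} F)" for x
    define w2 where "w2 x = (1 / b) * k x + (0 - F x)" for x
    have w: "H1_deriv w w1" unfolding w_def w1_def by (intro H1_deriv_add H1_deriv_scale fg c)
    have "H1_deriv (\<lambda>x. 0 + integral {-1..x} F) F" by (rule H1_deriv_indefinite[OF F])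
    then have w1: "H1_deriv w1 w2" unfolding w1_def w2_def
      by (intro H1_deriv_add H1_deriv_diff H1_deriv_scale gk H1_deriv_const) simp
    have "integral D (\<lambda>x. (w2 x)\<^sup>2) = integral D (\<lambda>x. (b / \<epsilon>\<^sup>2)\<^sup>2 * (z x)\<^sup>2)"
      by (simp add: w2_def F_def power_mult_distrib power_divide)
    also have "\<dots> = (b / \<epsilon>\<^sup>2)\<^sup>2 * integral D (\<lambda>x. (z x)\<^sup>2)" by simp
    also have "\<dots> \<le> (b / \<epsilon>\<^sup>2)\<^sup>2 * (\<epsilon> ^ 4 / b ^ 4 * K2)" by (intro mult_left_mono zbound) simp
    also have "\<dots> = K2 / b\<^sup>2" using \<epsilon> b by (simp add: field_simps power2_eq_square power4_eq_xxxx)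
    also have "\<dots> \<le> K" using Kparts by (simp add: K_def)
    finally have w2: "integral D (\<lambda>x. (w2 x)\<^sup>2) \<le> K" .
    \<comment> \<open>This pointwise bound later limits the nodal values of w and thereby the number
      of bits.\<close>
    have wb: "\<bar>w x\<bar> \<le> K" if x: "x \<in> D" for x
    proof -
      have "(z x)\<^sup>2 \<le> 2 * integral D (\<lambda>x. (z' x)\<^sup>2)"
        using z x by (intro H10_sq_le) (auto simp: H10_def)
      also have "\<dots> \<le> 2 * (\<epsilon>\<^sup>2 / b ^ 3 * K2)" using zbound by simp
      also have "\<dots> \<le> 2 * (1 / b ^ 3 * K2)"
        using \<epsilon> b K2 by (intro mult_left_mono mult_right_mono divide_right_mono) (auto simp: power_le_one)
      finally have "(z x)\<^sup>2 \<le> 2 * (K2 / b ^ 3)" by simp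
      moreover have "2 * \<bar>z x\<bar> \<le> 1 + (z x)\<^sup>2" using sum_squares_bound[of "\<bar>z x\<bar>" 1] by simp
      ultimately have "\<bar>z x\<bar> \<le> 1 + K2 / b ^ 3" by linarith
      moreover have "\<bar>(1 / b) * f x\<bar> \<le> F0 / b" using F0(1)[OF x] b by (simp add: divide_right_mono)
      ultimately show ?thesis using Kparts abs_triangle_ineq[of "(1 / b) * f x" "z x"] by (simp add: w_def K_def)
    qed
    have "u x = w x + A * exp (- sqrt b / \<epsilon> * (1 + x)) + B * exp (- sqrt b / \<epsilon> * (1 - x))" for x
    proof -
      have "E1 x = exp (- sqrt b / \<epsilon> * (1 + x))" "E2 x = exp (- sqrt b / \<epsilon> * (1 - x))"
        by (simp_all add: E1_def E2_def \<kappa>_def algebra_simps add_divide_distrib diff_divide_distrib)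
      then show ?thesis by (simp add: w_def z_def e_def)
    qed
    then show "\<exists>A B w w1 w2. \<bar>A\<bar> \<le> K \<and> \<bar>B\<bar> \<le> K \<and> (\<forall>x\<in>D. \<bar>w x\<bar> \<le> K) \<and>
      H1_deriv w w1 \<and> H1_deriv w1 w2 \<and> integral D (\<lambda>x. (w2 x)\<^sup>2) \<le> K \<and>
      (\<forall>x\<in>D. u x = w x + A * exp (- sqrt b / \<epsilon> * (1 + x)) + B * exp (- sqrt b / \<epsilon> * (1 - x)))"
      using AB wb w w1 w2 by blast
  qed
qed

section \<open>Quantized interpolation\<close>

text \<open>A left derivative: the open ray assigns each node to the cell on its left, which is why
  the error estimates use cells open on the left.\<close>

definition dpl :: "nat \<Rightarrow> (nat \<Rightarrow> real) \<Rightarrow> real \<Rightarrow> real" where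
  "dpl N y s = (\<Sum>i\<le>N. second_diff y i * indicator {real i<..} s)"

lemma dpl_cell_gen:
  assumes "j \<le> N" "real j < s" "s \<le> real (j + 1) \<or> j = N"
  shows "dpl N y s = y (j + 1) - y j"
proof -
  have "dpl N y s = (\<Sum>i\<le>j. second_diff y i * indicator {real i<..} s)"
    unfolding dpl_def using assms by (intro sum.mono_neutral_right) (auto simp: indicator_def)
  also have "\<dots> = (\<Sum>i\<le>j. second_diff y i)"
    using assms by (intro sum.cong) (auto simp: indicator_def)
  finally show ?thesis by (simp add: sum_second_diff)
qed

lemma dpl_left: "s \<le> 0 \<Longrightarrow> dpl N y s = 0"
  by (auto simp: dpl_def indicator_def intro!: sum.neutral)

lemma dpl_right: "real N < s \<Longrightarrow> y (N + 1) = y N \<Longrightarrow> dpl N y s = 0"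
  using dpl_cell_gen[of N N s y] by auto

lemma L2_indicator: "L2 (\<lambda>x. indicator {c<..} ((x - a) / h))"
proof -
  have m: "set_borel_measurable lebesgue D (\<lambda>x. indicator {c<..} ((x - a) / h) :: real)"
  proof -
    have "(\<lambda>x. indicator D x *\<^sub>R indicator {c<..} ((x - a) / h) :: real) \<in> borel_measurable borel" by measurable
    then have "(\<lambda>x. indicator D x *\<^sub>R indicator {c<..} ((x - a) / h) :: real) \<in> borel_measurable lborel" by simp
    then show ?thesis unfolding set_borel_measurable_def by (rule measurable_completion)
  qed
  have sq: "(indicator {c<..} ((x - a) / h) :: real)\<^sup>2 = indicator {c<..} ((x - a) / h)" for x
    by (auto simp: indicator_def)
  have "set_integrable lebesgue D (\<lambda>x. indicator {c<..} ((x - a) / h) :: real)"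
    by (rule set_integrable_bound[OF set_integrable_const_D[of 1] m]) (auto simp: indicator_def)
  then show ?thesis using m by (simp add: L2_def sq)
qed

lemma H1_deriv_relu:
  assumes "0 < h"
  shows "H1_deriv (\<lambda>x. relu ((x - a) / h - c)) (\<lambda>x. 1 / h * indicator {c<..} ((x - a) / h))"
proof (rule H1_deriv_C1[of "{a + c * h}"])
  show "continuous_on D (\<lambda>x. relu ((x - a) / h - c))"
    unfolding relu_def using assms by (intro continuous_intros) auto
  show "L2 (\<lambda>x. 1 / h * indicator {c<..} ((x - a) / h))" by (intro L2_scale L2_indicator)
  fix x :: real assume "x \<in> D - {a + c * h}"
  then consider "x < a + c * h" | "a + c * h < x" by force
  then show "((\<lambda>x. relu ((x - a) / h - c)) has_real_derivative 1 / h * indicator {c<..} ((x - a) / h)) (at x)"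
  proof cases
    case 1
    have "((\<lambda>x. 0) has_real_derivative 1 / h * indicator {c<..} ((x - a) / h)) (at x)"
      using 1 assms by (auto simp: indicator_def field_simps)
    then show ?thesis
      by (rule DERIV_cong_ev[THEN iffD1, rotated 3])
        (use eventually_nhds_in_open[of "{..<a + c * h}" x] 1 assms in
          \<open>auto elim!: eventually_mono simp: relu_def field_simps\<close>)
  next
    case 2
    have "((\<lambda>x. (x - a) / h - c) has_real_derivative 1 / h * indicator {c<..} ((x - a) / h)) (at x)"
      using 2 assms by (auto simp: indicator_def field_simps intro!: derivative_eq_intros)
    then show ?thesis
      by (rule DERIV_cong_ev[THEN iffD1, rotated 3])
        (use eventually_nhds_in_open[of "{a + c * h<..}" x] 2 assms in
          \<open>auto elim!: eventually_mono simp: relu_def field_simps\<close>)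
  qed
qed simp

lemma H1_deriv_pl:
  assumes "0 < h"
  shows "H1_deriv (\<lambda>x. pl N y ((x - a) / h)) (\<lambda>x. dpl N y ((x - a) / h) / h)"
proof -
  have "H1_deriv (\<lambda>x. y 0 + (\<Sum>i\<le>N. second_diff y i * relu ((x - a) / h - real i)))
    (\<lambda>x. 0 + (\<Sum>i\<le>N. second_diff y i * (1 / h * indicator {real i<..} ((x - a) / h))))"
    using assms by (intro H1_deriv_add H1_deriv_const H1_deriv_sum H1_deriv_scale H1_deriv_relu) auto
  moreover have "(\<lambda>x. 0 + (\<Sum>i\<le>N. second_diff y i * (1 / h * indicator {real i<..} ((x - a) / h)))) =
     (\<lambda>x. dpl N y ((x - a) / h) / h)"
    by (rule ext, unfold dpl_def sum_divide_distrib add_0_left, rule sum.cong) auto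
  ultimately show ?thesis by (simp add: pl_def)
qed

section \<open>Interpolation errors, cell by cell\<close>

lemma increment_oscillation:
  fixes v v1 :: "real \<Rightarrow> real"
  assumes "(v1 has_integral (v y - v x)) {x..y}" "x \<le> y" "\<And>s. s \<in> {x..y} \<Longrightarrow> \<bar>v1 s - d\<bar> \<le> \<omega>"
  shows "\<bar>v y - v x - d * (y - x)\<bar> \<le> \<omega> * (y - x)"
proof -
  have c: "((\<lambda>s. c) has_integral c * (y - x)) {x..y}" for c :: real
    using has_integral_const_real[of c x y] assms(2) by (simp add: mult.commute)
  have "v y - v x \<le> (d + \<omega>) * (y - x)"
    by (rule has_integral_le[OF assms(1) c]) (use assms(3) in \<open>smt (verit)\<close>)
  moreover have "(d - \<omega>) * (y - x) \<le> v y - v x"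
    by (rule has_integral_le[OF c assms(1)]) (use assms(3) in \<open>smt (verit)\<close>)
  ultimately show ?thesis by (simp add: algebra_simps abs_le_iff)
qed

text \<open>Nodal values in units of 1 / n^2, rounded down. Truncating i at n makes entry n + 1
  repeat entry n, so that \<open>pl\<close> stays constant beyond the grid.\<close>

definition quantized :: "nat \<Rightarrow> real \<Rightarrow> real \<Rightarrow> (real \<Rightarrow> real) \<Rightarrow> nat \<Rightarrow> real" where
  "quantized n a h v i = of_int \<lfloor>v (a + real (min i n) * h) * real n ^ 2\<rfloor>"

lemma quantized_error:
  assumes "0 < n"
  shows "quantized n a h v i / real n ^ 2 \<le> v (a + real (min i n) * h)"
    and "v (a + real (min i n) * h) \<le> quantized n a h v i / real n ^ 2 + 1 / real n ^ 2"
proof -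
  have "of_int \<lfloor>v (a + real (min i n) * h) * real n ^ 2\<rfloor> \<le> v (a + real (min i n) * h) * real n ^ 2"
    "v (a + real (min i n) * h) * real n ^ 2 \<le> of_int \<lfloor>v (a + real (min i n) * h) * real n ^ 2\<rfloor> + 1"
    by linarith+
  then show "quantized n a h v i / real n ^ 2 \<le> v (a + real (min i n) * h)"
    "v (a + real (min i n) * h) \<le> quantized n a h v i / real n ^ 2 + 1 / real n ^ 2"
    using assms by (simp_all add: quantized_def divide_le_eq le_divide_eq flip: add_divide_distrib)
qed

text \<open>Everything is expressed by the oscillation \<omega> of the derivative on the cell, so
  the estimate serves w, whose second derivative is only in L2, as well as the exponentials. The
  rounding error 1 / n^2 of the values becomes 1 / (n^2 h) in the slope.\<close>

lemma quantized_cell_error: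
  fixes v v1 :: "real \<Rightarrow> real" and n j :: nat and a h x :: real
  defines "p \<equiv> \<lambda>x. pl n (quantized n a h v) ((x - a) / h) / real n ^ 2"
    and "p' \<equiv> \<lambda>x. dpl n (quantized n a h v) ((x - a) / h) / h / real n ^ 2"
  assumes n: "0 < n" and h: "0 < h" and j: "j < n"
    and x: "a + real j * h < x" "x \<le> a + real (j + 1) * h"
    and I: "\<And>s t. a + real j * h \<le> s \<Longrightarrow> s \<le> t \<Longrightarrow> t \<le> a + real (j + 1) * h \<Longrightarrow>
      (v1 has_integral (v t - v s)) {s..t}"
    and osc: "\<And>s t. s \<in> {a + real j * h..a + real (j + 1) * h} \<Longrightarrow>
      t \<in> {a + real j * h..a + real (j + 1) * h} \<Longrightarrow> \<bar>v1 s - v1 t\<bar> \<le> \<omega>"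
  shows "\<bar>v x - p x\<bar> \<le> 2 * h * \<omega> + 1 / real n ^ 2"
    and "\<bar>v1 x - p' x\<bar> \<le> \<omega> + 1 / (real n ^ 2 * h)"
proof -
  define l r where "l = a + real j * h" and "r = a + real (j + 1) * h"
  have lr: "r = l + h" "l < x" "x \<le> r" using x by (auto simp: l_def r_def algebra_simps)
  define Y where "Y = quantized n a h v"
  define q0 q1 where "q0 = Y j / real n ^ 2" and "q1 = Y (j + 1) / real n ^ 2"
  have q: "q0 \<le> v l" "v l \<le> q0 + 1 / real n ^ 2" "q1 \<le> v r" "v r \<le> q1 + 1 / real n ^ 2"
    using quantized_error[OF n, where a=a and h=h and v=v and i=j] quantized_error[OF n, where a=a and h=h and v=v and i="j + 1"] j
    by (auto simp: q0_def q1_def Y_def l_def r_def min_def)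
  define \<theta> where "\<theta> = (x - l) / h"
  have \<theta>: "0 < \<theta>" "\<theta> \<le> 1" "(x - a) / h = real j + \<theta>"
    using lr h by (auto simp: \<theta>_def l_def field_simps)
  have px: "p x = q0 + \<theta> * (q1 - q0)"
    unfolding p_def Y_def[symmetric] \<theta>(3) using \<theta> j
    by (subst pl_cell[of j]) (auto simp: q0_def q1_def add_divide_distrib simp flip: diff_divide_distrib)
  have p'x: "p' x = (q1 - q0) / h"
    unfolding p'_def Y_def[symmetric] \<theta>(3) using \<theta> j
    by (subst dpl_cell_gen[of j]) (auto simp: q0_def q1_def simp flip: diff_divide_distrib)
  define \<sigma> where "\<sigma> = (v r - v l) / h"
  have "\<bar>v r - v l - v1 x * (r - l)\<bar> \<le> \<omega> * (r - l)"
    using lr osc[of _ x] I[of l r] unfolding l_def[symmetric] r_def[symmetric]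
    by (intro increment_oscillation[of v1 v]) auto
  moreover have "v r - v l - v1 x * (r - l) = (\<sigma> - v1 x) * h"
  proof -
    have "\<sigma> * h = v r - v l" using h by (simp add: \<sigma>_def)
    then show ?thesis using lr(1) by (simp add: left_diff_distrib)
  qed
  ultimately have "\<bar>\<sigma> - v1 x\<bar> * h \<le> \<omega> * h" using lr h by (simp add: abs_mult)
  then have \<sigma>: "\<bar>\<sigma> - v1 x\<bar> \<le> \<omega>" using h by simp
  have e1: "\<bar>v x - v l - v1 x * (x - l)\<bar> \<le> \<omega> * (x - l)"
    using lr osc[of _ x] I[of l x] unfolding l_def[symmetric] r_def[symmetric]
    by (intro increment_oscillation[of v1 v]) auto
  have "\<bar>(v r - v l) - (q1 - q0)\<bar> \<le> 1 / real n ^ 2" using q by (auto simp: abs_le_iff)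
  then have "\<bar>(v r - v l) - (q1 - q0)\<bar> / h \<le> 1 / real n ^ 2 / h"
    using h by (intro divide_right_mono) auto
  moreover have "\<sigma> - (q1 - q0) / h = ((v r - v l) - (q1 - q0)) / h"
    by (simp add: \<sigma>_def diff_divide_distrib)
  ultimately have "\<bar>\<sigma> - (q1 - q0) / h\<bar> \<le> 1 / (real n ^ 2 * h)"
    using h by (simp add: abs_divide)
  then show "\<bar>v1 x - p' x\<bar> \<le> \<omega> + 1 / (real n ^ 2 * h)"
    using \<sigma> unfolding p'x by linarith
  have "\<omega> \<ge> 0" using \<sigma> by linarith
  \<comment> \<open>Deviation of v from the line of slope \<open>v1 x\<close>, deviation of this
    slope from the secant slope, and a convex combination of the two rounding errors. Each of the
    first two contributes h \<omega>.\<close>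
  have "v x - p x = (v x - v l - v1 x * (x - l)) + (v1 x - \<sigma>) * (x - l)
     + ((1 - \<theta>) * (v l - q0) + \<theta> * (v r - q1))"
  proof -
    have "x - l = \<theta> * h" using h by (simp add: \<theta>_def)
    moreover have "\<sigma> * h = v r - v l" using h by (simp add: \<sigma>_def)
    ultimately have "\<sigma> * (x - l) = \<theta> * (v r - v l)" by (metis mult.commute mult.left_commute)
    then show ?thesis unfolding px by (simp add: algebra_simps)
  qed
  moreover have "\<bar>(v1 x - \<sigma>) * (x - l)\<bar> \<le> \<omega> * h"
    unfolding abs_mult using \<sigma> lr \<open>\<omega> \<ge> 0\<close> by (intro mult_mono) auto
  moreover have "\<omega> * (x - l) \<le> \<omega> * h" using lr \<open>\<omega> \<ge> 0\<close> by (intro mult_left_mono) auto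
  moreover have "\<bar>(1 - \<theta>) * (v l - q0) + \<theta> * (v r - q1)\<bar> \<le> 1 / real n ^ 2"
  proof -
    have "(1 - \<theta>) * (v l - q0) \<le> (1 - \<theta>) * (1 / real n ^ 2)" "\<theta> * (v r - q1) \<le> \<theta> * (1 / real n ^ 2)"
      by (rule mult_left_mono; use \<theta> q in linarith)+
    moreover have "0 \<le> (1 - \<theta>) * (v l - q0)" "0 \<le> \<theta> * (v r - q1)" using \<theta> q by auto
    moreover have "(1 - \<theta>) * (1 / real n ^ 2) + \<theta> * (1 / real n ^ 2) = 1 / real n ^ 2"
      by (simp flip: add_divide_distrib)
    ultimately show ?thesis by linarith
  qed
  ultimately show "\<bar>v x - p x\<bar> \<le> 2 * h * \<omega> + 1 / real n ^ 2" using e1 by (simp add: algebra_simps)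
qed

text \<open>A pointwise bound of order h * sqrt (h * J) loses half a power of h if J is replaced by
  the integral over D. Keeping the share of the single cell on the right and summing over disjoint
  cells recovers the full order. The 2 in front of \<beta> is n * h.\<close>

lemma integral_le_sum_cells:
  fixes \<phi> \<psi> :: "real \<Rightarrow> real" and n :: nat and h \<alpha> \<beta> :: real
  assumes n: "0 < n" and h: "h = 2 / real n"
    and int: "\<phi> integrable_on D" "\<psi> integrable_on D"
    and le: "\<And>j x. j < n \<Longrightarrow> -1 + real j * h < x \<Longrightarrow> x \<le> -1 + real (j + 1) * h \<Longrightarrow>
      \<phi> x \<le> \<alpha> * integral {-1 + real j * h..-1 + real (j + 1) * h} \<psi> + \<beta>"
  shows "integral D \<phi> \<le> \<alpha> * h * integral D \<psi> + 2 * \<beta>"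
proof -
  have hn: "0 < h" "real n * h = 2" using n h by auto
  have step: "integral {-1..-1 + real j * h} \<phi> \<le> \<alpha> * h * integral {-1..-1 + real j * h} \<psi> + real j * h * \<beta>"
    if "j \<le> n" for j
    using that
  proof (induction j)
    case (Suc j)
    define l r where "l = -1 + real j * h" and "r = -1 + real (j + 1) * h"
    have lr: "-1 \<le> l" "l \<le> r" "r = l + h" using hn by (auto simp: l_def r_def algebra_simps)
    have "real (j + 1) * h \<le> real n * h" using Suc hn by (intro mult_right_mono) auto
    then have r1: "r \<le> 1" using hn by (simp add: r_def)
    have sub: "f integrable_on {-1..r}" "f integrable_on {l..r}" if "f integrable_on D" for f :: "real \<Rightarrow> real"
      using that lr r1 by (auto intro: integrable_on_subinterval)
    define C where "C = \<alpha> * integral {l..r} \<psi> + \<beta>"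
    \<comment> \<open>The bound excludes the left node, so the value there is overwritten; one point
      is negligible.\<close>
    have "integral {l..r} \<phi> = integral {l..r} (\<lambda>x. if x = l then C else \<phi> x)"
      by (rule integral_spike[of "{l}"]) auto
    also have "\<dots> \<le> integral {l..r} (\<lambda>x. C)"
    proof (rule integral_le)
      show "(\<lambda>x. if x = l then C else \<phi> x) integrable_on {l..r}"
        by (rule integrable_spike[OF sub(2)[OF int(1)], of "{l}"]) auto
      show "(if x = l then C else \<phi> x) \<le> C" if "x \<in> {l..r}" for x
        using le[of j x] Suc.prems that by (auto simp: C_def l_def r_def)
    qed auto
    also have "\<dots> = h * C" using lr by simp
    finally have cell: "integral {l..r} \<phi> \<le> h * C" .
    have comb: "integral {-1..l} f + integral {l..r} f = integral {-1..r} f" if "f integrable_on D" for f :: "real \<Rightarrow> real"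
      using sub[OF that] lr by (intro Henstock_Kurzweil_Integration.integral_combine) auto
    have "integral {-1..l} \<phi> \<le> \<alpha> * h * integral {-1..l} \<psi> + real j * h * \<beta>"
      using Suc unfolding l_def by auto
    then have "integral {-1..r} \<phi> \<le> \<alpha> * h * integral {-1..l} \<psi> + real j * h * \<beta> + h * C"
      using cell comb[OF int(1)] by linarith
    also have "\<dots> = \<alpha> * h * (integral {-1..l} \<psi> + integral {l..r} \<psi>) + real (Suc j) * h * \<beta>"
      by (simp add: C_def algebra_simps)
    finally show ?case unfolding comb[OF int(2)] by (simp add: r_def)
  qed simp
  show ?thesis using step[of n] hn by simp
qed

lemma two_sq_bound: "(x :: real)\<^sup>2 \<le> 2 * s\<^sup>2 + 2 * t\<^sup>2" if "\<bar>x\<bar> \<le> s + t"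
proof -
  have "x\<^sup>2 \<le> (s + t)\<^sup>2" using that abs_le_square_iff[of x "s + t"] by linarith
  also have "\<dots> \<le> 2 * s\<^sup>2 + 2 * t\<^sup>2"
    using zero_le_power2[of "s - t"] by (simp add: power2_eq_square algebra_simps)
  finally show ?thesis .
qed

text \<open>By Cauchy-Schwarz, w1 oscillates on cell j by at most sqrt (h * J j), where
  \<open>J j\<close> is the share of that cell in the integral of w2^2. With h = 2 / n the factors 8
  h^4 and 2 h^2 become 128 / n^4 and 8 / n^2.\<close>

lemma smooth_interpolation_error:
  fixes w w1 w2 :: "real \<Rightarrow> real" and n :: nat
  defines "h \<equiv> 2 / real n"
  defines "p \<equiv> \<lambda>x. pl n (quantized n (-1) h w) ((x - (-1)) / h) / real n ^ 2"
    and "p' \<equiv> \<lambda>x. dpl n (quantized n (-1) h w) ((x - (-1)) / h) / h / real n ^ 2"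
  assumes n: "0 < n" and w: "H1_deriv w w1" and w1: "H1_deriv w1 w2"
    and K: "integral D (\<lambda>x. (w2 x)\<^sup>2) \<le> K"
  shows "H1_deriv p p'"
    and "integral D (\<lambda>x. (w x - p x)\<^sup>2) \<le> (128 * K + 4) / real n ^ 4"
    and "integral D (\<lambda>x. (w1 x - p' x)\<^sup>2) \<le> (8 * K + 1) / real n ^ 2"
proof -
  have h: "0 < h" using n by (simp add: h_def)
  show p: "H1_deriv p p'"
    using H1_deriv_scale[OF H1_deriv_pl[OF h], of "1 / real n ^ 2" n "quantized n (-1) h w" "-1"]
    by (simp add: p_def p'_def mult.commute)
  have w2: "L2 w2" using w1 H1_deriv_L2 by blast
  define J where "J j = integral {-1 + real j * h..-1 + real (j + 1) * h} (\<lambda>x. (w2 x)\<^sup>2)" for j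
  have cell: "\<bar>w x - p x\<bar> \<le> 2 * h * sqrt (h * J j) + 1 / real n ^ 2 \<and>
      \<bar>w1 x - p' x\<bar> \<le> sqrt (h * J j) + 1 / (real n ^ 2 * h) \<and> 0 \<le> J j"
    if j: "j < n" and x: "-1 + real j * h < x" "x \<le> -1 + real (j + 1) * h" for j x
  proof -
    have "real (j + 1) * h \<le> real n * h" using j h by (intro mult_right_mono) auto
    then have ends: "-1 \<le> -1 + real j * h" "-1 + real (j + 1) * h \<le> 1" using h n by (auto simp: h_def)
    have Jsub: "integral {s..t} (\<lambda>x. (w2 x)\<^sup>2) \<le> J j" if "-1 + real j * h \<le> s" "t \<le> -1 + real (j + 1) * h" for s t
      unfolding J_def using that ends w2
      by (intro integral_subset_le L2_power2_integrable_on) auto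
    have J0: "0 \<le> J j" unfolding J_def using ends w2
      by (intro Henstock_Kurzweil_Integration.integral_nonneg L2_power2_integrable_on) auto
    have I: "(w1 has_integral (w t - w s)) {s..t}"
      if "-1 + real j * h \<le> s" "s \<le> t" "t \<le> -1 + real (j + 1) * h" for s t
      using that ends H1_deriv_increment[OF w, of s t] L2_integrable_on[OF H1_deriv_L2[OF w], of s t]
      by (auto simp: has_integral_iff)
    have osc1: "\<bar>w1 t - w1 s\<bar> \<le> sqrt (h * J j)"
      if "-1 + real j * h \<le> s" "s \<le> t" "t \<le> -1 + real (j + 1) * h" for s t
    proof -
      have "(w1 t - w1 s)\<^sup>2 = (integral {s..t} w2)\<^sup>2"
        using that ends H1_deriv_increment[OF w1, of s t] by simp
      also have "\<dots> \<le> (t - s) * integral {s..t} (\<lambda>x. (w2 x)\<^sup>2)"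
        using that ends by (intro L2_cauchy_schwarz w2) auto
      also have "\<dots> \<le> h * J j"
      proof (intro mult_mono Jsub that)
        have "-1 + real (j + 1) * h = -1 + real j * h + h" by (simp add: algebra_simps)
        then show "t - s \<le> h" using that by linarith
        show "0 \<le> integral {s..t} (\<lambda>x. (w2 x)\<^sup>2)" using that ends w2
          by (intro Henstock_Kurzweil_Integration.integral_nonneg L2_power2_integrable_on) auto
      qed (use h in auto)
      finally show ?thesis by (simp add: real_le_rsqrt)
    qed
    have osc: "\<bar>w1 s - w1 t\<bar> \<le> sqrt (h * J j)"
      if "s \<in> {-1 + real j * h..-1 + real (j + 1) * h}" "t \<in> {-1 + real j * h..-1 + real (j + 1) * h}" for s t
      using osc1[of s t] osc1[of t s] that by (cases "s \<le> t") auto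
    show ?thesis unfolding p_def p'_def
      using quantized_cell_error[OF n h j x I osc] J0 by simp
  qed
  have diff: "L2 (\<lambda>x. w x - p x)" "L2 (\<lambda>x. w1 x - p' x)"
    using H1_deriv_L2_self[OF w] H1_deriv_L2[OF w] H1_deriv_L2_self[OF p] H1_deriv_L2[OF p]
    by (auto intro: L2_diff)
  have hn: "h * real n = 2" using n by (simp add: h_def)
  have "integral D (\<lambda>x. (w x - p x)\<^sup>2) \<le>
      (8 * h ^ 3) * h * integral D (\<lambda>x. (w2 x)\<^sup>2) + 2 * (2 / real n ^ 4)"
  proof (rule integral_le_sum_cells[OF n h_def[THEN meta_eq_to_obj_eq]])
    fix j x assume jx: "j < n" "-1 + real j * h < x" "x \<le> -1 + real (j + 1) * h"
    have "(w x - p x)\<^sup>2 \<le> 2 * (2 * h * sqrt (h * J j))\<^sup>2 + 2 * (1 / real n ^ 2)\<^sup>2"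
      using cell[OF jx] by (intro two_sq_bound) auto
    also have "\<dots> = 8 * h ^ 3 * J j + 2 / real n ^ 4"
    proof -
      have "(sqrt (h * J j))\<^sup>2 = h * J j" using cell[OF jx] h by simp
      then show ?thesis unfolding power_mult_distrib
        by (simp add: power_divide power2_eq_square power3_eq_cube power4_eq_xxxx mult.assoc)
    qed
    finally show "(w x - p x)\<^sup>2 \<le> 8 * h ^ 3 * integral {-1 + real j * h..-1 + real (j + 1) * h} (\<lambda>x. (w2 x)\<^sup>2) + 2 / real n ^ 4"
      by (simp add: J_def)
  qed (use diff w2 in \<open>auto intro: L2_power2_integrable_on\<close>)
  also have "\<dots> \<le> (8 * h ^ 3) * h * K + 2 * (2 / real n ^ 4)"
    using K h by (intro add_right_mono mult_left_mono) auto
  also have "\<dots> = (128 * K + 4) / real n ^ 4"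
    using n by (simp add: h_def power3_eq_cube power4_eq_xxxx field_simps)
  finally show "integral D (\<lambda>x. (w x - p x)\<^sup>2) \<le> (128 * K + 4) / real n ^ 4" .
  have "integral D (\<lambda>x. (w1 x - p' x)\<^sup>2) \<le>
      (2 * h) * h * integral D (\<lambda>x. (w2 x)\<^sup>2) + 2 * (1 / (2 * real n ^ 2))"
  proof (rule integral_le_sum_cells[OF n h_def[THEN meta_eq_to_obj_eq]])
    fix j x assume jx: "j < n" "-1 + real j * h < x" "x \<le> -1 + real (j + 1) * h"
    have "(w1 x - p' x)\<^sup>2 \<le> 2 * (sqrt (h * J j))\<^sup>2 + 2 * (1 / (real n ^ 2 * h))\<^sup>2"
      using cell[OF jx] by (intro two_sq_bound) auto
    also have "\<dots> = 2 * h * J j + 1 / (2 * real n ^ 2)"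
    proof -
      have "real n ^ 2 * h = 2 * real n" using hn by (simp add: power2_eq_square mult.commute)
      moreover have "(sqrt (h * J j))\<^sup>2 = h * J j" using cell[OF jx] h by simp
      ultimately show ?thesis by (simp add: power_divide power_mult_distrib)
    qed
    finally show "(w1 x - p' x)\<^sup>2 \<le> 2 * h * integral {-1 + real j * h..-1 + real (j + 1) * h} (\<lambda>x. (w2 x)\<^sup>2) + 1 / (2 * real n ^ 2)"
      by (simp add: J_def)
  qed (use diff w2 in \<open>auto intro: L2_power2_integrable_on\<close>)
  also have "\<dots> \<le> (2 * h) * h * K + 2 * (1 / (2 * real n ^ 2))"
    using K h by (intro add_right_mono mult_left_mono) auto
  also have "\<dots> = (8 * K + 1) / real n ^ 2"
    using n by (simp add: h_def power2_eq_square field_simps)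
  finally show "integral D (\<lambda>x. (w1 x - p' x)\<^sup>2) \<le> (8 * K + 1) / real n ^ 2" .
qed

text \<open>Ceiling minus one in place of the floor, to match cells that are open on the
  left.\<close>

lemma cell_index:
  fixes n :: nat and a h x :: real
  assumes "0 < h" "a < x" "x \<le> a + real n * h"
  obtains j where "j < n" "a + real j * h < x" "x \<le> a + real (j + 1) * h"
proof -
  define s where "s = (x - a) / h"
  have s: "0 < s" "s \<le> real n" "x = a + s * h" using assms by (auto simp: s_def field_simps)
  define j where "j = nat (\<lceil>s\<rceil> - 1)"
  have c: "1 \<le> \<lceil>s\<rceil>" "\<lceil>s\<rceil> \<le> int n" using s by (auto simp: ceiling_le_iff)
  then have rj: "real j = of_int \<lceil>s\<rceil> - 1" by (simp add: j_def)
  have "real j < s" "s \<le> real (j + 1)" using rj by (simp_all, linarith+)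
  moreover have "j < n" using c unfolding j_def by linarith
  ultimately show ?thesis
    using that[of j] s assms(1) by (simp add: mult_strict_right_mono mult_right_mono)
qed

text \<open>On the grid, v'' = c^2 v \<le> c^2 bounds the oscillation of v' by c^2 h. Off the grid
  the interpolant is frozen at an end value, where both this value and v are of rounding size. The
  conditional clauses \<open>right\<close> and \<open>left\<close> let one lemma cover layers at
  either end. At x = a the left derivative \<open>dpl\<close> is 0 while v' may be large, hence
  \<open>x \<noteq> a\<close>.\<close>

lemma layer_interpolation_error:
  fixes c d a h x :: real and n :: nat and v :: "real \<Rightarrow> real"
  defines "p \<equiv> \<lambda>x. pl n (quantized n a h v) ((x - a) / h) / real n ^ 2"
    and "p' \<equiv> \<lambda>x. dpl n (quantized n a h v) ((x - a) / h) / h / real n ^ 2"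
  assumes v_def: "v = (\<lambda>x. exp (c * x + d))" and n: "0 < n" and h: "0 < h"
    and inside: "\<And>x. a \<le> x \<Longrightarrow> x \<le> a + real n * h \<Longrightarrow> v x \<le> 1"
    and right: "a + real n * h < x \<Longrightarrow> v x \<le> 1 / real n ^ 2 \<and> v (a + real n * h) \<le> 1 / real n ^ 2"
    and left: "x < a \<Longrightarrow> v x \<le> 1 / real n ^ 2 \<and> v a \<le> 1 / real n ^ 2"
    and x: "x \<noteq> a"
  shows "\<bar>v x - p x\<bar> \<le> 2 * h\<^sup>2 * c\<^sup>2 + 2 / real n ^ 2"
    and "\<bar>c * v x - p' x\<bar> \<le> c\<^sup>2 * h + 1 / (real n ^ 2 * h) + \<bar>c\<bar> / real n ^ 2"
proof -
  define Y where "Y = quantized n a h v"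
  have pos: "0 < v x" for x by (simp add: v_def)
  have I: "((\<lambda>x. c * v x) has_integral (v t - v s)) {s..t}" if "s \<le> t" for s t
    using that by (intro fundamental_theorem_of_calculus)
      (auto simp: v_def simp flip: has_real_derivative_iff_has_vector_derivative intro!: derivative_eq_intros)
  have I2: "((\<lambda>x. c * (c * v x)) has_integral (c * v t - c * v s)) {s..t}" if "s \<le> t" for s t
    using has_integral_mult_right[OF I[OF that], of c] by (simp add: right_diff_distrib)
  have nn: "0 \<le> 2 * h\<^sup>2 * c\<^sup>2" "0 \<le> c\<^sup>2 * h" "0 \<le> 1 / (real n ^ 2 * h)" "0 \<le> \<bar>c\<bar> / real n ^ 2" "0 \<le> 1 / real n ^ 2"
    using h by auto
  have outside: "\<bar>v x - q / real n ^ 2\<bar> \<le> 2 * h\<^sup>2 * c\<^sup>2 + 2 / real n ^ 2 \<and>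
      \<bar>c * v x - 0\<bar> \<le> c\<^sup>2 * h + 1 / (real n ^ 2 * h) + \<bar>c\<bar> / real n ^ 2"
    if "v x \<le> 1 / real n ^ 2" "v y \<le> 1 / real n ^ 2" "q / real n ^ 2 \<le> v y"
      "v y \<le> q / real n ^ 2 + 1 / real n ^ 2" for q y
  proof
    have two: "2 / real n ^ 2 = 1 / real n ^ 2 + 1 / real n ^ 2" by simp
    have "\<bar>v x - q / real n ^ 2\<bar> \<le> 2 / real n ^ 2"
      unfolding two using that pos[of x] pos[of y] by linarith
    then show "\<bar>v x - q / real n ^ 2\<bar> \<le> 2 * h\<^sup>2 * c\<^sup>2 + 2 / real n ^ 2" using nn by linarith
    have "\<bar>c * v x\<bar> \<le> \<bar>c\<bar> * (1 / real n ^ 2)"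
      unfolding abs_mult using that pos[of x] by (intro mult_left_mono) auto
    then show "\<bar>c * v x - 0\<bar> \<le> c\<^sup>2 * h + 1 / (real n ^ 2 * h) + \<bar>c\<bar> / real n ^ 2"
      using nn unfolding times_divide_eq_right mult_1_right diff_0_right by linarith
  qed
  consider "x < a" | "a + real n * h < x" | "a < x" "x \<le> a + real n * h" using x by linarith
  then have "\<bar>v x - p x\<bar> \<le> 2 * h\<^sup>2 * c\<^sup>2 + 2 / real n ^ 2 \<and>
    \<bar>c * v x - p' x\<bar> \<le> c\<^sup>2 * h + 1 / (real n ^ 2 * h) + \<bar>c\<bar> / real n ^ 2"
  proof cases
    case 1
    then have "(x - a) / h \<le> 0" using h by (simp add: divide_le_0_iff)
    then have "p x = Y 0 / real n ^ 2" "p' x = 0" by (auto simp: p_def p'_def pl_left dpl_left Y_def)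
    then show ?thesis
      using outside[of a "Y 0"] left[OF 1] quantized_error[OF n, where a=a and h=h and v=v and i=0]
      by (simp add: Y_def)
  next
    case 2
    then have "real n < (x - a) / h" using h by (simp add: field_simps)
    moreover have "Y (n + 1) = Y n" by (simp add: Y_def quantized_def)
    ultimately have "p x = Y n / real n ^ 2" "p' x = 0" by (auto simp: p_def p'_def pl_right dpl_right Y_def)
    then show ?thesis
      using outside[of "a + real n * h" "Y n"] right[OF 2] quantized_error[OF n, where a=a and h=h and v=v and i=n]
      by (simp add: Y_def)
  next
    case 3
    obtain j where j: "j < n" "a + real j * h < x" "x \<le> a + real (j + 1) * h"
      using cell_index[OF h 3] .
    have "real (j + 1) * h \<le> real n * h" using j h by (intro mult_right_mono) auto
    then have ends: "a \<le> a + real j * h" "a + real (j + 1) * h \<le> a + real n * h" using h by auto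
    have width: "a + real (j + 1) * h = a + real j * h + h" by (simp add: algebra_simps)
    have osc1: "\<bar>c * v t - c * v s\<bar> \<le> c\<^sup>2 * h"
      if "a + real j * h \<le> s" "s \<le> t" "t \<le> a + real (j + 1) * h" for s t
    proof -
      have "\<bar>c * v t - c * v s - 0 * (t - s)\<bar> \<le> c\<^sup>2 * (t - s)"
      proof (rule increment_oscillation[of "\<lambda>x. c * (c * v x)" "\<lambda>x. c * v x", OF I2[OF that(2)] that(2)])
        fix r assume "r \<in> {s..t}"
        then have "v r \<le> 1" using inside[of r] that ends by auto
        then have "\<bar>c * c\<bar> * \<bar>v r\<bar> \<le> \<bar>c * c\<bar> * 1" using pos[of r] by (intro mult_left_mono) auto
        then show "\<bar>c * (c * v r) - 0\<bar> \<le> c\<^sup>2" by (simp add: power2_eq_square abs_mult mult.assoc)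
      qed
      also have "\<dots> \<le> c\<^sup>2 * h" using that width by (intro mult_left_mono) auto
      finally show ?thesis by simp
    qed
    have osc: "\<bar>c * v s - c * v t\<bar> \<le> c\<^sup>2 * h"
      if "s \<in> {a + real j * h..a + real (j + 1) * h}" "t \<in> {a + real j * h..a + real (j + 1) * h}" for s t
      using osc1[of s t] osc1[of t s] that by (cases "s \<le> t") auto
    have "\<bar>v x - p x\<bar> \<le> 2 * h * (c\<^sup>2 * h) + 1 / real n ^ 2"
      unfolding p_def by (rule quantized_cell_error(1)[OF n h j _ osc]) (use I in auto)
    moreover have "2 * h * (c\<^sup>2 * h) = 2 * h\<^sup>2 * c\<^sup>2" by (simp add: power2_eq_square)
    moreover have "2 / real n ^ 2 = 1 / real n ^ 2 + 1 / real n ^ 2" by simp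
    moreover have "\<bar>c * v x - p' x\<bar> \<le> c\<^sup>2 * h + 1 / (real n ^ 2 * h)"
      unfolding p'_def by (rule quantized_cell_error(2)[OF n h j _ osc]) (use I in auto)
    ultimately show ?thesis using nn by linarith
  qed
  then show "\<bar>v x - p x\<bar> \<le> 2 * h\<^sup>2 * c\<^sup>2 + 2 / real n ^ 2"
    "\<bar>c * v x - p' x\<bar> \<le> c\<^sup>2 * h + 1 / (real n ^ 2 * h) + \<bar>c\<bar> / real n ^ 2" by auto
qed

section \<open>Networks for quantized interpolants\<close>

lemma quantized_abs_le:
  assumes "0 < h" "\<And>x. a \<le> x \<Longrightarrow> x \<le> a + real n * h \<Longrightarrow> \<bar>v x\<bar> \<le> V"
  shows "\<bar>quantized n a h v i\<bar> \<le> real n ^ 2 * V + 1"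
proof -
  define y where "y = v (a + real (min i n) * h) * real n ^ 2"
  have "real (min i n) * h \<le> real n * h" using assms(1) by (intro mult_right_mono) auto
  then have "\<bar>v (a + real (min i n) * h)\<bar> \<le> V" using assms by (intro assms(2)) auto
  then have "\<bar>y\<bar> \<le> V * real n ^ 2" unfolding y_def abs_mult by (simp add: mult_right_mono)
  then have "\<bar>of_int \<lfloor>y\<rfloor> :: real\<bar> \<le> V * real n ^ 2 + 1" by linarith
  then show ?thesis by (simp add: quantized_def y_def mult.commute)
qed

text \<open>Only the number of bits enters the depth, and it grows like the logarithm of the bounds.
  So differences may be bounded crudely by 2 M and second differences by 4 M, straight from the size
  of the nodal values.\<close>

lemma registers_quantized:
  fixes m :: nat
  defines "n \<equiv> m * m"
  assumes m: "3 \<le> m" and h: "0 < h" and V: "\<And>x. a \<le> x \<Longrightarrow> x \<le> a + real n * h \<Longrightarrow> \<bar>v x\<bar> \<le> V"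
    and B: "4 * (real n ^ 2 * V + 1) < 2 ^ B"
    and reg: "registers w L ss" and s: "s \<in> set ss" and w: "2 * length ss + 16 \<le> w"
  shows "\<exists>L'. L' \<le> L + 3 * (m + 1) + 2 * (m * (B + 1)) + 2 \<and>
    registers w L' (ss @ [\<lambda>x. pl n (quantized n a h v) (s x)])"
proof -
  define M where "M = real n ^ 2 * V + 1"
  have bd: "\<bar>quantized n a h v i\<bar> \<le> M" for i unfolding M_def by (rule quantized_abs_le[OF h V])
  have B: "4 * M < 2 ^ B" using B by (simp add: M_def)
  show ?thesis unfolding n_def
  proof (rule registers_pl[OF m _ _ _ _ reg s w, of _ B "2 * M"], fold n_def)
    fix i
    show "quantized n a h v i \<in> \<int>" by (simp add: quantized_def)
    show "\<bar>quantized n a h v (i + 1) - quantized n a h v i\<bar> \<le> 2 * M"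
      using bd[of i] bd[of "i + 1"] by linarith
    have "\<bar>second_diff (quantized n a h v) i\<bar> \<le> 4 * M"
      using bd[of i] bd[of "i + 1"] bd[of "i - 1"] unfolding second_diff_def by (cases "i = 0") auto
    then show "\<bar>second_diff (quantized n a h v) i\<bar> < 2 ^ B" using B by linarith
  qed (simp add: quantized_def)
qed

lemma affine_span_rescale: "affine_span {\<lambda>x. x} (\<lambda>x. (x - a) / h)"
proof -
  have "affine_span {\<lambda>x. x} (\<lambda>x. (1 / h) * x + (- a / h))"
    by (intro affine_span.add affine_span.scale affine_span.const affine_span.base) simp
  moreover have "(\<lambda>x. (1 / h) * x + (- a / h)) = (\<lambda>x. (x - a) / h)"
    by (auto simp: diff_divide_distrib)
  ultimately show ?thesis by simp
qed

text \<open>The interpolants are computed one after another, with finished ones kept as registers: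
  depths add up, the width stays bounded. Each run costs 3 (m + 1) + 2 m (B + 1) + 2 layers and the
  output 2 more; 2550 is 50 * 50 + 50.\<close>

lemma network_three_interpolants:
  fixes m :: nat
  defines "n \<equiv> m * m"
  assumes m: "3 \<le> m" and B: "4 * (real n ^ 2 * V + 1) < 2 ^ B"
    and h: "0 < h1" "0 < h2" "0 < h3"
    and V1: "\<And>x. a1 \<le> x \<Longrightarrow> x \<le> a1 + real n * h1 \<Longrightarrow> \<bar>v1 x\<bar> \<le> V"
    and V2: "\<And>x. a2 \<le> x \<Longrightarrow> x \<le> a2 + real n * h2 \<Longrightarrow> \<bar>v2 x\<bar> \<le> V"
    and V3: "\<And>x. a3 \<le> x \<Longrightarrow> x \<le> a3 + real n * h3 \<Longrightarrow> \<bar>v3 x\<bar> \<le> V"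
  shows "\<exists>\<Phi>. relu_network \<Phi> \<and> width \<Phi> \<le> 50 \<and> depth \<Phi> \<le> 9 * (m + 1) + 6 * (m * (B + 1)) + 8 \<and>
    1 \<le> size_nn \<Phi> \<and> size_nn \<Phi> \<le> 2550 * (9 * (m + 1) + 6 * (m * (B + 1)) + 8) \<and>
    R \<Phi> = (\<lambda>x. c1 * pl n (quantized n a1 h1 v1) ((x - a1) / h1) +
      c2 * pl n (quantized n a2 h2 v2) ((x - a2) / h2) + c3 * pl n (quantized n a3 h3 v3) ((x - a3) / h3))"
proof -
  let ?s1 = "\<lambda>x. (x - a1) / h1" let ?s2 = "\<lambda>x. (x - a2) / h2" let ?s3 = "\<lambda>x. (x - a3) / h3"
  let ?p1 = "\<lambda>x. pl n (quantized n a1 h1 v1) (?s1 x)"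
  let ?p2 = "\<lambda>x. pl n (quantized n a2 h2 v2) (?s2 x)"
  let ?p3 = "\<lambda>x. pl n (quantized n a3 h3 v3) (?s3 x)"
  have 0: "registers 50 0 [?s1, ?s2, ?s3]"
    by (rule registers_affine[OF registers_input]) (use affine_span_rescale in auto)
  obtain L1 where L1: "L1 \<le> 0 + 3 * (m + 1) + 2 * (m * (B + 1)) + 2" "registers 50 L1 ([?s1, ?s2, ?s3] @ [?p1])"
    using registers_quantized[where v = v1 and a = a1 and V = V and s = ?s1, OF m h(1) V1[unfolded n_def] B[unfolded n_def] 0] unfolding n_def by auto
  obtain L2 where L2: "L2 \<le> L1 + 3 * (m + 1) + 2 * (m * (B + 1)) + 2"
      "registers 50 L2 (([?s1, ?s2, ?s3] @ [?p1]) @ [?p2])"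
    using registers_quantized[where v = v2 and a = a2 and V = V and s = ?s2, OF m h(2) V2[unfolded n_def] B[unfolded n_def] L1(2)] unfolding n_def by auto
  obtain L3 where L3: "L3 \<le> L2 + 3 * (m + 1) + 2 * (m * (B + 1)) + 2"
      "registers 50 L3 ((([?s1, ?s2, ?s3] @ [?p1]) @ [?p2]) @ [?p3])"
    using registers_quantized[where v = v3 and a = a3 and V = V and s = ?s3, OF m h(3) V3[unfolded n_def] B[unfolded n_def] L2(2)] unfolding n_def by auto
  let ?F = "\<lambda>x. c1 * ?p1 x + c2 * ?p2 x + c3 * ?p3 x"
  have "registers 50 L3 [?F]"
    by (rule registers_affine[OF L3(2)])
      (auto intro!: affine_span.add affine_span.scale intro: affine_span.base)
  from registers_network[OF this, of ?F]
  obtain \<Phi> where \<Phi>: "relu_network \<Phi>" "width \<Phi> \<le> 50" "depth \<Phi> = L3 + 2" "1 \<le> size_nn \<Phi>"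
    "size_nn \<Phi> \<le> (L3 + 2) * 2550" "R \<Phi> = ?F" by auto
  have "L3 + 2 \<le> 9 * (m + 1) + 6 * (m * (B + 1)) + 8" using L1(1) L2(1) L3(1) by simp
  then show ?thesis using \<Phi> by (intro exI[of _ \<Phi>]) auto
qed

section \<open>Approximation of the solution\<close>

text \<open>Joins two kinds of estimates: the smooth part \<phi> is small in L2, the layer part
  \<psi> is small pointwise off finitely many nodes. The 4 is twice the length of D.\<close>

lemma L2_perturbation:
  assumes "L2 \<phi>" "L2 \<psi>" "finite S" "\<And>x. x \<in> D - S \<Longrightarrow> \<bar>\<psi> x\<bar> \<le> M"
  shows "integral D (\<lambda>x. (\<phi> x + \<psi> x)\<^sup>2) \<le> 2 * integral D (\<lambda>x. (\<phi> x)\<^sup>2) + 4 * M\<^sup>2"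
proof -
  have i: "(\<lambda>x. (\<phi> x)\<^sup>2) integrable_on D" "(\<lambda>x. (\<phi> x + \<psi> x)\<^sup>2) integrable_on D"
    using assms L2_add by (auto intro!: L2_power2_integrable_on)
  let ?F = "\<lambda>x. if x \<in> S then 2 * (\<phi> x)\<^sup>2 + 2 * M\<^sup>2 else (\<phi> x + \<psi> x)\<^sup>2"
  have "integral D (\<lambda>x. (\<phi> x + \<psi> x)\<^sup>2) = integral D ?F"
    using assms(3) by (intro integral_spike[of S]) (auto intro: negligible_finite)
  also have "\<dots> \<le> integral D (\<lambda>x. 2 * (\<phi> x)\<^sup>2 + 2 * M\<^sup>2)"
  proof (rule integral_le)
    show "?F integrable_on D"
      by (rule integrable_spike[OF i(2), of S]) (use assms(3) in \<open>auto intro: negligible_finite\<close>)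
    show "(\<lambda>x. 2 * (\<phi> x)\<^sup>2 + 2 * M\<^sup>2) integrable_on D"
      using i by (intro integrable_add integrable_on_mult_right) auto
    fix x :: real assume x: "x \<in> D"
    show "?F x \<le> 2 * (\<phi> x)\<^sup>2 + 2 * M\<^sup>2"
    proof (cases "x \<in> S")
      case False
      then have "\<bar>\<psi> x\<bar> \<le> M" using assms(4) x by auto
      then have "\<bar>\<phi> x + \<psi> x\<bar> \<le> \<bar>\<phi> x\<bar> + M" by linarith
      from two_sq_bound[OF this] show ?thesis using False by simp
    qed simp
  qed
  also have "\<dots> = 2 * integral D (\<lambda>x. (\<phi> x)\<^sup>2) + 4 * M\<^sup>2"
    using i by (subst Henstock_Kurzweil_Integration.integral_add) (auto intro: integrable_on_mult_right)
  finally show ?thesis .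
qed

lemma energy_norm_le:
  assumes "L2 w" "L2 g" "0 \<le> b" "\<epsilon>\<^sup>2 * integral D (\<lambda>x. (g x)\<^sup>2) + b * integral D (\<lambda>x. (w x)\<^sup>2) \<le> M\<^sup>2" "0 \<le> M"
  shows "energy_norm \<epsilon> b w g \<le> M"
proof -
  have i: "set_integrable lebesgue D (\<lambda>x. (w x)\<^sup>2)" "set_integrable lebesgue D (\<lambda>x. (g x)\<^sup>2)"
    using assms by (auto simp: L2_def)
  have "(LINT x:D|lebesgue. \<epsilon>\<^sup>2 * (g x)\<^sup>2 + b * (w x)\<^sup>2) =
    (LINT x:D|lebesgue. \<epsilon>\<^sup>2 * (g x)\<^sup>2) + (LINT x:D|lebesgue. b * (w x)\<^sup>2)"
    using i by (intro set_integral_add(2) set_integrable_mult_right) auto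
  also have "\<dots> \<le> M\<^sup>2" using assms(4) LINT_eq_integral[OF i(1)] LINT_eq_integral[OF i(2)] by simp
  finally show ?thesis unfolding energy_norm_def using assms(5) by (intro real_le_lsqrt) auto
qed

lemma L2_norm_le:
  assumes "L2 w" "integral D (\<lambda>x. (w x)\<^sup>2) \<le> M\<^sup>2" "0 \<le> M"
  shows "L2_norm_I w \<le> M"
proof -
  have i: "set_integrable lebesgue D (\<lambda>x. (w x)\<^sup>2)" using assms by (auto simp: L2_def)
  show ?thesis unfolding L2_norm_I_def using assms LINT_eq_integral[OF i] by (intro real_le_lsqrt) auto
qed

lemma network_approximation:
  assumes b: "b > 0" and f: "H2 f"
  shows "\<exists>C V. 1 \<le> C \<and> 1 \<le> V \<and> (\<forall>m N \<epsilon> u u'. 3 \<le> m \<and> 4 * (real (m * m) ^ 2 * V + 1) < 2 ^ N \<and>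
    0 < \<epsilon> \<and> \<epsilon> \<le> 1 \<and> weak_solution \<epsilon> b f u u' \<longrightarrow>
    (\<exists>\<Phi>. relu_network \<Phi> \<and> width \<Phi> \<le> 50 \<and> depth \<Phi> \<le> 9 * (m + 1) + 6 * (m * (N + 1)) + 8 \<and>
      1 \<le> size_nn \<Phi> \<and> size_nn \<Phi> \<le> 2550 * (9 * (m + 1) + 6 * (m * (N + 1)) + 8) \<and>
      (\<exists>g. H1_deriv (\<lambda>x. u x - R \<Phi> x) g \<and>
        energy_norm \<epsilon> b (\<lambda>x. u x - R \<Phi> x) g \<le> C * (ln (real (m * m)))\<^sup>2 / real (m * m)) \<and>
      L2_norm_I (\<lambda>x. u x - R \<Phi> x) \<le> C * (ln (real (m * m)))\<^sup>2 / real (m * m) ^ 2))"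
proof -
  obtain K where K: "0 < K" and decomposition: "\<And>\<epsilon> u u'. 0 < \<epsilon> \<and> \<epsilon> \<le> 1 \<and> weak_solution \<epsilon> b f u u' \<Longrightarrow>
    (\<exists>A B w w1 w2. \<bar>A\<bar> \<le> K \<and> \<bar>B\<bar> \<le> K \<and> (\<forall>x\<in>D. \<bar>w x\<bar> \<le> K) \<and>
      H1_deriv w w1 \<and> H1_deriv w1 w2 \<and> integral D (\<lambda>x. (w2 x)\<^sup>2) \<le> K \<and>
      (\<forall>x\<in>D. u x = w x + A * exp (- sqrt b / \<epsilon> * (1 + x)) + B * exp (- sqrt b / \<epsilon> * (1 - x))))"
    using solution_decomposition[OF b f] by blast
  define C1 where "C1 = 2 * (128 * K + 4) + 4 * (20 * K)\<^sup>2"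
  define C2 where "C2 = 2 * (8 * K + 1) + 4 * (8 * K * sqrt b)\<^sup>2"
  \<comment> \<open>\<open>C1\<close> and \<open>C2\<close> bound squared norms. As C \<ge> 1 gives
    C \<le> C^2, the constant C itself remains valid after taking roots.\<close>
  define C where "C = 1 + C2 + (1 + b) * C1"
  have C1: "0 \<le> C1" and C2: "0 \<le> C2" using K b by (auto simp: C1_def C2_def)
  have "C1 \<le> (1 + b) * C1" "b * C1 \<le> (1 + b) * C1" "0 \<le> (1 + b) * C1" using b C1 by (auto simp: algebra_simps)
  then have C: "1 \<le> C" "C1 \<le> C" "C2 + b * C1 \<le> C" using C1 C2 by (auto simp: C_def algebra_simps)
  have "C * 1 \<le> C * C" using C by (intro mult_left_mono) auto
  then have CC: "C \<le> C\<^sup>2" by (simp add: power2_eq_square)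
  show ?thesis
  proof (rule exI[of _ C], rule exI[of _ "K + 1"], intro conjI allI impI)
    show "1 \<le> C" by (rule C)
    show "1 \<le> K + 1" using K by simp
    fix m N :: nat and \<epsilon> u u'
    assume H: "3 \<le> m \<and> 4 * (real (m * m) ^ 2 * (K + 1) + 1) < 2 ^ N \<and>
      0 < \<epsilon> \<and> \<epsilon> \<le> 1 \<and> weak_solution \<epsilon> b f u u'"
    then have m: "3 \<le> m" and N: "4 * (real (m * m) ^ 2 * (K + 1) + 1) < 2 ^ N" and \<epsilon>: "0 < \<epsilon>" "\<epsilon> \<le> 1" by auto
    obtain A B w w1 w2 where AB: "\<bar>A\<bar> \<le> K" "\<bar>B\<bar> \<le> K" and wK: "\<And>x. x \<in> D \<Longrightarrow> \<bar>w x\<bar> \<le> K"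
      and w: "H1_deriv w w1" and w1: "H1_deriv w1 w2" and w2: "integral D (\<lambda>x. (w2 x)\<^sup>2) \<le> K"
      and u: "\<And>x. x \<in> D \<Longrightarrow> u x = w x + A * exp (- sqrt b / \<epsilon> * (1 + x)) + B * exp (- sqrt b / \<epsilon> * (1 - x))"
      using decomposition[of \<epsilon> u u'] H by blast
    define n where "n = m * m"
    have n9: "9 \<le> n" using mult_le_mono[OF m m] by (simp add: n_def)
    then have n: "0 < n" "9 \<le> real n" by auto
    define \<Lambda> where "\<Lambda> = ln (real n)"
    have \<Lambda>: "1 \<le> \<Lambda>"
    proof -
      have "exp 1 \<le> real n" using exp_le n by linarith
      then show ?thesis unfolding \<Lambda>_def using n by (simp add: ln_ge_iff)
    qed
    \<comment> \<open>Chosen so that exp (- sqrt b * T) = 1 / n^2: at distance \<epsilon> T from its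
      end point a layer has decayed to rounding size. The grid may run past the opposite end of D,
      and the bounds \<open>in2\<close> and \<open>in3\<close> hold there as well.\<close>
    define T where "T = 2 / sqrt b * \<Lambda>"
    define c where "c = sqrt b / \<epsilon>"
    define h where "h = \<epsilon> * T / real n"
    have sb: "0 < sqrt b" "sqrt b * sqrt b = b" using b by auto
    have T: "0 < T" "sqrt b * T = 2 * \<Lambda>" using sb \<Lambda> by (auto simp: T_def)
    have h: "0 < h" "real n * h = \<epsilon> * T" using T \<epsilon> n by (auto simp: h_def)
    have c: "0 < c" "c * \<epsilon> = sqrt b" "c * (\<epsilon> * T) = 2 * \<Lambda>" using sb \<epsilon> T by (auto simp: c_def)
    have tail: "exp (- (2 * \<Lambda>)) = 1 / real n ^ 2"
      using n by (simp add: \<Lambda>_def exp_minus exp_double field_simps)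
    define v2 where "v2 = (\<lambda>x. exp (- c * x + - c))"
    define v3 where "v3 = (\<lambda>x. exp (c * x + - c))"
    define a3 where "a3 = 1 - \<epsilon> * T"
    define h1 where "h1 = 2 / real n"
    have h1: "0 < h1" "real n * h1 = 2" using n by (auto simp: h1_def)
    define p1 where "p1 = (\<lambda>x. pl n (quantized n (-1) h1 w) ((x - (-1)) / h1) / real n ^ 2)"
    define p1' where "p1' = (\<lambda>x. dpl n (quantized n (-1) h1 w) ((x - (-1)) / h1) / h1 / real n ^ 2)"
    define p2 where "p2 = (\<lambda>x. pl n (quantized n (-1) h v2) ((x - (-1)) / h) / real n ^ 2)"
    define p2' where "p2' = (\<lambda>x. dpl n (quantized n (-1) h v2) ((x - (-1)) / h) / h / real n ^ 2)"
    define p3 where "p3 = (\<lambda>x. pl n (quantized n a3 h v3) ((x - a3) / h) / real n ^ 2)"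
    define p3' where "p3' = (\<lambda>x. dpl n (quantized n a3 h v3) ((x - a3) / h) / h / real n ^ 2)"
    note smooth = smooth_interpolation_error[OF n(1) w w1 w2, folded h1_def, folded p1_def p1'_def]
    define \<eta> where "\<eta> = 2 * h\<^sup>2 * c\<^sup>2 + 2 / real n ^ 2"
    define \<eta>' where "\<eta>' = c\<^sup>2 * h + 1 / (real n ^ 2 * h) + c / real n ^ 2"
    have in2: "v2 x \<le> 1" if "-1 \<le> x" for x
    proof -
      have "0 \<le> c * (x + 1)" using that c by (intro mult_nonneg_nonneg) auto
      then show ?thesis by (simp add: v2_def algebra_simps)
    qed
    have in3: "v3 x \<le> 1" if "x \<le> 1" for x
    proof -
      have "0 \<le> c * (1 - x)" using that c by (intro mult_nonneg_nonneg) auto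
      then show ?thesis by (simp add: v3_def algebra_simps)
    qed
    have layer2: "\<bar>v2 x - p2 x\<bar> \<le> \<eta>" "\<bar>- c * v2 x - p2' x\<bar> \<le> \<eta>'" if x: "x \<in> D" "x \<noteq> -1" for x
    proof -
      have out: "v2 y \<le> 1 / real n ^ 2" if "-1 + real n * h \<le> y" for y
      proof -
        have "c * (\<epsilon> * T) \<le> c * (y + 1)" using that h c by (intro mult_left_mono) auto
        then have "v2 y \<le> exp (- (2 * \<Lambda>))" using c by (simp add: v2_def algebra_simps)
        then show ?thesis by (simp add: tail)
      qed
      note err = layer_interpolation_error[OF v2_def n(1) h(1), of "-1" x]
      show "\<bar>v2 x - p2 x\<bar> \<le> \<eta>"
        using err(1) in2 out x by (auto simp: \<eta>_def p2_def)
      show "\<bar>- c * v2 x - p2' x\<bar> \<le> \<eta>'"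
        using err(2) in2 out x c by (auto simp: \<eta>'_def p2'_def)
    qed
    have layer3: "\<bar>v3 x - p3 x\<bar> \<le> \<eta>" "\<bar>c * v3 x - p3' x\<bar> \<le> \<eta>'" if x: "x \<in> D" "x \<noteq> a3" for x
    proof -
      have out: "v3 y \<le> 1 / real n ^ 2" if "y \<le> a3" for y
      proof -
        have "c * (\<epsilon> * T) \<le> c * (1 - y)" using that h c by (intro mult_left_mono) (auto simp: a3_def)
        then have "v3 y \<le> exp (- (2 * \<Lambda>))" using c by (simp add: v3_def algebra_simps)
        then show ?thesis by (simp add: tail)
      qed
      have "a3 + real n * h = 1" using h by (simp add: a3_def)
      note err = layer_interpolation_error[OF v3_def n(1) h(1), of a3 x, unfolded this]
      show "\<bar>v3 x - p3 x\<bar> \<le> \<eta>"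
        using err(1) in3 out x by (auto simp: \<eta>_def p3_def)
      show "\<bar>c * v3 x - p3' x\<bar> \<le> \<eta>'"
        using err(2) in3 out x c by (auto simp: \<eta>'_def p3'_def)
    qed
    have \<eta>: "\<eta> \<le> 10 * \<Lambda>\<^sup>2 / real n ^ 2"
    proof -
      \<comment> \<open>The mesh width is proportional to \<epsilon> and the decay rate c to 1 /
        \<epsilon>, so their product is free of \<epsilon>.\<close>
      have "h * c = 2 * \<Lambda> / real n" using c(3) by (simp add: h_def mult.commute)
      then have "h\<^sup>2 * c\<^sup>2 = (2 * \<Lambda> / real n)\<^sup>2" by (simp flip: power_mult_distrib)
      then have "\<eta> = (8 * \<Lambda>\<^sup>2 + 2) / real n ^ 2"
        by (simp add: \<eta>_def mult.assoc power_divide power_mult_distrib add_divide_distrib)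
      moreover have "1 \<le> \<Lambda>\<^sup>2" using \<Lambda> by simp
      ultimately show ?thesis by (simp add: divide_right_mono)
    qed
    \<comment> \<open>All three terms of \<open>\<eta>'\<close> grow like 1 / \<epsilon>. The factor
      \<epsilon> is the weight of the derivative in the energy norm and cancels this growth.\<close>
    have \<eta>': "\<epsilon> * \<eta>' \<le> 4 * sqrt b * \<Lambda> / real n"
    proof -
      have "\<epsilon> * (c\<^sup>2 * h) = (\<epsilon> * c) * (c * (\<epsilon> * T)) / real n" by (simp add: h_def power2_eq_square)
      then have 1: "\<epsilon> * (c\<^sup>2 * h) = 2 * sqrt b * \<Lambda> / real n" using c by (simp add: mult.commute)
      have "\<epsilon> * (1 / (real n ^ 2 * h)) = 1 / (real n * T)"
        using \<epsilon> T n by (simp add: h_def power2_eq_square)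
      also have "\<dots> = sqrt b / (2 * \<Lambda>) / real n" using sb \<Lambda> by (simp add: T_def field_simps)
      also have "\<dots> \<le> sqrt b * \<Lambda> / real n"
      proof (rule divide_right_mono)
        have "sqrt b / (2 * \<Lambda>) \<le> sqrt b / 1" using sb \<Lambda> by (intro divide_left_mono) auto
        also have "\<dots> \<le> sqrt b * \<Lambda>" using sb \<Lambda> by simp
        finally show "sqrt b / (2 * \<Lambda>) \<le> sqrt b * \<Lambda>" .
      qed simp
      finally have 2: "\<epsilon> * (1 / (real n ^ 2 * h)) \<le> sqrt b * \<Lambda> / real n" .
      have "\<epsilon> * (c / real n ^ 2) = sqrt b * (1 / real n) / real n" using c by (simp add: power2_eq_square mult.commute)
      also have "\<dots> \<le> sqrt b * \<Lambda> / real n"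
      proof (intro divide_right_mono mult_left_mono)
        have "1 / real n \<le> 1" using n by simp
        then show "1 / real n \<le> \<Lambda>" using \<Lambda> by linarith
      qed (use sb in auto)
      finally have 3: "\<epsilon> * (c / real n ^ 2) \<le> sqrt b * \<Lambda> / real n" .
      have "\<epsilon> * \<eta>' \<le> 2 * sqrt b * \<Lambda> / real n + sqrt b * \<Lambda> / real n + sqrt b * \<Lambda> / real n"
        unfolding \<eta>'_def distrib_left 1 by (intro add_mono 2 3 order_refl)
      also have "\<dots> = 4 * sqrt b * \<Lambda> / real n" by simp
      finally show ?thesis .
    qed
    define E where "E x = A * (v2 x - p2 x) + B * (v3 x - p3 x)" for x
    define E' where "E' x = A * (- c * v2 x - p2' x) + B * (c * v3 x - p3' x)" for x
    have AB_le: "\<bar>A * s + B * t\<bar> \<le> 2 * K * q" if "\<bar>s\<bar> \<le> q" "\<bar>t\<bar> \<le> q" for s t q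
    proof -
      have "\<bar>A * s\<bar> \<le> K * q" "\<bar>B * t\<bar> \<le> K * q"
        unfolding abs_mult using AB that by (auto intro!: mult_mono)
      then show ?thesis by linarith
    qed
    define \<mu> where "\<mu> = 20 * K * (\<Lambda>\<^sup>2 / real n ^ 2)"
    define \<mu>' where "\<mu>' = 8 * K * sqrt b * (\<Lambda> / real n)"
    \<comment> \<open>The left ends -1 and a3 of the layer grids, where \<open>dpl\<close> misses
      the slope of the layer, are left out; they form a null set.\<close>
    have Eb: "\<bar>E x\<bar> \<le> \<mu>" "\<bar>\<epsilon> * E' x\<bar> \<le> \<mu>'" if x: "x \<in> D - {-1, a3}" for x
    proof -
      have "\<bar>E x\<bar> \<le> 2 * K * \<eta>" unfolding E_def using layer2(1)[of x] layer3(1)[of x] x by (intro AB_le) auto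
      also have "\<dots> \<le> 2 * K * (10 * \<Lambda>\<^sup>2 / real n ^ 2)" using \<eta> K by (intro mult_left_mono) auto
      finally show "\<bar>E x\<bar> \<le> \<mu>" by (simp add: \<mu>_def)
      have "\<bar>E' x\<bar> \<le> 2 * K * \<eta>'" unfolding E'_def using layer2(2)[of x] layer3(2)[of x] x by (intro AB_le) auto
      then have "\<epsilon> * \<bar>E' x\<bar> \<le> \<epsilon> * (2 * K * \<eta>')" using \<epsilon> by (intro mult_left_mono) auto
      also have "\<dots> = 2 * K * (\<epsilon> * \<eta>')" by simp
      also have "\<dots> \<le> 2 * K * (4 * sqrt b * \<Lambda> / real n)" using \<eta>' K by (intro mult_left_mono) auto
      finally show "\<bar>\<epsilon> * E' x\<bar> \<le> \<mu>'" using \<epsilon> by (simp add: \<mu>'_def abs_mult)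
    qed
    have Hv: "H1_deriv v2 (\<lambda>x. - c * v2 x)" "H1_deriv v3 (\<lambda>x. c * v3 x)"
      unfolding v2_def v3_def by (rule H1_deriv_exp)+
    have Hp: "H1_deriv p2 p2'" "H1_deriv p3 p3'"
      using H1_deriv_scale[OF H1_deriv_pl[OF h(1)], of "1 / real n ^ 2" n "quantized n (-1) h v2" "-1"]
        H1_deriv_scale[OF H1_deriv_pl[OF h(1)], of "1 / real n ^ 2" n "quantized n a3 h v3" a3]
      by (simp_all add: p2_def p2'_def p3_def p3'_def mult.commute)
    have HE: "H1_deriv E E'" unfolding E_def[abs_def] E'_def[abs_def]
      by (intro H1_deriv_add H1_deriv_scale H1_deriv_diff Hv Hp)
    define \<phi> where "\<phi> x = w x - p1 x" for x
    define \<phi>' where "\<phi>' x = w1 x - p1' x" for x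
    have H\<phi>: "H1_deriv \<phi> \<phi>'" unfolding \<phi>_def[abs_def] \<phi>'_def[abs_def] by (intro H1_deriv_diff w smooth)
    have smooth_sq: "integral D (\<lambda>x. (\<phi> x)\<^sup>2) \<le> (128 * K + 4) / real n ^ 4"
      "integral D (\<lambda>x. (\<phi>' x)\<^sup>2) \<le> (8 * K + 1) / real n ^ 2"
      using smooth(2,3) by (simp_all add: \<phi>_def \<phi>'_def p1_def p1'_def)
    define g where "g x = \<phi>' x + E' x" for x
    have Herr: "H1_deriv (\<lambda>x. \<phi> x + E x) g" unfolding g_def[abs_def] by (intro H1_deriv_add H\<phi> HE)
    \<comment> \<open>Lower powers of \<Lambda> are raised to the fourth, so that the root of each
      squared norm carries the same factor \<Lambda>^2.\<close>
    have \<Lambda>pow: "1 \<le> \<Lambda> ^ 4" "\<Lambda>\<^sup>2 \<le> \<Lambda> ^ 4" using \<Lambda> by (auto intro: power_increasing)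
    have l2: "integral D (\<lambda>x. (\<phi> x + E x)\<^sup>2) \<le> C1 * (\<Lambda> ^ 4 / real n ^ 4)"
    proof -
      have "integral D (\<lambda>x. (\<phi> x + E x)\<^sup>2) \<le> 2 * integral D (\<lambda>x. (\<phi> x)\<^sup>2) + 4 * \<mu>\<^sup>2"
        using Eb(1) by (intro L2_perturbation[of _ _ "{-1, a3}"] H1_deriv_L2_self[OF H\<phi>] H1_deriv_L2_self[OF HE]) auto
      also have "\<dots> \<le> 2 * ((128 * K + 4) / real n ^ 4) + 4 * \<mu>\<^sup>2"
        by (intro add_right_mono mult_left_mono smooth_sq(1)) auto
      also have "\<dots> \<le> 2 * ((128 * K + 4) * \<Lambda> ^ 4 / real n ^ 4) + 4 * \<mu>\<^sup>2"
      proof -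
        have "(128 * K + 4) * 1 \<le> (128 * K + 4) * \<Lambda> ^ 4" using K \<Lambda>pow by (intro mult_left_mono) auto
        then show ?thesis by (intro add_right_mono mult_left_mono divide_right_mono) auto
      qed
      also have "\<dots> = C1 * (\<Lambda> ^ 4 / real n ^ 4)"
        by (simp add: C1_def \<mu>_def power_mult_distrib power_divide add_divide_distrib algebra_simps)
      finally show ?thesis .
    qed
    have h1n: "\<epsilon>\<^sup>2 * integral D (\<lambda>x. (g x)\<^sup>2) \<le> C2 * (\<Lambda> ^ 4 / real n ^ 2)"
    proof -
      have L: "L2 (\<lambda>x. \<epsilon> * \<phi>' x)" "L2 (\<lambda>x. \<epsilon> * E' x)"
        using H1_deriv_L2[OF H\<phi>] H1_deriv_L2[OF HE] by (auto intro: L2_scale)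
      have "\<epsilon>\<^sup>2 * integral D (\<lambda>x. (g x)\<^sup>2) = integral D (\<lambda>x. (\<epsilon> * \<phi>' x + \<epsilon> * E' x)\<^sup>2)"
        by (simp add: g_def power_mult_distrib flip: distrib_left)
      also have "\<dots> \<le> 2 * integral D (\<lambda>x. (\<epsilon> * \<phi>' x)\<^sup>2) + 4 * \<mu>'\<^sup>2"
        using Eb(2) by (intro L2_perturbation[of _ _ "{-1, a3}"] L) auto
      also have "integral D (\<lambda>x. (\<epsilon> * \<phi>' x)\<^sup>2) = \<epsilon>\<^sup>2 * integral D (\<lambda>x. (\<phi>' x)\<^sup>2)"
        by (simp add: power_mult_distrib)
      also have "\<dots> \<le> 1 * ((8 * K + 1) / real n ^ 2)"
        using \<epsilon> smooth_sq(2) H1_deriv_L2[OF H\<phi>]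
        by (intro mult_mono Henstock_Kurzweil_Integration.integral_nonneg L2_power2_integrable_on)
          (auto simp: power_le_one)
      also have "1 * ((8 * K + 1) / real n ^ 2) \<le> (8 * K + 1) * \<Lambda> ^ 4 / real n ^ 2"
      proof -
        have "(8 * K + 1) * 1 \<le> (8 * K + 1) * \<Lambda> ^ 4" using K \<Lambda>pow by (intro mult_left_mono) auto
        then show ?thesis by (simp add: divide_right_mono)
      qed
      also have "4 * \<mu>'\<^sup>2 = 4 * (8 * K * sqrt b)\<^sup>2 * (\<Lambda>\<^sup>2 / real n ^ 2)"
        by (simp add: \<mu>'_def power_mult_distrib power_divide)
      also have "\<dots> \<le> 4 * (8 * K * sqrt b)\<^sup>2 * (\<Lambda> ^ 4 / real n ^ 2)"
        using \<Lambda>pow by (intro mult_left_mono divide_right_mono) auto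
      finally show ?thesis by (simp add: C2_def add_divide_distrib algebra_simps)
    qed
    have Lerr: "L2 (\<lambda>x. \<phi> x + E x)" "L2 g" using H1_deriv_L2_self[OF Herr] H1_deriv_L2[OF Herr] .
    have n4: "\<Lambda> ^ 4 / real n ^ 4 \<le> \<Lambda> ^ 4 / real n ^ 2"
      using n \<Lambda> by (intro divide_left_mono power_increasing) auto
    have energy: "energy_norm \<epsilon> b (\<lambda>x. \<phi> x + E x) g \<le> C * \<Lambda>\<^sup>2 / real n"
    proof (rule energy_norm_le[OF Lerr])
      have "b * integral D (\<lambda>x. (\<phi> x + E x)\<^sup>2) \<le> b * (C1 * (\<Lambda> ^ 4 / real n ^ 2))"
        using l2 mult_left_mono[OF n4 C1] b by (intro mult_left_mono) auto
      then have "\<epsilon>\<^sup>2 * integral D (\<lambda>x. (g x)\<^sup>2) + b * integral D (\<lambda>x. (\<phi> x + E x)\<^sup>2) \<le>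
        (C2 + b * C1) * (\<Lambda> ^ 4 / real n ^ 2)" using h1n by (simp add: algebra_simps add_divide_distrib)
      also have "\<dots> \<le> C\<^sup>2 * (\<Lambda> ^ 4 / real n ^ 2)" using C CC by (intro mult_right_mono) auto
      also have "\<dots> = (C * \<Lambda>\<^sup>2 / real n)\<^sup>2" by (simp add: power_divide power_mult_distrib)
      finally show "\<epsilon>\<^sup>2 * integral D (\<lambda>x. (g x)\<^sup>2) + b * integral D (\<lambda>x. (\<phi> x + E x)\<^sup>2) \<le> (C * \<Lambda>\<^sup>2 / real n)\<^sup>2" .
    qed (use b C in auto)
    have L2n: "L2_norm_I (\<lambda>x. \<phi> x + E x) \<le> C * \<Lambda>\<^sup>2 / real n ^ 2"
    proof (rule L2_norm_le[OF Lerr(1)])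
      have "C1 * (\<Lambda> ^ 4 / real n ^ 4) \<le> C\<^sup>2 * (\<Lambda> ^ 4 / real n ^ 4)" using C CC by (intro mult_right_mono) auto
      also have "\<dots> = (C * \<Lambda>\<^sup>2 / real n ^ 2)\<^sup>2" by (simp add: power_divide power_mult_distrib)
      finally show "integral D (\<lambda>x. (\<phi> x + E x)\<^sup>2) \<le> (C * \<Lambda>\<^sup>2 / real n ^ 2)\<^sup>2" using l2 by linarith
    qed (use C in auto)
    \<comment> \<open>The unit 1 / n^2 of the rounding and the coefficients A and B enter as real
      output weights, so only w and the two pure exponentials are quantized.\<close>
    have "\<exists>\<Phi>. relu_network \<Phi> \<and> width \<Phi> \<le> 50 \<and> depth \<Phi> \<le> 9 * (m + 1) + 6 * (m * (N + 1)) + 8 \<and>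
      1 \<le> size_nn \<Phi> \<and> size_nn \<Phi> \<le> 2550 * (9 * (m + 1) + 6 * (m * (N + 1)) + 8) \<and>
      R \<Phi> = (\<lambda>x. 1 / real n ^ 2 * pl n (quantized n (-1) h1 w) ((x - (-1)) / h1) +
        A / real n ^ 2 * pl n (quantized n (-1) h v2) ((x - (-1)) / h) +
        B / real n ^ 2 * pl n (quantized n a3 h v3) ((x - a3) / h))"
      unfolding n_def
    proof (rule network_three_interpolants[OF m N _ h(1) h(1)], fold n_def)
      show "0 < h1" by (rule h1)
      show "\<bar>w x\<bar> \<le> K + 1" if "-1 \<le> x" "x \<le> -1 + real n * h1" for x
        using wK[of x] that h1 by auto
      show "\<bar>v2 x\<bar> \<le> K + 1" if "-1 \<le> x" "x \<le> -1 + real n * h" for x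
      proof -
        have "0 \<le> v2 x" by (simp add: v2_def)
        then show ?thesis using in2[of x] that K by linarith
      qed
      show "\<bar>v3 x\<bar> \<le> K + 1" if "a3 \<le> x" "x \<le> a3 + real n * h" for x
      proof -
        have "0 \<le> v3 x" by (simp add: v3_def)
        then show ?thesis using in3[of x] that K h unfolding a3_def by linarith
      qed
    qed
    then obtain \<Phi> where \<Phi>: "relu_network \<Phi>" "width \<Phi> \<le> 50" "depth \<Phi> \<le> 9 * (m + 1) + 6 * (m * (N + 1)) + 8"
      "1 \<le> size_nn \<Phi>" "size_nn \<Phi> \<le> 2550 * (9 * (m + 1) + 6 * (m * (N + 1)) + 8)"
      and R: "\<And>x. R \<Phi> x = p1 x + A * p2 x + B * p3 x" by (auto simp: p1_def p2_def p3_def)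
    have eq: "\<phi> x + E x = u x - R \<Phi> x" if "x \<in> D" for x
    proof -
      have "v2 x = exp (- sqrt b / \<epsilon> * (1 + x))" "v3 x = exp (- sqrt b / \<epsilon> * (1 - x))"
        by (simp_all add: v2_def v3_def c_def algebra_simps add_divide_distrib diff_divide_distrib)
      then show ?thesis using u[OF that] by (simp add: \<phi>_def E_def R algebra_simps)
    qed
    have "H1_deriv (\<lambda>x. u x - R \<Phi> x) g" by (rule H1_deriv_cong[OF Herr eq])
    moreover have "energy_norm \<epsilon> b (\<lambda>x. u x - R \<Phi> x) g = energy_norm \<epsilon> b (\<lambda>x. \<phi> x + E x) g"
      unfolding energy_norm_def using eq by (intro arg_cong[of _ _ sqrt] set_lebesgue_integral_cong) auto
    moreover have "L2_norm_I (\<lambda>x. u x - R \<Phi> x) = L2_norm_I (\<lambda>x. \<phi> x + E x)"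
      unfolding L2_norm_I_def using eq by (intro arg_cong[of _ _ sqrt] set_lebesgue_integral_cong) auto
    ultimately show "\<exists>\<Phi>. relu_network \<Phi> \<and> width \<Phi> \<le> 50 \<and> depth \<Phi> \<le> 9 * (m + 1) + 6 * (m * (N + 1)) + 8 \<and>
      1 \<le> size_nn \<Phi> \<and> size_nn \<Phi> \<le> 2550 * (9 * (m + 1) + 6 * (m * (N + 1)) + 8) \<and>
      (\<exists>g. H1_deriv (\<lambda>x. u x - R \<Phi> x) g \<and>
        energy_norm \<epsilon> b (\<lambda>x. u x - R \<Phi> x) g \<le> C * (ln (real (m * m)))\<^sup>2 / real (m * m)) \<and>
      L2_norm_I (\<lambda>x. u x - R \<Phi> x) \<le> C * (ln (real (m * m)))\<^sup>2 / real (m * m) ^ 2"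
      using \<Phi> energy L2n unfolding \<Lambda>_def n_def[symmetric] by (intro exI[of _ \<Phi>]) auto
  qed
qed

section \<open>Logarithms against small powers\<close>

lemma ln_sq_powr_bound:
  fixes m :: nat
  assumes "1 \<le> m" "0 < \<theta>"
  shows "(ln (real (m * m)))\<^sup>2 \<le> 16 / \<theta>\<^sup>2 * real m powr \<theta>"
proof -
  have "ln (real m) \<le> real m powr (\<theta> / 2) / (\<theta> / 2)" using assms by (intro ln_powr_bound) auto
  moreover have "ln (real (m * m)) = 2 * ln (real m)" using assms by (simp add: ln_mult)
  moreover have "0 \<le> ln (real m)" using assms by simp
  ultimately have "(ln (real (m * m)))\<^sup>2 \<le> (2 * (real m powr (\<theta> / 2) / (\<theta> / 2)))\<^sup>2"
    by (intro power_mono) auto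
  also have "\<dots> = 16 / \<theta>\<^sup>2 * real m powr \<theta>"
  proof -
    have "(real m powr (\<theta> / 2))\<^sup>2 = real m powr \<theta>" by (simp add: power2_eq_square flip: powr_add)
    moreover have "2 * (real m powr (\<theta> / 2) / (\<theta> / 2)) = 4 * real m powr (\<theta> / 2) / \<theta>" by simp
    ultimately show ?thesis by (simp only: power_divide power_mult_distrib) simp
  qed
  finally show ?thesis .
qed

text \<open>The bit count is measured in the same power m powr \<theta> as the logarithm in the
  error, so that one exponent accounts for both losses.\<close>

lemma bit_count_exists:
  fixes V \<theta> :: real
  assumes "1 \<le> V" "0 < \<theta>"
  shows "\<exists>c\<ge>0. \<forall>m\<ge>1. \<exists>N. 4 * (real (m * m) ^ 2 * V + 1) < 2 ^ N \<and> real (N + 1) \<le> c * real m powr \<theta>"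
proof -
  define c where "c = log 2 (8 * V) + 3 + 4 / (\<theta> * ln 2)"
  have lV: "0 \<le> log 2 (8 * V)" using assms by simp
  have lt: "0 < 4 / (\<theta> * ln 2)" using assms by simp
  have "0 \<le> c" using lV lt by (simp add: c_def)
  moreover have "\<exists>N. 4 * (real (m * m) ^ 2 * V + 1) < 2 ^ N \<and> real (N + 1) \<le> c * real m powr \<theta>"
    if m: "1 \<le> m" for m :: nat
  proof -
    define X where "X = 8 * V * real m ^ 4"
    have m4: "1 \<le> real m ^ 4" using m by simp
    have "1 * 1 \<le> V * real m ^ 4" using assms m4 by (intro mult_mono) auto
    then have X: "4 * (real (m * m) ^ 2 * V + 1) \<le> X" "1 \<le> X"
      by (auto simp: X_def power2_eq_square power4_eq_xxxx algebra_simps)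
    define N where "N = nat \<lceil>log 2 X\<rceil> + 1"
    have lX: "0 \<le> log 2 X" using X by simp
    have "X = 2 powr (log 2 X)" using X by simp
    also have "\<dots> \<le> 2 powr real (nat \<lceil>log 2 X\<rceil>)" by (intro powr_mono real_nat_ceiling_ge) auto
    also have "\<dots> = 2 ^ nat \<lceil>log 2 X\<rceil>" by (simp add: powr_realpow)
    also have "\<dots> < 2 ^ N" by (simp add: N_def)
    finally have "4 * (real (m * m) ^ 2 * V + 1) < 2 ^ N" using X by linarith
    moreover have "real (N + 1) \<le> c * real m powr \<theta>"
    proof -
      have mp: "1 \<le> real m powr \<theta>" using m assms by (intro ge_one_powr_ge_zero) auto
      have "real (N + 1) \<le> log 2 X + 3" using lX by (simp add: N_def) linarith
      also have "log 2 X = log 2 (8 * V) + 4 * log 2 (real m)"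
        using assms m by (simp add: X_def log_mult log_nat_power)
      also have "log 2 (real m) \<le> real m powr \<theta> / (\<theta> * ln 2)"
        using ln_powr_bound[of "real m" \<theta>] m assms by (simp add: log_def divide_right_mono flip: divide_divide_eq_left)
      also have "log 2 (8 * V) + 4 * (real m powr \<theta> / (\<theta> * ln 2)) + 3 \<le> c * real m powr \<theta>"
      proof -
        have "(log 2 (8 * V) + 3) * 1 \<le> (log 2 (8 * V) + 3) * real m powr \<theta>"
          using lV mp by (intro mult_left_mono) auto
        then show ?thesis unfolding c_def by (simp add: distrib_right)
      qed
      finally show ?thesis by simp
    qed
    ultimately show ?thesis by blast
  qed
  ultimately show ?thesis by blast
qed

text \<open>The inequality is x powr (2 - \<theta>) \<ge> c / \<tau> rearranged. The threshold fixes
  the number m of blocks in terms of \<tau>.\<close>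

lemma powr_threshold:
  fixes c \<tau> \<theta> x :: real
  assumes "0 < c" "0 < \<tau>" "\<theta> < 2" "(c / \<tau>) powr (1 / (2 - \<theta>)) \<le> x"
  shows "c * x powr \<theta> / x ^ 2 \<le> \<tau>"
proof -
  have x: "0 < x" using assms by (smt (verit) powr_gt_zero divide_pos_pos)
  have "c / \<tau> = ((c / \<tau>) powr (1 / (2 - \<theta>))) powr (2 - \<theta>)" using assms by (simp add: powr_powr)
  also have "\<dots> \<le> x powr (2 - \<theta>)" using assms by (intro powr_mono2) auto
  also have "\<dots> = x ^ 2 / x powr \<theta>" using x by (simp add: powr_diff)
  finally show ?thesis using x assms by (simp add: field_simps)
qed

theorem theorem4p8:
  fixes b \<delta> :: real and f :: "real \<Rightarrow> real"
  assumes "b > 0" and "H2 f" and "0 < \<delta>" and "\<delta> < 1"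
  shows "\<exists>C C\<^sub>\<delta> Ct\<^sub>\<delta> \<tau>\<^sub>0. C > 0 \<and> C\<^sub>\<delta> > 0 \<and> Ct\<^sub>\<delta> > 0 \<and> \<tau>\<^sub>0 > 0 \<and>
    (\<forall>\<tau> \<epsilon> u u'. 0 < \<tau> \<and> \<tau> \<le> 1 \<and> 0 < \<epsilon> \<and> \<epsilon> \<le> 1 \<and> weak_solution \<epsilon> b f u u' \<longrightarrow>
      (\<exists>\<Phi>. relu_network \<Phi> \<and>
         (\<tau> \<le> \<tau>\<^sub>0 \<longrightarrow> real (width \<Phi>) \<le> C * (log 2 \<tau>)\<^sup>2) \<and>
         real (depth \<Phi>) \<le> C * \<tau> powr (-1 / (2 * (1 - \<delta>))) \<and>
         real (size_nn \<Phi>) \<le> C\<^sub>\<delta> * \<tau> powr (-1 / (2 * (1 - \<delta>))) \<and>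
         (\<exists>g. H1_deriv (\<lambda>x. u x - R \<Phi> x) g \<and>
              energy_norm \<epsilon> b (\<lambda>x. u x - R \<Phi> x) g \<le> \<tau>) \<and>
         \<tau> \<le> Ct\<^sub>\<delta> * real (size_nn \<Phi>) powr (-2 * (1 - \<delta>)) \<and>
         L2_norm_I (\<lambda>x. u x - R \<Phi> x) \<le> \<tau>\<^sup>2 \<and>
         \<tau>\<^sup>2 \<le> Ct\<^sub>\<delta>\<^sup>2 * real (size_nn \<Phi>) powr (-4 * (1 - \<delta>))))"
proof -
  \<comment> \<open>The exponent of 1 / \<tau> allowed for depth and size. It exceeds 1 / 2 because
    \<delta> is positive, and this leaves room for \<theta> > 0.\<close>
  define \<gamma> where "\<gamma> = 1 / (2 * (1 - \<delta>))"
  have \<gamma>: "1 / 2 < \<gamma>" "2 * (1 - \<delta>) * \<gamma> = 1" "- 1 / (2 * (1 - \<delta>)) = - \<gamma>"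
    using assms(3,4) by (auto simp: \<gamma>_def field_simps)
  \<comment> \<open>This choice makes \<open>(1 + \<theta>) / (2 - \<theta>) = \<gamma>\<close>.\<close>
  define \<theta> where "\<theta> = (2 * \<gamma> - 1) / (1 + \<gamma>)"
  have \<theta>: "0 < \<theta>" "\<theta> < 2" "1 / (2 - \<theta>) * (1 + \<theta>) = \<gamma>"
  proof -
    show "0 < \<theta>" "\<theta> < 2" using \<gamma> by (auto simp: \<theta>_def field_simps)
    have "2 - \<theta> = 3 / (1 + \<gamma>)" "1 + \<theta> = 3 * \<gamma> / (1 + \<gamma>)" using \<gamma> by (auto simp: \<theta>_def field_simps)
    moreover have "1 + \<gamma> \<noteq> 0" using \<gamma> by linarith
    ultimately show "1 / (2 - \<theta>) * (1 + \<theta>) = \<gamma>" by simp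
  qed
  define q where "q = 1 / (2 - \<theta>)"
  have q: "0 < q" "q * (1 + \<theta>) = \<gamma>" using \<theta> by (auto simp: q_def)
  obtain C V where CV: "1 \<le> C" "1 \<le> V" and approx:
    "\<And>m N \<epsilon> u u'. 3 \<le> m \<and> 4 * (real (m * m) ^ 2 * V + 1) < 2 ^ N \<and>
      0 < \<epsilon> \<and> \<epsilon> \<le> 1 \<and> weak_solution \<epsilon> b f u u' \<Longrightarrow>
    (\<exists>\<Phi>. relu_network \<Phi> \<and> width \<Phi> \<le> 50 \<and> depth \<Phi> \<le> 9 * (m + 1) + 6 * (m * (N + 1)) + 8 \<and>
      1 \<le> size_nn \<Phi> \<and> size_nn \<Phi> \<le> 2550 * (9 * (m + 1) + 6 * (m * (N + 1)) + 8) \<and>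
      (\<exists>g. H1_deriv (\<lambda>x. u x - R \<Phi> x) g \<and>
        energy_norm \<epsilon> b (\<lambda>x. u x - R \<Phi> x) g \<le> C * (ln (real (m * m)))\<^sup>2 / real (m * m)) \<and>
      L2_norm_I (\<lambda>x. u x - R \<Phi> x) \<le> C * (ln (real (m * m)))\<^sup>2 / real (m * m) ^ 2)"
    using network_approximation[OF assms(1,2)] by blast
  obtain cN where cN: "0 \<le> cN" and bits: "\<And>m. 1 \<le> m \<Longrightarrow>
      \<exists>N. 4 * (real (m * m) ^ 2 * V + 1) < 2 ^ N \<and> real (N + 1) \<le> cN * real m powr \<theta>"
    using bit_count_exists[OF CV(2) \<theta>(1)] by blast
  \<comment> \<open>The factor C (ln n)^2 of the error is at most c * m powr \<theta>. The summand 1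
    gives c \<ge> 1, which makes the threshold X at least 1.\<close>
  define c where "c = C * (16 / \<theta>\<^sup>2) + 1"
  have c: "1 \<le> c" using CV by (simp add: c_def)
  \<comment> \<open>26 comes from 9 (m + 1) + 8 \<le> 26 m, and 5 from m \<le> X + 4 \<le> 5
    X.\<close>
  define cP where "cP = (26 + 6 * cN) * (5 * c powr q) powr (1 + \<theta>)"
  have cP: "0 < cP" using cN c by (simp add: cP_def)
  define cS where "cS = 2550 * cP"
  have cS: "0 < cS" using cP by (simp add: cS_def)
  define cT where "cT = cS powr (2 * (1 - \<delta>))"
  have cT: "0 < cT" using cS by (simp add: cT_def)
  \<comment> \<open>The width is at most 50, but log 2 \<tau> vanishes at \<tau> = 1; for \<tau>
    \<le> 1 / 2 its square is at least 1. The constant cP + 50 serves depth and width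
    together.\<close>
  have main: "\<exists>\<Phi>. relu_network \<Phi> \<and> (\<tau> \<le> 1 / 2 \<longrightarrow> real (width \<Phi>) \<le> (cP + 50) * (log 2 \<tau>)\<^sup>2) \<and>
         real (depth \<Phi>) \<le> (cP + 50) * \<tau> powr (- \<gamma>) \<and>
         real (size_nn \<Phi>) \<le> cS * \<tau> powr (- \<gamma>) \<and>
         (\<exists>g. H1_deriv (\<lambda>x. u x - R \<Phi> x) g \<and>
              energy_norm \<epsilon> b (\<lambda>x. u x - R \<Phi> x) g \<le> \<tau>) \<and>
         \<tau> \<le> cT * real (size_nn \<Phi>) powr (-2 * (1 - \<delta>)) \<and>
         L2_norm_I (\<lambda>x. u x - R \<Phi> x) \<le> \<tau>\<^sup>2 \<and>
         \<tau>\<^sup>2 \<le> cT\<^sup>2 * real (size_nn \<Phi>) powr (-4 * (1 - \<delta>))"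
    if H: "0 < \<tau> \<and> \<tau> \<le> 1 \<and> 0 < \<epsilon> \<and> \<epsilon> \<le> 1 \<and> weak_solution \<epsilon> b f u u'" for \<tau> \<epsilon> u u'
  proof -
    have \<tau>: "0 < \<tau>" "\<tau> \<le> 1" using H by auto
    define X where "X = (c / \<tau>) powr q"
    have "1 \<le> c / \<tau>" using c \<tau> by (simp add: field_simps)
    then have X: "1 \<le> X" unfolding X_def using q by (intro ge_one_powr_ge_zero) auto
    define m where "m = 3 + nat \<lceil>X\<rceil>"
    have m: "3 \<le> m" "X \<le> real m" "real m \<le> 5 * X"
    proof -
      show "3 \<le> m" by (simp add: m_def)
      have "real (nat \<lceil>X\<rceil>) = of_int \<lceil>X\<rceil>" using X by simp
      then have "X \<le> real (nat \<lceil>X\<rceil>)" "real (nat \<lceil>X\<rceil>) \<le> X + 1" by linarith+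
      moreover have "real m = 3 + real (nat \<lceil>X\<rceil>)" by (simp only: m_def of_nat_add of_nat_numeral)
      ultimately show "X \<le> real m" "real m \<le> 5 * X" using X by linarith+
    qed
    define P where "P = real m powr (1 + \<theta>)"
    have mP: "real m \<le> P" "1 \<le> real m powr \<theta>" "real m * real m powr \<theta> = P"
    proof -
      show "1 \<le> real m powr \<theta>" using m \<theta> by (intro ge_one_powr_ge_zero) auto
      then show "real m \<le> P" "real m * real m powr \<theta> = P" using m by (auto simp: P_def powr_add)
    qed
    obtain N where N: "4 * (real (m * m) ^ 2 * V + 1) < 2 ^ N" "real (N + 1) \<le> cN * real m powr \<theta>"
      using bits[of m] m by auto
    have layers: "real (9 * (m + 1) + 6 * (m * (N + 1)) + 8) \<le> cP * \<tau> powr (- \<gamma>)"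
    proof -
      have "real m * real (N + 1) \<le> real m * (cN * real m powr \<theta>)" using N by (intro mult_left_mono) auto
      also have "\<dots> = cN * P" using mP(3) by (simp add: mult.left_commute)
      finally have "real (9 * (m + 1) + 6 * (m * (N + 1)) + 8) \<le> 26 * real m + 6 * (cN * P)"
        using m by (simp only: of_nat_add of_nat_mult of_nat_numeral of_nat_1) simp
      also have "\<dots> \<le> (26 + 6 * cN) * P" using mP by (simp add: algebra_simps)
      also have "P \<le> (5 * X) powr (1 + \<theta>)" unfolding P_def using m \<theta> by (intro powr_mono2) auto
      also have "5 * X = (5 * c powr q) * \<tau> powr (- q)"
        using c \<tau> by (simp add: X_def powr_divide powr_minus_divide)
      also have "\<dots> powr (1 + \<theta>) = (5 * c powr q) powr (1 + \<theta>) * \<tau> powr (- q * (1 + \<theta>))"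
        using c \<tau> by (subst powr_mult) (auto simp: powr_powr)
      finally show ?thesis using cN q by (simp add: cP_def mult.assoc)
    qed
    obtain \<Phi> g where \<Phi>: "relu_network \<Phi>" "width \<Phi> \<le> 50" "depth \<Phi> \<le> 9 * (m + 1) + 6 * (m * (N + 1)) + 8"
      "1 \<le> size_nn \<Phi>" "size_nn \<Phi> \<le> 2550 * (9 * (m + 1) + 6 * (m * (N + 1)) + 8)"
      and g: "H1_deriv (\<lambda>x. u x - R \<Phi> x) g"
        "energy_norm \<epsilon> b (\<lambda>x. u x - R \<Phi> x) g \<le> C * (ln (real (m * m)))\<^sup>2 / real (m * m)"
      and l2: "L2_norm_I (\<lambda>x. u x - R \<Phi> x) \<le> C * (ln (real (m * m)))\<^sup>2 / real (m * m) ^ 2"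
      using approx[of m N \<epsilon> u u'] m N H by blast
    define e where "e = C * (ln (real (m * m)))\<^sup>2"
    have e1: "1 \<le> e"
    proof -
      have "9 \<le> m * m" using mult_le_mono[OF m(1) m(1)] by simp
      then have "real 9 \<le> real (m * m)" by (rule of_nat_mono)
      then have "exp 1 \<le> real (m * m)" using exp_le unfolding of_nat_numeral by linarith
      then have "1 \<le> ln (real (m * m))" using m by (subst ln_ge_iff) auto
      then have "1 * 1 \<le> C * (ln (real (m * m)))\<^sup>2" using CV by (intro mult_mono) auto
      then show ?thesis by (simp add: e_def)
    qed
    have "e \<le> C * (16 / \<theta>\<^sup>2 * real m powr \<theta>)"
      unfolding e_def using CV m \<theta> by (intro mult_left_mono ln_sq_powr_bound) auto
    also have "\<dots> \<le> c * real m powr \<theta>" by (simp add: c_def distrib_right mult.assoc)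
    finally have "e / real (m * m) \<le> c * real m powr \<theta> / real m ^ 2"
      by (simp add: divide_right_mono power2_eq_square)
    also have "\<dots> \<le> \<tau>" using c \<tau> \<theta> m by (intro powr_threshold) (auto simp: X_def q_def)
    finally have e\<tau>: "e / real (m * m) \<le> \<tau>" .
    \<comment> \<open>As e \<ge> 1, the L2 bound e / n^2 lies below the square of the energy bound e
      / n, so one choice of m meets both accuracies.\<close>
    have "e / real (m * m) ^ 2 \<le> e\<^sup>2 / real (m * m) ^ 2"
      using e1 by (intro divide_right_mono) (auto simp: power2_eq_square)
    also have "\<dots> = (e / real (m * m))\<^sup>2" by (simp add: power_divide)
    also have "\<dots> \<le> \<tau>\<^sup>2" using e\<tau> e1 by (intro power_mono) auto
    finally have e\<tau>2: "e / real (m * m) ^ 2 \<le> \<tau>\<^sup>2" .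
    define M where "M = real (size_nn \<Phi>)"
    have M: "1 \<le> M" "M \<le> cS * \<tau> powr (- \<gamma>)"
    proof -
      show "1 \<le> M" using \<Phi>(4) by (simp add: M_def)
      have "M \<le> real (2550 * (9 * (m + 1) + 6 * (m * (N + 1)) + 8))"
        unfolding M_def by (rule of_nat_mono[OF \<Phi>(5)])
      also have "\<dots> = 2550 * real (9 * (m + 1) + 6 * (m * (N + 1)) + 8)" by (simp only: of_nat_mult of_nat_numeral)
      also have "\<dots> \<le> 2550 * (cP * \<tau> powr (- \<gamma>))" using layers by (intro mult_left_mono) auto
      finally show "M \<le> cS * \<tau> powr (- \<gamma>)" by (simp add: cS_def)
    qed
    \<comment> \<open>The size bound M \<le> cS * \<tau> powr (- \<gamma>) solved for \<tau>: the
      exponents 2 (1 - \<delta>) and \<gamma> are reciprocal.\<close>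
    have rate: "\<tau> \<le> cT * M powr (-2 * (1 - \<delta>))"
    proof -
      have "M powr (2 * (1 - \<delta>)) \<le> (cS * \<tau> powr (- \<gamma>)) powr (2 * (1 - \<delta>))"
        using M assms by (intro powr_mono2) auto
      also have "\<dots> = cT * \<tau> powr (- (2 * (1 - \<delta>) * \<gamma>))"
        using cS \<tau> by (subst powr_mult) (auto simp: cT_def powr_powr mult.commute)
      also have "\<dots> = cT / \<tau>" using \<tau> \<gamma>(2) by (simp add: powr_minus_divide)
      finally have "M powr (2 * (1 - \<delta>)) * \<tau> \<le> cT" using \<tau> by (simp add: field_simps)
      moreover have "0 < M powr (2 * (1 - \<delta>))" using M by simp
      moreover have "M powr (-2 * (1 - \<delta>)) = 1 / M powr (2 * (1 - \<delta>))"
        unfolding mult_minus_left by (rule powr_minus_divide)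
      ultimately show ?thesis by (simp only: times_divide_eq_right mult_1_right pos_le_divide_eq mult.commute)
    qed
    have "\<tau>\<^sup>2 \<le> (cT * M powr (-2 * (1 - \<delta>)))\<^sup>2" using rate \<tau> by (intro power_mono) auto
    also have "\<dots> = cT\<^sup>2 * M powr (-4 * (1 - \<delta>))"
      using M by (simp add: power_mult_distrib power2_eq_square flip: powr_add)
    finally have rate2: "\<tau>\<^sup>2 \<le> cT\<^sup>2 * M powr (-4 * (1 - \<delta>))" .
    have wd: "real (width \<Phi>) \<le> (cP + 50) * (log 2 \<tau>)\<^sup>2" if "\<tau> \<le> 1 / 2"
    proof -
      have "log 2 \<tau> \<le> log 2 (1 / 2)" using that \<tau> by simp
      then have "1 \<le> - log 2 \<tau>" by (simp add: log_divide)
      then have "1\<^sup>2 \<le> (- log 2 \<tau>)\<^sup>2" by (intro power_mono) auto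
      then have "(cP + 50) * 1 \<le> (cP + 50) * (log 2 \<tau>)\<^sup>2" using cP by (intro mult_left_mono) auto
      moreover have "real (width \<Phi>) \<le> (cP + 50) * 1" using \<Phi>(2) cP by simp
      ultimately show ?thesis by (rule order_trans[rotated])
    qed
    have "real (depth \<Phi>) \<le> cP * \<tau> powr (- \<gamma>)" using of_nat_mono[OF \<Phi>(3), where ?'a = real] layers by linarith
    also have "\<dots> \<le> (cP + 50) * \<tau> powr (- \<gamma>)" by (intro mult_right_mono) auto
    finally have dp: "real (depth \<Phi>) \<le> (cP + 50) * \<tau> powr (- \<gamma>)" .
    show ?thesis
      using \<Phi>(1) wd dp M(2) g l2 rate rate2 e\<tau> e\<tau>2 unfolding M_def e_def
      by (intro exI[of _ \<Phi>]) (auto intro: order_trans)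
  qed
  show ?thesis unfolding \<gamma>(3)
    using main cP cS cT
    by (intro exI[of _ "cP + 50"] exI[of _ cS] exI[of _ cT] exI[of _ "1 / 2"]) auto
qed

end
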